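(* Every $a\in W(K)$ is equivalent modulo $\wp W(K)$ to a unique vector $b\in W(K)$ of the form $$b=c\beta+\sum_{x\in\mathbb P^1_k(\overline k)}\ \sum_{(i,p)=1}c_{x,i}[\pi_x]^{-i}\in W(K)\subset W(\overline k(X))$$ with $c\in W(\mathbb F_p)$, $c_{x,i}\in W(\overline k)$ such that (i) for $\sigma\in\mathrm{Gal}(\overline k/k)$ and $x\in\mathbb P^1_k(\overline k)$: $c_{\sigma x,i}=\sigma c_{x,i}$; (ii) for every integer $n\ge1$ there are only finitely many $c_{x,i}$ with $v(c_{x,i})\le n$.
   Context: Let $k$ be a finite field of characteristic $p$, $\overline k$ an algebraic closure, $K=k(X)$ the rational function field. For $x\in\overline k$ put $\pi_x=X-x\in\overline k(X)$, and $\pi_\infty=1/X$. $W(\cdot)$ denotes $p$-typical Witt vectors, $F$ the Frobenius on Witt vectors, $\wp=F-\mathrm{id}$, $[a]=(a,0,0,\ldots)$ the Teichmüller lift. Fix $\alpha\in k$ with $\mathrm{Tr}_{k/\mathbb F_p}(\alpha)\ne0$ and set $\beta=[\alpha]$. $i$ runs over integers $i\ge1$ prime to $p$. $v$ on $W(\overline k)$ is the $p$-adic valuation ($v(a_0,a_1,\ldots)$ is the least $j$ with $a_j\ne0$, $v(0)=\infty$). Infinite sums converge in the topology on $W(\overline k(X))$ with basis at $0$ given by $V^jW(\overline k(X))$, $V$ the Verschiebung. *)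

theory Defs
  imports
    "HOL-Algebra.Algebraic_Closure_Type"
    "HOL-Computational_Algebra.Polynomial_Factorial"
    "HOL-Library.Poly_Mapping"
    "HOL-Library.Extended_Nat"
begin

section \<open>Witt vectors\<close>

text \<open>
  A Witt vector over \<open>R\<close> is its sequence of components, an element of \<^typ>\<open>nat \<Rightarrow> 'a\<close>.
  Ring homomorphisms \<open>f\<close> act on Witt vectors by \<^term>\<open>\<lambda>a. f \<circ> a\<close>.
\<close>

definition witt_poly :: "nat \<Rightarrow> nat \<Rightarrow> (nat \<Rightarrow> 'a::comm_ring_1) \<Rightarrow> 'a" where
  "witt_poly p n a = (\<Sum>i\<le>n. of_nat p ^ i * a i ^ (p ^ (n - i)))"

type_synonym int_mpoly = "(nat \<Rightarrow>\<^sub>0 nat) \<Rightarrow>\<^sub>0 int"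

definition mpoly_var :: "nat \<Rightarrow> int_mpoly" where
  "mpoly_var v = Poly_Mapping.single (Poly_Mapping.single v 1) 1"

definition mpoly_eval :: "(nat \<Rightarrow> 'a::comm_ring_1) \<Rightarrow> int_mpoly \<Rightarrow> 'a" where
  "mpoly_eval f P = (\<Sum>m\<in>Poly_Mapping.keys P. of_int (Poly_Mapping.lookup P m) *
     (\<Prod>v\<in>Poly_Mapping.keys m. f v ^ Poly_Mapping.lookup m v))"

text \<open>
  For \<open>p\<close> prime and \<open>h\<close> addition or multiplication, \<open>witt_op_polys p h\<close> is the unique sequence
  of integral polynomials \<open>S\<^sub>n\<close> in the variables \<open>X\<^sub>0, Y\<^sub>0, X\<^sub>1, Y\<^sub>1, \<dots>\<close> with
  \<open>w\<^sub>n(S\<^sub>0, S\<^sub>1, \<dots>) = h (w\<^sub>n(X)) (w\<^sub>n(Y))\<close> for all \<open>n\<close>, where \<open>w\<^sub>n\<close> is the \<open>n\<close>-th Witt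
  polynomial. \<open>X\<^sub>i\<close> is variable number \<open>2 i\<close> and \<open>Y\<^sub>i\<close> is variable number \<open>2 i + 1\<close>.
\<close>

definition witt_op_polys ::
    "nat \<Rightarrow> (int_mpoly \<Rightarrow> int_mpoly \<Rightarrow> int_mpoly) \<Rightarrow> nat \<Rightarrow> int_mpoly" where
  "witt_op_polys p h = (THE S. \<forall>n. witt_poly p n S =
     h (witt_poly p n (\<lambda>i. mpoly_var (2 * i))) (witt_poly p n (\<lambda>i. mpoly_var (2 * i + 1))))"

definition witt_op ::
    "nat \<Rightarrow> (int_mpoly \<Rightarrow> int_mpoly \<Rightarrow> int_mpoly) \<Rightarrow>
     (nat \<Rightarrow> 'a::comm_ring_1) \<Rightarrow> (nat \<Rightarrow> 'a) \<Rightarrow> nat \<Rightarrow> 'a" where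
  "witt_op p h a b n =
     mpoly_eval (\<lambda>v. if even v then a (v div 2) else b (v div 2)) (witt_op_polys p h n)"

definition teichmueller :: "'a::zero \<Rightarrow> nat \<Rightarrow> 'a" where
  "teichmueller x n = (if n = 0 then x else 0)"

definition witt_ring :: "nat \<Rightarrow> (nat \<Rightarrow> 'a::comm_ring_1) ring" where
  "witt_ring p = \<lparr>carrier = UNIV, monoid.mult = witt_op p (*), one = teichmueller 1,
     zero = (\<lambda>_. 0), add = witt_op p (+)\<rparr>"

text \<open>The formula for the Frobenius is the one valid over rings of characteristic \<open>p\<close>.\<close>

definition witt_frobenius :: "nat \<Rightarrow> (nat \<Rightarrow> 'a::comm_ring_1) \<Rightarrow> nat \<Rightarrow> 'a" where
  "witt_frobenius p a n = a n ^ p"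

definition witt_wp :: "nat \<Rightarrow> (nat \<Rightarrow> 'a::comm_ring_1) \<Rightarrow> nat \<Rightarrow> 'a" where
  "witt_wp p a = witt_frobenius p a \<ominus>\<^bsub>witt_ring p\<^esub> a"

definition verschiebung :: "(nat \<Rightarrow> 'a::zero) \<Rightarrow> nat \<Rightarrow> 'a" where
  "verschiebung a n = (case n of 0 \<Rightarrow> 0 | Suc m \<Rightarrow> a m)"

definition witt_val :: "(nat \<Rightarrow> 'a::zero) \<Rightarrow> enat" where
  "witt_val a = (if a = (\<lambda>_. 0) then \<infinity> else enat (LEAST j. a j \<noteq> 0))"

text \<open>
  Unordered summation: the net of finite partial sums converges to \<open>s\<close> in the topology with
  basis \<open>V\<^sup>j W(R)\<close> at \<open>0\<close>.
\<close>

definition has_witt_sum ::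
    "nat \<Rightarrow> ('i \<Rightarrow> nat \<Rightarrow> 'a::comm_ring_1) \<Rightarrow> 'i set \<Rightarrow> (nat \<Rightarrow> 'a) \<Rightarrow> bool" where
  "has_witt_sum p f A s \<longleftrightarrow> (\<forall>j. \<forall>\<^sub>F S in finite_subsets_at_top A.
     s \<ominus>\<^bsub>witt_ring p\<^esub> finsum (witt_ring p) f S \<in> Set.range (verschiebung ^^ j))"

section \<open>Fields and rational functions\<close>

definition field_auts_fixing :: "'a::field set \<Rightarrow> ('a \<Rightarrow> 'a) set" where
  "field_auts_fixing S = {\<sigma>. bij \<sigma> \<and> (\<forall>x y. \<sigma> (x + y) = \<sigma> x + \<sigma> y) \<and>
     (\<forall>x y. \<sigma> (x * y) = \<sigma> x * \<sigma> y) \<and> (\<forall>x\<in>S. \<sigma> x = x)}"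

text \<open>Only used in positive characteristic, where the multiples of \<open>1\<close> form the prime field.\<close>

definition prime_subfield :: "'a::finite_field set" where
  "prime_subfield = Set.range of_nat"

text \<open>
  A finite field is Galois over its prime field, so the trace is the sum of the conjugates.
  It is taken with values in the field itself.
\<close>

definition abs_trace :: "'a::finite_field \<Rightarrow> 'a" where
  "abs_trace x = (\<Sum>\<sigma>\<in>field_auts_fixing prime_subfield. \<sigma> x)"

lemma map_poly_to_ac_mult:
  "map_poly to_ac (a * b) = map_poly to_ac a * map_poly to_ac b"
  by (rule poly_eqI) (simp add: coeff_map_poly coeff_mult to_ac_sum)

definition ratfun_to_ac :: "'a::field poly fract \<Rightarrow> 'a alg_closure poly fract" where
  "ratfun_to_ac r = (THE s. \<exists>a b. b \<noteq> 0 \<and> r = Fract a b \<and>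
     s = Fract (map_poly to_ac a) (map_poly to_ac b))"

lemma ratfun_to_ac_Fract:
  assumes "b \<noteq> 0"
  shows "ratfun_to_ac (Fract a b) = Fract (map_poly to_ac a) (map_poly to_ac b)"
  unfolding ratfun_to_ac_def
proof (rule the_equality)
  fix s
  assume "\<exists>c d. d \<noteq> 0 \<and> Fract a b = Fract c d \<and> s = Fract (map_poly to_ac c) (map_poly to_ac d)"
  then obtain c d where d: "d \<noteq> 0" and eq: "Fract a b = Fract c d"
    and s: "s = Fract (map_poly to_ac c) (map_poly to_ac d)"
    by blast
  have "a * d = c * b"
    using eq assms d by (simp add: eq_fract)
  then have "map_poly to_ac a * map_poly to_ac d = map_poly to_ac c * map_poly to_ac b"
    by (metis map_poly_to_ac_mult)
  then show "s = Fract (map_poly to_ac a) (map_poly to_ac b)"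
    using s assms d by (simp add: eq_fract map_poly_eq_0_iff)
qed (use assms in blast)

definition ratfun_const :: "'a::field \<Rightarrow> 'a poly fract" where
  "ratfun_const c = to_fract [:c:]"

datatype 'a proj_line = Affine 'a | Infinity

definition local_param :: "'a::field proj_line \<Rightarrow> 'a poly fract" where
  "local_param x = (case x of Affine t \<Rightarrow> to_fract [:- t, 1:] | Infinity \<Rightarrow> 1 / to_fract [:0, 1:])"

end

theory Submission
  imports Defs "HOL-Library.Cardinality"
begin

text \<open>
  By the identity \<open>F y = y + \<wp> y\<close> every \<open>V y\<close> is congruent to \<open>V F y = p y\<close> modulo \<open>\<wp>\<close>. Reducing the
  zeroth component to normal form therefore leaves a remainder that may be divided by \<open>p\<close>, and
  iterating this reduces both existence and uniqueness to length one. In length one, partial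
  fractions over \<open>'a alg_closure\<close> turn \<open>u ^ p - u\<close> into an operation on coefficients: a pole of
  order \<open>p j\<close> can be traded for a pole of order \<open>j\<close>, and comparing coefficients at the highest pole
  shows that no further cancellation is possible. The constants contribute the cokernel of
  \<open>x \<mapsto> x ^ p - x\<close> on the finite field, which the trace identifies with the prime field. Everything
  is done over \<open>'a alg_closure\<close>; rational functions fixed by \<open>x \<mapsto> x ^ q\<close> on coefficients descend to
  the finite field with \<open>q\<close> elements.

  All identities between Witt vectors are proved for vectors with components in \<open>int_mpoly\<close>, where
  the Witt polynomials are jointly injective, and then specialised.
\<close>

section \<open>Witt vectors\<close>

text \<open>Why the remainder V y is traded for VF y: since [f] V y is not V ([f] y), dividing by V
  directly would change the exponents of the local parameters from one component to the next. The
  operator VF commutes with multiplication by [f], so the pole orders i stay fixed during the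
  iteration and only the coefficients grow, component by component. The infinite sum shapes the
  uniqueness part. It agrees with a finite sum only in finitely many components, so the inductive
  statement there is a congruence on the first n components over a finite index set. Constants and
  poles are separated by the base field. Over the closure every constant Witt vector lies in the
  image of \<wp>, so the pole coefficients are isolated there with an arbitrary constant vector
  carried along. The trace enters only over the finite field, once the poles have cancelled.\<close>

locale ring_morph =
  fixes h :: "'a::comm_ring_1 \<Rightarrow> 'b::comm_ring_1"
  assumes one [simp]: "h 1 = 1"
    and add [simp]: "h (x + y) = h x + h y"
    and mult [simp]: "h (x * y) = h x * h y"
begin

lemma zero [simp]: "h 0 = 0"
  using add[of 0 0] by simp

lemma uminus [simp]: "h (- x) = - h x"
  using add[of x "- x"] by (simp add: eq_neg_iff_add_eq_0 add.commute)

lemma diff [simp]: "h (x - y) = h x - h y"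
  using add[of x "- y"] by simp

lemma power [simp]: "h (x ^ n) = h x ^ n"
  by (induction n) auto

lemma of_nat [simp]: "h (of_nat n) = of_nat n"
  by (induction n) auto

lemma of_int [simp]: "h (of_int n) = of_int n"
  by (cases n rule: int_cases2) auto

lemma sum: "h (sum f A) = (\<Sum>x\<in>A. h (f x))"
  by (induction A rule: infinite_finite_induct) auto

lemma prod: "h (prod f A) = (\<Prod>x\<in>A. h (f x))"
  by (induction A rule: infinite_finite_induct) auto

lemma witt_poly: "h (witt_poly p n a) = witt_poly p n (h \<circ> a)"
  by (simp add: witt_poly_def sum)

lemma mpoly_eval: "h (mpoly_eval f P) = mpoly_eval (h \<circ> f) P"
  by (simp add: mpoly_eval_def sum prod)

end

lemma ring_morph_comp:
  "ring_morph f \<Longrightarrow> ring_morph g \<Longrightarrow> ring_morph (g \<circ> f)"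
  by (simp add: ring_morph_def)

subsection \<open>Evaluation of polynomials\<close>

definition monom_eval :: "(nat \<Rightarrow> 'a::comm_ring_1) \<Rightarrow> (nat \<Rightarrow>\<^sub>0 nat) \<Rightarrow> 'a" where
  "monom_eval f m = (\<Prod>v\<in>Poly_Mapping.keys m. f v ^ Poly_Mapping.lookup m v)"

lemma monom_eval_superset:
  assumes "finite A" "Poly_Mapping.keys m \<subseteq> A"
  shows "monom_eval f m = (\<Prod>v\<in>A. f v ^ Poly_Mapping.lookup m v)"
  unfolding monom_eval_def using assms
  by (intro prod.mono_neutral_left) (auto simp: in_keys_iff)

lemma monom_eval_add: "monom_eval f (m + m') = monom_eval f m * monom_eval f m'"
proof -
  let ?A = "Poly_Mapping.keys m \<union> Poly_Mapping.keys m'"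
  have "Poly_Mapping.keys (m + m') \<subseteq> ?A" by (rule keys_add)
  then show ?thesis
    by (simp add: monom_eval_superset[of ?A] lookup_add power_add prod.distrib)
qed

lemma mpoly_eval_superset:
  assumes "finite A" "Poly_Mapping.keys P \<subseteq> A"
  shows "mpoly_eval f P = (\<Sum>m\<in>A. of_int (Poly_Mapping.lookup P m) * monom_eval f m)"
  unfolding mpoly_eval_def monom_eval_def using assms
  by (intro sum.mono_neutral_left) (auto simp: in_keys_iff)

lemma mpoly_eval_add: "mpoly_eval f (P + Q) = mpoly_eval f P + mpoly_eval f Q"
proof -
  let ?A = "Poly_Mapping.keys P \<union> Poly_Mapping.keys Q"
  have "Poly_Mapping.keys (P + Q) \<subseteq> ?A" by (rule keys_add)
  then show ?thesis
    by (simp add: mpoly_eval_superset[of ?A] lookup_add sum.distrib algebra_simps)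
qed

lemma mpoly_eval_single:
  "mpoly_eval f (Poly_Mapping.single m c) = of_int c * monom_eval f m"
  by (subst mpoly_eval_superset[of "{m}"]) auto

lemma poly_mapping_sum_single:
  fixes P :: "'k \<Rightarrow>\<^sub>0 'b::comm_monoid_add"
  shows "(\<Sum>m\<in>Poly_Mapping.keys P. Poly_Mapping.single m (Poly_Mapping.lookup P m)) = P"
proof (rule poly_mapping_eqI)
  fix k
  have "Poly_Mapping.lookup (\<Sum>m\<in>Poly_Mapping.keys P. Poly_Mapping.single m (Poly_Mapping.lookup P m)) k
      = (\<Sum>m\<in>Poly_Mapping.keys P. if m = k then Poly_Mapping.lookup P m else 0)"
    by (simp add: lookup_sum lookup_single when_def)
  also have "\<dots> = Poly_Mapping.lookup P k"
    by (simp add: in_keys_iff)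
  finally show "Poly_Mapping.lookup (\<Sum>m\<in>Poly_Mapping.keys P. Poly_Mapping.single m (Poly_Mapping.lookup P m)) k
      = Poly_Mapping.lookup P k" .
qed

lemma poly_mapping_add_induct:
  fixes P :: "'k \<Rightarrow>\<^sub>0 'b::comm_monoid_add"
  assumes "\<And>m c. Q (Poly_Mapping.single m c)" and "\<And>P R. Q P \<Longrightarrow> Q R \<Longrightarrow> Q (P + R)"
  shows "Q P"
proof -
  have "Q (\<Sum>m\<in>A. Poly_Mapping.single m (Poly_Mapping.lookup P m))" if "finite A" for A
    using that
  proof (induction A rule: finite_induct)
    case empty
    show ?case using assms(1)[of undefined 0] by simp
  qed (use assms in auto)
  from this[of "Poly_Mapping.keys P"] show ?thesis
    by (simp add: poly_mapping_sum_single)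
qed

lemma mpoly_eval_mult: "mpoly_eval f (P * Q) = mpoly_eval f P * mpoly_eval f Q"
proof (induction P rule: poly_mapping_add_induct)
  case (1 m c)
  show ?case
  proof (induction Q rule: poly_mapping_add_induct)
    case (1 m' c')
    show ?case by (simp add: mult_single mpoly_eval_single monom_eval_add)
  qed (simp add: distrib_left mpoly_eval_add)
qed (simp add: distrib_right mpoly_eval_add)

lemma ring_morph_mpoly_eval: "ring_morph (mpoly_eval f)"
proof
  show "mpoly_eval f 1 = 1"
    using mpoly_eval_single[of f 0 1] by (simp add: monom_eval_def)
qed (simp_all add: mpoly_eval_add mpoly_eval_mult)

lemma mpoly_eval_var [simp]: "mpoly_eval f (mpoly_var v) = f v"
  by (simp add: mpoly_var_def mpoly_eval_single monom_eval_def)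

lemma mpoly_var_power: "mpoly_var v ^ n = Poly_Mapping.single (Poly_Mapping.single v n) 1"
  by (induction n) (simp_all add: mpoly_var_def mult_single flip: single_add)

lemma monom_eval_var: "monom_eval mpoly_var m = Poly_Mapping.single m 1"
proof -
  have "(\<Prod>v\<in>A. mpoly_var v ^ Poly_Mapping.lookup m v) =
      Poly_Mapping.single (\<Sum>v\<in>A. Poly_Mapping.single v (Poly_Mapping.lookup m v)) 1"
    if "finite A" for A
    using that by (induction A rule: finite_induct) (simp_all add: mpoly_var_power mult_single)
  from this[of "Poly_Mapping.keys m"] show ?thesis
    by (simp add: monom_eval_def poly_mapping_sum_single)
qed

subsection \<open>Congruences modulo powers of a prime\<close>

lemma prime_dvd_power_add:
  fixes x y :: "'a::comm_ring_1"
  assumes "prime p"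
  shows "of_nat p dvd (x + y) ^ p - (x ^ p + y ^ p)"
proof -
  have p: "p > 0" using assms prime_gt_0_nat by blast
  have "(x + y) ^ p = (\<Sum>k\<le>p. of_nat (p choose k) * x ^ k * y ^ (p - k))"
    by (rule binomial_ring)
  also have "\<dots> = (\<Sum>k\<in>insert 0 (insert p {0<..<p}). of_nat (p choose k) * x ^ k * y ^ (p - k))"
    using p by (intro sum.cong) auto
  also have "\<dots> = y ^ p + (x ^ p + (\<Sum>k\<in>{0<..<p}. of_nat (p choose k) * x ^ k * y ^ (p - k)))"
    using p by (simp)
  finally have "(x + y) ^ p - (x ^ p + y ^ p) = (\<Sum>k\<in>{0<..<p}. of_nat (p choose k) * x ^ k * y ^ (p - k))"
    by simp
  also have "of_nat p dvd \<dots>"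
  proof (intro dvd_sum dvd_mult2)
    fix k assume "k \<in> {0<..<p}"
    then have "p dvd (p choose k)"
      using assms by (intro dvd_choose_prime) auto
    then show "of_nat p dvd (of_nat (p choose k) :: 'a)"
      by (auto elim!: dvdE)
  qed
  finally show ?thesis .
qed

text \<open>Each p-th power gains one factor p: in u^p - v^p = (u - v) * s the sum s is congruent to
  p * v^(p-1), hence to 0, modulo p because u and v are congruent modulo p.\<close>

lemma power_prime_power_cong:
  fixes x y :: "'a::comm_ring_1"
  assumes "of_nat p dvd x - y"
  shows "of_nat p ^ Suc k dvd x ^ (p ^ k) - y ^ (p ^ k)"
proof (induction k)
  case (Suc k)
  define u v where "u = x ^ (p ^ k)" and "v = y ^ (p ^ k)"
  have uv: "of_nat p dvd u - v"
    using Suc unfolding u_def v_def by (simp add: dvd_mult_left)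
  have pow: "u - v dvd u ^ i - v ^ i" for i
    by (metis dvd_triv_left power_diff_sumr2)
  have "of_nat p dvd (\<Sum>i<p. v ^ (p - Suc i) * (u ^ i - v ^ i))"
    using uv pow by (intro dvd_sum) (meson dvd_mult dvd_trans)
  also have "(\<Sum>i<p. v ^ (p - Suc i) * (u ^ i - v ^ i)) = (\<Sum>i<p. v ^ (p - Suc i) * u ^ i) - (\<Sum>i<p. v ^ (p - Suc i) * v ^ i)"
    by (simp add: algebra_simps sum_subtractf)
  also have "(\<Sum>i<p. v ^ (p - Suc i) * v ^ i) = (\<Sum>i<p. v ^ (p - 1))"
    by (intro sum.cong) (auto simp flip: power_add)
  also have "\<dots> = of_nat p * v ^ (p - 1)" by simp
  finally have "of_nat p dvd (\<Sum>i<p. v ^ (p - Suc i) * u ^ i)"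
    by (metis dvd_diffD dvd_triv_left dvd_diff_commute dvd_add_left_iff diff_add_cancel)
  then have "of_nat p ^ Suc k * of_nat p dvd (u - v) * (\<Sum>i<p. v ^ (p - Suc i) * u ^ i)"
    using Suc unfolding u_def v_def by (intro mult_dvd_mono)
  also have "(u - v) * (\<Sum>i<p. v ^ (p - Suc i) * u ^ i) = u ^ p - v ^ p"
    by (rule power_diff_sumr2[symmetric])
  finally show ?case
    unfolding u_def v_def by (simp add: mult.commute flip: power_mult)
qed (use assms in simp)

subsection \<open>Existence of the Witt polynomials\<close>

text \<open>The lift of the Frobenius of F_p[X] to integral polynomials, on which Dwork's criterion
  for ghost vectors rests.\<close>

definition frob_lift :: "nat \<Rightarrow> int_mpoly \<Rightarrow> int_mpoly" where
  "frob_lift p = mpoly_eval (\<lambda>v. mpoly_var v ^ p)"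

lemma ring_morph_frob_lift: "ring_morph (frob_lift p)"
  unfolding frob_lift_def by (rule ring_morph_mpoly_eval)

lemma frob_lift_var [simp]: "frob_lift p (mpoly_var v) = mpoly_var v ^ p"
  by (simp add: frob_lift_def)

text \<open>Both sides are additive modulo p, so single terms suffice. On a monomial the two maps
  coincide, and on its integer coefficient the claim is Fermat's little theorem.\<close>

lemma frob_lift_cong:
  assumes p: "prime p"
  shows "of_nat p dvd frob_lift p P - P ^ p"
proof -
  interpret ring_morph "frob_lift p" by (rule ring_morph_frob_lift)
  have add: "of_nat p dvd frob_lift p (P + R) - (P + R) ^ p"
    if "of_nat p dvd frob_lift p P - P ^ p" "of_nat p dvd frob_lift p R - R ^ p" for P R
  proof -
    have "of_nat p dvd (frob_lift p P - P ^ p) + (frob_lift p R - R ^ p) - ((P + R) ^ p - (P ^ p + R ^ p))"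
      by (rule dvd_diff[OF dvd_add[OF that] prime_dvd_power_add[OF p]])
    then show ?thesis by (simp add: algebra_simps)
  qed
  have nat: "of_nat p dvd frob_lift p (of_nat n) - of_nat n ^ p" for n
  proof (induction n)
    case 0
    show ?case using p prime_gt_0_nat[OF p] by (simp add: power_0_left)
  next
    case (Suc n)
    have "of_nat p dvd frob_lift p (1 + of_nat n) - (1 + of_nat n) ^ p"
      using Suc by (intro add) simp
    then show ?case by simp
  qed
  have int: "of_nat p dvd frob_lift p (of_int c) - of_int c ^ p" for c
  proof (cases c rule: int_cases2)
    case (nonneg n)
    then show ?thesis using nat[of n] by simp
  next
    case (nonpos n)
    \<comment> \<open>Expanding 0 = (n + (-n))^p modulo p relates (-n)^p to n^p for p = 2 and odd p
      alike, without a case split on the sign.\<close>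
    have "of_nat p dvd (of_nat n + - of_nat n) ^ p - (of_nat n ^ p + (- of_nat n :: int_mpoly) ^ p)"
      by (rule prime_dvd_power_add[OF p])
    then have "of_nat p dvd (of_nat n ^ p + (- of_nat n :: int_mpoly) ^ p)"
      using prime_gt_0_nat[OF p]
      by (subst (asm) dvd_minus_iff[symmetric]) (simp add: power_0_left add.commute del: of_nat_power)
    from dvd_add[OF nat[of n] this] have "of_nat p dvd - (of_nat n + (- of_nat n :: int_mpoly) ^ p)"
      by (subst dvd_minus_iff) simp
    then show ?thesis
      using nonpos by simp
  qed
  show ?thesis
  proof (induction P rule: poly_mapping_add_induct)
    case (1 m c)
    have *: "Poly_Mapping.single m c = of_int c * monom_eval mpoly_var m"
      by (simp add: monom_eval_var mult_single flip: single_of_int)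
    have "frob_lift p (monom_eval mpoly_var m) = monom_eval mpoly_var m ^ p"
      unfolding monom_eval_def
      by (simp add: prod prod_power_distrib power_mult[symmetric] mult.commute)
    then have "frob_lift p (Poly_Mapping.single m c) - Poly_Mapping.single m c ^ p =
        (frob_lift p (of_int c) - of_int c ^ p) * monom_eval mpoly_var m ^ p"
      unfolding * by (simp add: power_mult_distrib algebra_simps)
    then show ?case using int[of c] by simp
  next
    case (2 P R)
    then show ?case by (rule add)
  qed
qed

text \<open>Dwork's lemma. The next component r must solve p^(m+1) * r = \<open>g (Suc m)\<close>
  minus the part built from earlier components. The right-hand side is divisible because both of its
  terms are congruent to \<open>frob_lift p (g m)\<close> modulo p^(m+1).\<close>

lemma ghost_exists:
  assumes p: "prime p" and g: "\<And>n. of_nat p ^ Suc n dvd g (Suc n) - frob_lift p (g n)"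
  shows "\<exists>S. \<forall>n. witt_poly p n S = g n"
proof -
  interpret ring_morph "frob_lift p" by (rule ring_morph_frob_lift)
  let ?P = "\<lambda>f n r. (\<Sum>i<n. of_nat p ^ i * f i ^ (p ^ (n - i))) + of_nat p ^ n * r = g n"
  have split: "witt_poly p n f = (\<Sum>i<n. of_nat p ^ i * f i ^ (p ^ (n - i))) + of_nat p ^ n * f n" for n and f :: "nat \<Rightarrow> int_mpoly"
    by (simp add: witt_poly_def flip: lessThan_Suc_atMost)
  have "\<exists>f. \<forall>n. ?P f n (f n)"
  proof (rule dependent_wf_choice[of less_than])
    fix f g' :: "nat \<Rightarrow> int_mpoly" and n r
    assume "\<And>z. (z, n) \<in> less_than \<Longrightarrow> f z = g' z"
    then have "(\<Sum>i<n. of_nat p ^ i * f i ^ (p ^ (n - i))) = (\<Sum>i<n. of_nat p ^ i * g' i ^ (p ^ (n - i)))"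
      by (intro sum.cong) auto
    then show "?P f n r = ?P g' n r" by simp
  next
    fix n f
    assume IH: "\<And>y. (y, n) \<in> less_than \<Longrightarrow> ?P f y (f y)"
    show "\<exists>r. ?P f n r"
    proof (cases n)
      case (Suc m)
      have gm: "g m = witt_poly p m f" using IH[of m] Suc by (simp add: split)
      \<comment> \<open>The prefactor supplies i factors p, and the congruence raised to the power
        p^(m-i) supplies the other m - i + 1.\<close>
      have "of_nat p ^ Suc m dvd of_nat p ^ i * (frob_lift p (f i) ^ (p ^ (m - i)) - f i ^ (p ^ (Suc m - i)))"
        if "i \<le> m" for i
      proof -
        have "of_nat p ^ Suc (m - i) dvd frob_lift p (f i) ^ (p ^ (m - i)) - (f i ^ p) ^ (p ^ (m - i))"
          by (rule power_prime_power_cong[OF frob_lift_cong[OF p]])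
        then have "of_nat p ^ i * of_nat p ^ Suc (m - i) dvd
            of_nat p ^ i * (frob_lift p (f i) ^ (p ^ (m - i)) - (f i ^ p) ^ (p ^ (m - i)))"
          by (intro mult_dvd_mono) auto
        moreover have "(of_nat p ^ i * of_nat p ^ Suc (m - i) :: int_mpoly) = of_nat p ^ Suc m"
          using that by (simp del: power_Suc of_nat_power flip: power_add)
        moreover have "(f i ^ p) ^ (p ^ (m - i)) = f i ^ (p ^ (Suc m - i))"
          using that by (simp add: Suc_diff_le flip: power_mult)
        ultimately show ?thesis by metis
      qed
      then have "of_nat p ^ Suc m dvd (\<Sum>i\<le>m. of_nat p ^ i * (frob_lift p (f i) ^ (p ^ (m - i)) - f i ^ (p ^ (Suc m - i))))"
        by (intro dvd_sum) auto
      also have "\<dots> = frob_lift p (g m) - (\<Sum>i<Suc m. of_nat p ^ i * f i ^ (p ^ (Suc m - i)))"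
        by (simp only: lessThan_Suc_atMost) (simp add: gm witt_poly_def sum right_diff_distrib sum_subtractf)
      finally have "of_nat p ^ Suc m dvd (g (Suc m) - frob_lift p (g m)) +
          (frob_lift p (g m) - (\<Sum>i<Suc m. of_nat p ^ i * f i ^ (p ^ (Suc m - i))))"
        by (intro dvd_add g)
      then obtain r where "g (Suc m) - (\<Sum>i<Suc m. of_nat p ^ i * f i ^ (p ^ (Suc m - i))) = of_nat p ^ Suc m * r"
        by (auto simp only: add_diff_add diff_add_cancel dvd_def add_diff_eq)
      then have "(\<Sum>i<Suc m. of_nat p ^ i * f i ^ (p ^ (Suc m - i))) + of_nat p ^ Suc m * r = g (Suc m)"
        by (simp add: algebra_simps)
      then show ?thesis unfolding Suc by blast
    qed simp
  qed simp
  then show ?thesis by (simp add: split)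
qed

text \<open>Components are recovered one by one, since multiplication by p^k is injective on
  integral polynomials. The bound \<open>N\<close> makes this usable for vectors that agree only up
  to a power of V.\<close>

lemma ghost_agree:
  fixes S S' :: "nat \<Rightarrow> int_mpoly"
  assumes p: "prime p" and eq: "\<And>n. n < N \<Longrightarrow> witt_poly p n S = witt_poly p n S'" and "k < N"
  shows "S k = S' k"
  using \<open>k < N\<close>
proof (induction k rule: less_induct)
  case (less k)
  have "(\<Sum>i<k. of_nat p ^ i * S i ^ (p ^ (k - i))) = (\<Sum>i<k. of_nat p ^ i * S' i ^ (p ^ (k - i)))"
    using less by (intro sum.cong) auto
  then have "of_nat p ^ k * S k = of_nat p ^ k * S' k"
    using eq[OF less.prems] by (simp add: witt_poly_def flip: lessThan_Suc_atMost)
  then show ?case using prime_gt_0_nat[OF p] by simp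
qed

lemma ghost_inj:
  fixes S S' :: "nat \<Rightarrow> int_mpoly"
  assumes "prime p" and "\<And>n. witt_poly p n S = witt_poly p n S'"
  shows "S = S'"
  using ghost_agree[OF assms(1), of "Suc _" S S'] assms(2) by blast


text \<open>Replacing X_i by X_i^p in w_n gives w_(n+1) without its last summand p^(n+1) *
  X_(n+1).\<close>

lemma frob_lift_witt_poly_var:
  assumes p: "prime p"
  shows "of_nat p ^ Suc n dvd witt_poly p (Suc n) (\<lambda>i. mpoly_var (f i)) -
    frob_lift p (witt_poly p n (\<lambda>i. mpoly_var (f i)))"
proof -
  interpret ring_morph "frob_lift p" by (rule ring_morph_frob_lift)
  have "frob_lift p (witt_poly p n (\<lambda>i. mpoly_var (f i))) =
      (\<Sum>i\<le>n. of_nat p ^ i * (mpoly_var (f i) ^ p) ^ (p ^ (n - i)))"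
    unfolding witt_poly by (simp add: witt_poly_def frob_lift_def)
  also have "\<dots> = (\<Sum>i\<le>n. of_nat p ^ i * mpoly_var (f i) ^ (p ^ (Suc n - i)))"
    by (intro sum.cong) (auto simp: Suc_diff_le simp flip: power_mult)
  finally show ?thesis by (simp add: witt_poly_def)
qed

text \<open>Discharges the definite description: Dwork's lemma gives existence, injectivity of the
  ghost map uniqueness. Dwork's congruence passes to sums and products because
  \<open>frob_lift\<close> is a ring morphism.\<close>

lemma witt_op_polys_spec:
  assumes p: "prime p" and h: "h = (+) \<or> h = (*)"
  shows "witt_poly p n (witt_op_polys p h) =
     h (witt_poly p n (\<lambda>i. mpoly_var (2 * i))) (witt_poly p n (\<lambda>i. mpoly_var (2 * i + 1)))"
proof -
  interpret ring_morph "frob_lift p" by (rule ring_morph_frob_lift)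
  let ?u = "\<lambda>n. witt_poly p n (\<lambda>i. mpoly_var (2 * i))"
  let ?v = "\<lambda>n. witt_poly p n (\<lambda>i. mpoly_var (2 * i + 1))"
  have "of_nat p ^ Suc n dvd h (?u (Suc n)) (?v (Suc n)) - frob_lift p (h (?u n) (?v n))" for n
  proof -
    have u: "of_nat p ^ Suc n dvd ?u (Suc n) - frob_lift p (?u n)"
      and v: "of_nat p ^ Suc n dvd ?v (Suc n) - frob_lift p (?v n)"
      by (rule frob_lift_witt_poly_var[OF p])+
    from h show ?thesis
    proof
      assume "h = (+)"
      then show ?thesis using dvd_add[OF u v] by (simp add: algebra_simps)
    next
      assume "h = (*)"
      moreover have "?u (Suc n) * ?v (Suc n) - frob_lift p (?u n) * frob_lift p (?v n) =
        ?u (Suc n) * (?v (Suc n) - frob_lift p (?v n)) + (?u (Suc n) - frob_lift p (?u n)) * frob_lift p (?v n)"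
        by (simp add: algebra_simps)
      ultimately show ?thesis
        using dvd_add[OF dvd_mult[OF v, of "?u (Suc n)"] dvd_mult2[OF u, of "frob_lift p (?v n)"]]
        by (simp only: mult)
    qed
  qed
  from ghost_exists[OF p this] obtain S where S: "\<forall>n. witt_poly p n S = h (?u n) (?v n)" by blast
  have "\<forall>n. witt_poly p n (witt_op_polys p h) = h (?u n) (?v n)"
    unfolding witt_op_polys_def
  proof (rule theI[of _ S])
    show "\<And>S'. \<forall>n. witt_poly p n S' = h (?u n) (?v n) \<Longrightarrow> S' = S"
      using S by (intro ghost_inj[OF p]) simp
  qed (rule S)
  then show ?thesis by blast
qed

text \<open>Evaluation specialises the universal identity to any ring. The operation
  \<open>h\<close> lives on integral polynomials, so its counterpart \<open>h'\<close> on the target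
  ring is a separate parameter.\<close>

lemma witt_poly_witt_op_aux:
  assumes p: "prime p" and h: "h = (+) \<or> h = (*)"
    and h': "\<And>x y. mpoly_eval (\<lambda>v. if even v then a (v div 2) else b (v div 2)) (h x y) =
      h' (mpoly_eval (\<lambda>v. if even v then a (v div 2) else b (v div 2)) x)
        (mpoly_eval (\<lambda>v. if even v then a (v div 2) else b (v div 2)) y)"
  shows "witt_poly p n (witt_op p h a b) = h' (witt_poly p n a) (witt_poly p n b)"
proof -
  let ?e = "mpoly_eval (\<lambda>v. if even v then a (v div 2) else b (v div 2))"
  interpret ring_morph ?e by (rule ring_morph_mpoly_eval)
  have *: "witt_op p h a b = ?e \<circ> witt_op_polys p h"
    by (auto simp: witt_op_def)
  show ?thesis
    unfolding * witt_poly[symmetric] witt_op_polys_spec[OF p h] h'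
    by (simp add: witt_poly comp_def)
qed

lemma witt_poly_add:
  "prime p \<Longrightarrow> witt_poly p n (witt_op p (+) a b) = witt_poly p n a + witt_poly p n b"
  by (rule witt_poly_witt_op_aux) (auto simp: mpoly_eval_add)

lemma witt_poly_mult:
  "prime p \<Longrightarrow> witt_poly p n (witt_op p (*) a b) = witt_poly p n a * witt_poly p n b"
  by (rule witt_poly_witt_op_aux) (auto simp: mpoly_eval_mult)

lemma (in ring_morph) witt_op: "h \<circ> witt_op p f a b = witt_op p f (h \<circ> a) (h \<circ> b)"
  by (auto simp: witt_op_def mpoly_eval fun_eq_iff intro!: arg_cong2[where f = mpoly_eval])

subsection \<open>The additive group of Witt vectors\<close>

text \<open>Three interleaved families of variables, numbered by residues modulo 3, because
  associativity involves three vectors. Identities in fewer vectors repeat an argument.\<close>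

lemma generic_witt_vectors:
  fixes a b c :: "nat \<Rightarrow> 'a::comm_ring_1"
  obtains e :: "int_mpoly \<Rightarrow> 'a" and A B C :: "nat \<Rightarrow> int_mpoly"
  where "ring_morph e" "e \<circ> A = a" "e \<circ> B = b" "e \<circ> C = c"
proof
  let ?e = "mpoly_eval (\<lambda>v. if v mod 3 = 0 then a (v div 3) else if v mod 3 = 1 then b (v div 3) else c (v div 3))"
  have 1: "Suc (3 * i) mod 3 = 1" "Suc (3 * i) div 3 = i"
    "Suc (Suc (3 * i)) mod 3 = 2" "Suc (Suc (3 * i)) div 3 = i" for i
    by presburger+
  show "ring_morph ?e" by (rule ring_morph_mpoly_eval)
  show "?e \<circ> (\<lambda>i. mpoly_var (3 * i)) = a" by (auto simp: fun_eq_iff)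
  show "?e \<circ> (\<lambda>i. mpoly_var (3 * i + 1)) = b" by (auto simp: fun_eq_iff 1)
  show "?e \<circ> (\<lambda>i. mpoly_var (3 * i + 2)) = c" by (auto simp: fun_eq_iff 1)
qed

lemma witt_poly_zero [simp]: "prime p \<Longrightarrow> witt_poly p n (\<lambda>_. 0) = 0"
  by (simp add: witt_poly_def power_0_left prime_gt_0_nat)

lemma witt_poly_teichmueller: "prime p \<Longrightarrow> witt_poly p n (teichmueller y) = y ^ (p ^ n)"
  by (simp add: witt_poly_def teichmueller_def power_0_left prime_gt_0_nat if_distrib if_distribR
    sum.delta' cong: if_cong)

lemma witt_add_commute:
  fixes a b :: "nat \<Rightarrow> 'a::comm_ring_1"
  assumes "prime p"
  shows "witt_op p (+) a b = witt_op p (+) b a"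
proof -
  obtain e :: "int_mpoly \<Rightarrow> 'a" and A B C where e: "ring_morph e" "e \<circ> A = a" "e \<circ> B = b"
    by (rule generic_witt_vectors[of a b b]) (rule that; assumption)
  have "witt_op p (+) A B = witt_op p (+) B A"
    using assms by (intro ghost_inj[OF assms]) (simp_all add: witt_poly_add add.commute)
  then have "e \<circ> witt_op p (+) A B = e \<circ> witt_op p (+) B A" by simp
  then show ?thesis using e by (simp add: ring_morph.witt_op)
qed

lemma witt_add_assoc:
  fixes a b c :: "nat \<Rightarrow> 'a::comm_ring_1"
  assumes "prime p"
  shows "witt_op p (+) (witt_op p (+) a b) c = witt_op p (+) a (witt_op p (+) b c)"
proof -
  obtain e :: "int_mpoly \<Rightarrow> 'a" and A B C where e: "ring_morph e" "e \<circ> A = a" "e \<circ> B = b" "e \<circ> C = c"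
    by (rule generic_witt_vectors[of a b c]) (rule that; assumption)
  have "witt_op p (+) (witt_op p (+) A B) C = witt_op p (+) A (witt_op p (+) B C)"
    using assms by (intro ghost_inj[OF assms]) (simp_all add: witt_poly_add add.assoc)
  then have "e \<circ> witt_op p (+) (witt_op p (+) A B) C = e \<circ> witt_op p (+) A (witt_op p (+) B C)" by simp
  then show ?thesis using e by (simp add: ring_morph.witt_op)
qed

lemma witt_add_left_commute:
  assumes p: "prime p"
  shows "witt_op p (+) a (witt_op p (+) b c) = witt_op p (+) b (witt_op p (+) a c)"
  using witt_add_assoc[OF p] witt_add_commute[OF p] by metis

lemma ring_morph_zero_vector: "ring_morph e \<Longrightarrow> e \<circ> (\<lambda>_. 0) = (\<lambda>_. 0)"
  by (auto simp: ring_morph.zero)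

lemma witt_add_zero:
  fixes a :: "nat \<Rightarrow> 'a::comm_ring_1"
  assumes "prime p"
  shows "witt_op p (+) a (\<lambda>_. 0) = a"
proof -
  obtain e :: "int_mpoly \<Rightarrow> 'a" and A B C where e: "ring_morph e" "e \<circ> A = a"
    by (rule generic_witt_vectors[of a a a]) (rule that; assumption)
  have "witt_op p (+) A (\<lambda>_. 0) = A"
    using assms by (intro ghost_inj[OF assms]) (simp_all add: witt_poly_add)
  then have "e \<circ> witt_op p (+) A (\<lambda>_. 0) = e \<circ> A" by simp
  then show ?thesis using e by (simp add: ring_morph.witt_op ring_morph_zero_vector)
qed

text \<open>Negation is not componentwise when p = 2, so the inverse of the generic vector is
  obtained from Dwork's lemma applied to the negated ghost components and then specialised.\<close>

lemma witt_add_inverse: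
  assumes p: "prime p"
  shows "\<exists>b. witt_op p (+) a b = (\<lambda>_. 0)"
proof -
  let ?e = "mpoly_eval a"
  interpret F: ring_morph "frob_lift p" by (rule ring_morph_frob_lift)
  have "of_nat p ^ Suc n dvd - witt_poly p (Suc n) mpoly_var - frob_lift p (- witt_poly p n mpoly_var)" for n
    using frob_lift_witt_poly_var[OF p, of n "\<lambda>i. i"]
    by (subst dvd_minus_iff[symmetric]) (simp add: algebra_simps)
  from ghost_exists[OF p this] obtain N where N: "\<And>n. witt_poly p n N = - witt_poly p n mpoly_var"
    by blast
  have "witt_op p (+) mpoly_var N = (\<lambda>_. 0)"
    by (rule ghost_inj[OF p]) (simp add: witt_poly_add[OF p] N p)
  then have "?e \<circ> witt_op p (+) mpoly_var N = ?e \<circ> (\<lambda>_. 0)" by simp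
  then have "witt_op p (+) (?e \<circ> mpoly_var) (?e \<circ> N) = (\<lambda>_. 0)"
    by (simp only: ring_morph.witt_op[OF ring_morph_mpoly_eval] ring_morph_zero_vector[OF ring_morph_mpoly_eval])
  moreover have "?e \<circ> mpoly_var = a" by auto
  ultimately show ?thesis by auto
qed

lemma witt_ring_simps [simp]:
  "carrier (witt_ring p) = UNIV" "x \<oplus>\<^bsub>witt_ring p\<^esub> y = witt_op p (+) x y"
  "x \<otimes>\<^bsub>witt_ring p\<^esub> y = witt_op p (*) x y" "\<zero>\<^bsub>witt_ring p\<^esub> = (\<lambda>_. 0)"
  "\<one>\<^bsub>witt_ring p\<^esub> = teichmueller 1"
  by (simp_all add: witt_ring_def)

lemma abelian_group_witt_ring:
  assumes p: "prime p"
  shows "abelian_group (witt_ring p)"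
proof (rule abelian_groupI; simp)
  fix x y z :: "nat \<Rightarrow> 'a"
  show "\<exists>y. witt_op p (+) y x = (\<lambda>_. 0)"
    using witt_add_inverse[OF p, of x] by (auto simp: witt_add_commute[OF p])
  show "witt_op p (+) (witt_op p (+) x y) z = witt_op p (+) x (witt_op p (+) y z)"
    by (rule witt_add_assoc[OF p])
  show "witt_op p (+) x y = witt_op p (+) y x"
    by (rule witt_add_commute[OF p])
  show "witt_op p (+) (\<lambda>_. 0) x = x"
    using witt_add_commute[OF p, of x] witt_add_zero[OF p] by metis
qed

subsection \<open>Verschiebung, Teichmueller multiples and truncation\<close>

lemma witt_poly_verschiebung:
  assumes "prime p"
  shows "witt_poly p n (verschiebung a) = (case n of 0 \<Rightarrow> 0 | Suc m \<Rightarrow> of_nat p * witt_poly p m a)"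
proof (cases n)
  case (Suc m)
  have "witt_poly p (Suc m) (verschiebung a) = (\<Sum>i\<le>m. of_nat p ^ Suc i * a i ^ (p ^ (m - i)))"
    unfolding witt_poly_def using assms
    by (subst sum.atMost_Suc_shift) (simp add: verschiebung_def power_0_left prime_gt_0_nat)
  then show ?thesis by (simp add: Suc witt_poly_def sum_distrib_left mult.assoc)
qed (use assms in \<open>simp add: witt_poly_def verschiebung_def\<close>)

lemma comp_verschiebung: "h 0 = 0 \<Longrightarrow> h \<circ> verschiebung a = verschiebung (h \<circ> a)"
  by (auto simp: fun_eq_iff verschiebung_def split: nat.split)

lemma verschiebung_add:
  fixes a b :: "nat \<Rightarrow> 'a::comm_ring_1"
  assumes p: "prime p"
  shows "verschiebung (witt_op p (+) a b) = witt_op p (+) (verschiebung a) (verschiebung b)"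
proof -
  obtain e :: "int_mpoly \<Rightarrow> 'a" and A B C where e: "ring_morph e" "e \<circ> A = a" "e \<circ> B = b" "e \<circ> C = b"
    by (rule generic_witt_vectors[of a b b]) (rule that; assumption)
  have "verschiebung (witt_op p (+) A B) = witt_op p (+) (verschiebung A) (verschiebung B)"
    using p by (intro ghost_inj[OF p])
      (simp_all add: witt_poly_add witt_poly_verschiebung distrib_left split: nat.split)
  then have "e \<circ> verschiebung (witt_op p (+) A B) = e \<circ> witt_op p (+) (verschiebung A) (verschiebung B)"
    by simp
  then show ?thesis
    using e ring_morph.zero[OF e(1)] by (simp add: ring_morph.witt_op comp_verschiebung)
qed

text \<open>The product of \<open>a\<close> with the Teichmueller lift [y] in closed form. Every
  product in the theorem has a Teichmueller factor, so Witt multiplication is always rewritten to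
  this.\<close>

definition teich_scale :: "nat \<Rightarrow> 'a::comm_ring_1 \<Rightarrow> (nat \<Rightarrow> 'a) \<Rightarrow> nat \<Rightarrow> 'a" where
  "teich_scale p y a n = a n * y ^ (p ^ n)"

lemma witt_poly_teich_scale: "witt_poly p n (teich_scale p y a) = witt_poly p n a * y ^ (p ^ n)"
proof -
  have "of_nat p ^ i * (a i * y ^ p ^ i) ^ p ^ (n - i) = of_nat p ^ i * a i ^ p ^ (n - i) * y ^ p ^ n"
    if "i \<le> n" for i
    using that by (simp add: power_mult_distrib mult.assoc flip: power_mult power_add)
  then show ?thesis
    unfolding witt_poly_def teich_scale_def sum_distrib_right by (intro sum.cong) auto
qed

lemma comp_teich_scale: "ring_morph h \<Longrightarrow> h \<circ> teich_scale p y a = teich_scale p (h y) (h \<circ> a)"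
  by (auto simp: fun_eq_iff teich_scale_def ring_morph.mult ring_morph.power)

lemma comp_teichmueller: "h 0 = 0 \<Longrightarrow> h \<circ> teichmueller y = teichmueller (h y)"
  by (auto simp: fun_eq_iff teichmueller_def)

lemma witt_mult_teichmueller:
  fixes y :: "'a::comm_ring_1" and a :: "nat \<Rightarrow> 'a::comm_ring_1"
  assumes p: "prime p"
  shows "witt_op p (*) a (teichmueller y) = teich_scale p y a"
proof -
  obtain e :: "int_mpoly \<Rightarrow> 'a" and A B C
    where e: "ring_morph e" "e \<circ> A = a" "e \<circ> B = (\<lambda>_::nat. y)" "e \<circ> C = (\<lambda>_::nat. y)"
    by (rule generic_witt_vectors[of a "\<lambda>_. y" "\<lambda>_. y"]) (rule that; assumption)
  have "witt_op p (*) A (teichmueller (B 0)) = teich_scale p (B 0) A"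
    using p by (intro ghost_inj[OF p])
      (simp_all add: witt_poly_mult witt_poly_teichmueller witt_poly_teich_scale)
  then have "e \<circ> witt_op p (*) A (teichmueller (B 0)) = e \<circ> teich_scale p (B 0) A"
    by simp
  moreover have "e (B 0) = y" using fun_cong[OF e(3), of 0] by simp
  ultimately show ?thesis
    using e ring_morph.zero[OF e(1)]
    by (simp add: ring_morph.witt_op comp_teichmueller comp_teich_scale)
qed

lemma teich_scale_add:
  fixes y :: "'a::comm_ring_1" and a b :: "nat \<Rightarrow> 'a::comm_ring_1"
  assumes p: "prime p"
  shows "teich_scale p y (witt_op p (+) a b) = witt_op p (+) (teich_scale p y a) (teich_scale p y b)"
proof -
  obtain e :: "int_mpoly \<Rightarrow> 'a" and A B C where e: "ring_morph e" "e \<circ> A = a" "e \<circ> B = b" "e \<circ> C = (\<lambda>_::nat. y)"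
    by (rule generic_witt_vectors[of a b "\<lambda>_. y"]) (rule that; assumption)
  have "teich_scale p (C 0) (witt_op p (+) A B) =
      witt_op p (+) (teich_scale p (C 0) A) (teich_scale p (C 0) B)"
    using p by (intro ghost_inj[OF p])
      (simp_all add: witt_poly_add witt_poly_teich_scale distrib_right)
  then have "e \<circ> teich_scale p (C 0) (witt_op p (+) A B) =
      e \<circ> witt_op p (+) (teich_scale p (C 0) A) (teich_scale p (C 0) B)"
    by simp
  moreover have "e (C 0) = y" using fun_cong[OF e(4), of 0] by simp
  ultimately show ?thesis
    using e by (simp add: ring_morph.witt_op comp_teich_scale)
qed

text \<open>No carries occur: in each ghost component every summand p^i * a_i^(p^(n-i)) comes from
  exactly one of the two vectors.\<close>

lemma witt_add_disjoint:
  fixes a :: "nat \<Rightarrow> 'a::comm_ring_1"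
  assumes p: "prime p"
  shows "witt_op p (+) (\<lambda>i. if i \<in> I then a i else 0) (\<lambda>i. if i \<in> I then 0 else a i) = a"
proof -
  obtain e :: "int_mpoly \<Rightarrow> 'a" and A B C where e: "ring_morph e" "e \<circ> A = a" "e \<circ> B = a" "e \<circ> C = a"
    by (rule generic_witt_vectors[of a a a]) (rule that; assumption)
  let ?l = "\<lambda>(A::nat \<Rightarrow> _) i. if i \<in> I then A i else 0" and ?r = "\<lambda>(A::nat \<Rightarrow> _) i. if i \<in> I then 0 else A i"
  have "witt_poly p n (?l A) + witt_poly p n (?r A) = witt_poly p n A" for n
    unfolding witt_poly_def sum.distrib[symmetric]
    using prime_gt_0_nat[OF p] by (intro sum.cong) (auto simp: power_0_left)
  then have "witt_op p (+) (?l A) (?r A) = A"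
    by (intro ghost_inj[OF p]) (simp add: witt_poly_add[OF p])
  then have "e \<circ> witt_op p (+) (?l A) (?r A) = a"
    using e by simp
  moreover have "e \<circ> ?l A = ?l a" "e \<circ> ?r A = ?r a"
    using ring_morph.zero[OF e(1)] fun_cong[OF e(2)] by (auto simp: fun_eq_iff)
  ultimately show ?thesis
    by (simp add: ring_morph.witt_op[OF e(1)])
qed

lemma verschiebung_pow_apply: "(verschiebung ^^ n) a k = (if k < n then 0 else a (k - n))"
  by (induction n arbitrary: k) (auto simp: verschiebung_def split: nat.split)

lemma verschiebung_pow_add:
  "prime p \<Longrightarrow> (verschiebung ^^ n) (witt_op p (+) a b) =
    witt_op p (+) ((verschiebung ^^ n) a) ((verschiebung ^^ n) b)"
  by (induction n) (auto simp: verschiebung_add)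

lemma witt_poly_verschiebung_pow:
  "prime p \<Longrightarrow> k < n \<Longrightarrow> witt_poly p k ((verschiebung ^^ n) a) = 0"
  unfolding witt_poly_def using prime_gt_0_nat[of p]
  by (intro sum.neutral) (auto simp: verschiebung_pow_apply power_0_left)

text \<open>The ghost components of V^n b vanish below n, and the ghost components below n determine
  the components below n of generic vectors.\<close>

lemma witt_add_verschiebung_pow_apply:
  fixes a b :: "nat \<Rightarrow> 'a::comm_ring_1"
  assumes p: "prime p" and k: "k < n"
  shows "witt_op p (+) a ((verschiebung ^^ n) b) k = a k"
proof -
  obtain e :: "int_mpoly \<Rightarrow> 'a" and A B C where e: "ring_morph e" "e \<circ> A = a" "e \<circ> B = b" "e \<circ> C = b"
    by (rule generic_witt_vectors[of a b b]) (rule that; assumption)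
  have V: "e \<circ> (verschiebung ^^ n) B = (verschiebung ^^ n) b"
    using ring_morph.zero[OF e(1)] fun_cong[OF e(3)] by (auto simp: fun_eq_iff verschiebung_pow_apply)
  have "witt_op p (+) A ((verschiebung ^^ n) B) k = A k"
    by (rule ghost_agree[OF p _ k]) (simp add: witt_poly_add p witt_poly_verschiebung_pow)
  then have "(e \<circ> witt_op p (+) A ((verschiebung ^^ n) B)) k = (e \<circ> A) k"
    by simp
  then show ?thesis
    by (simp only: ring_morph.witt_op[OF e(1)] V e(2))
qed

lemma witt_add_apply_0: "prime p \<Longrightarrow> witt_op p (+) a b 0 = a 0 + b 0"
  using witt_poly_add[of p 0 a b] by (simp add: witt_poly_def)

definition witt_trunc :: "nat \<Rightarrow> (nat \<Rightarrow> 'a::zero) \<Rightarrow> nat \<Rightarrow> 'a" where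
  "witt_trunc n a k = (if k < n then a k else 0)"

lemma witt_trunc_add_tail:
  assumes "prime p"
  shows "witt_op p (+) (witt_trunc n a) ((verschiebung ^^ n) (\<lambda>k. a (k + n))) = a"
proof -
  have "witt_trunc n a = (\<lambda>i. if i \<in> {..<n} then a i else 0)"
    "(verschiebung ^^ n) (\<lambda>k. a (k + n)) = (\<lambda>i. if i \<in> {..<n} then 0 else a i)"
    by (auto simp: fun_eq_iff witt_trunc_def verschiebung_pow_apply)
  then show ?thesis using witt_add_disjoint[OF assms, of "{..<n}" a] by simp
qed

lemma witt_trunc_Suc:
  assumes "prime p"
  shows "witt_trunc (Suc n) a =
    witt_op p (+) (witt_trunc n a) ((verschiebung ^^ n) (teichmueller (a n)))"
proof -
  have "witt_trunc n (witt_trunc (Suc n) a) = witt_trunc n a"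
    "(\<lambda>k. witt_trunc (Suc n) a (k + n)) = teichmueller (a n)"
    by (auto simp: fun_eq_iff witt_trunc_def teichmueller_def)
  then show ?thesis using witt_trunc_add_tail[OF assms, of n "witt_trunc (Suc n) a"] by simp
qed

text \<open>Splitting each vector into truncation plus V^n of its tail, the tails add up to another
  V^n multiple, which the first n components do not see.\<close>

lemma witt_add_trunc_cong:
  assumes p: "prime p" and "witt_trunc n a = witt_trunc n a'" "witt_trunc n b = witt_trunc n b'"
  shows "witt_trunc n (witt_op p (+) a b) = witt_trunc n (witt_op p (+) a' b')"
proof -
  have *: "witt_trunc n (witt_op p (+) x y) =
      witt_trunc n (witt_op p (+) (witt_trunc n x) (witt_trunc n y))" for x y :: "nat \<Rightarrow> 'a"
  proof -
    let ?x = "(verschiebung ^^ n) (\<lambda>k. x (k + n))" and ?y = "(verschiebung ^^ n) (\<lambda>k. y (k + n))"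
    have "witt_op p (+) x y =
        witt_op p (+) (witt_op p (+) (witt_trunc n x) ?x) (witt_op p (+) (witt_trunc n y) ?y)"
      by (simp only: witt_trunc_add_tail[OF p])
    also have "\<dots> = witt_op p (+) (witt_op p (+) (witt_trunc n x) (witt_trunc n y)) (witt_op p (+) ?x ?y)"
      by (simp only: witt_add_assoc[OF p] witt_add_left_commute[OF p])
    finally show ?thesis
      using p by (simp add: fun_eq_iff witt_trunc_def witt_add_verschiebung_pow_apply
          verschiebung_pow_add[symmetric])
  qed
  show ?thesis by (simp only: *[of a b] *[of a' b'] assms(2,3))
qed

lemma witt_trunc_eq_iff: "witt_trunc n a = witt_trunc n b \<longleftrightarrow> (\<forall>k<n. a k = b k)"
  by (auto simp: fun_eq_iff witt_trunc_def)

subsection \<open>Subtraction and additive maps\<close>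

text \<open>Additivity packaged as a predicate, so that compatibility with zero, differences and
  finite sums is proved once for F, V, \<wp>, Teichmueller scaling and maps induced by ring
  morphisms.\<close>

definition witt_hom :: "nat \<Rightarrow> ((nat \<Rightarrow> 'a::comm_ring_1) \<Rightarrow> nat \<Rightarrow> 'b::comm_ring_1) \<Rightarrow> bool" where
  "witt_hom p f \<longleftrightarrow> (\<forall>a b. f (witt_op p (+) a b) = witt_op p (+) (f a) (f b))"

locale witt_prime =
  fixes p :: nat
  assumes p: "prime p"
begin

lemma p_gt_0: "p > 0"
  using p by (rule prime_gt_0_nat)

abbreviation wadd :: "(nat \<Rightarrow> 'a::comm_ring_1) \<Rightarrow> (nat \<Rightarrow> 'a) \<Rightarrow> nat \<Rightarrow> 'a" (infixl \<open>\<boxplus>\<close> 65)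
  where "wadd \<equiv> witt_op p (+)"

abbreviation wminus :: "(nat \<Rightarrow> 'a::comm_ring_1) \<Rightarrow> (nat \<Rightarrow> 'a) \<Rightarrow> nat \<Rightarrow> 'a" (infixl \<open>\<boxminus>\<close> 65)
  where "a \<boxminus> b \<equiv> a \<ominus>\<^bsub>witt_ring p\<^esub> b"

abbreviation wsum :: "('i \<Rightarrow> nat \<Rightarrow> 'a::comm_ring_1) \<Rightarrow> 'i set \<Rightarrow> nat \<Rightarrow> 'a"
  where "wsum \<equiv> finsum (witt_ring p)"

lemmas wadd_ac = witt_add_assoc[OF p] witt_add_commute[OF p] witt_add_left_commute[OF p]

lemma wadd_0 [simp]: "a \<boxplus> (\<lambda>_. 0) = a" "(\<lambda>_. 0) \<boxplus> a = a"
  using witt_add_zero[OF p] witt_add_commute[OF p] by metis+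

lemma wminus_add_cancel [simp]: "(a \<boxminus> b) \<boxplus> b = a"
proof -
  interpret abelian_group "witt_ring p :: (nat \<Rightarrow> 'a) ring" by (rule abelian_group_witt_ring[OF p])
  show ?thesis using l_neg[of b] by (simp add: a_minus_def wadd_ac)
qed

lemma wadd_right_cancel [simp]: "a \<boxplus> c = b \<boxplus> c \<longleftrightarrow> a = b"
proof -
  interpret abelian_group "witt_ring p :: (nat \<Rightarrow> 'a) ring" by (rule abelian_group_witt_ring[OF p])
  show ?thesis using add.right_cancel[of c a b] by simp
qed

lemma wadd_left_cancel [simp]: "c \<boxplus> a = c \<boxplus> b \<longleftrightarrow> a = b"
  by (simp add: witt_add_commute[OF p, of c])

lemma wminus_eq_iff: "a \<boxminus> b = c \<longleftrightarrow> a = c \<boxplus> b"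
  by (metis wadd_right_cancel wminus_add_cancel)

lemma wadd_minus_cancel [simp]: "(a \<boxplus> b) \<boxminus> b = a"
  by (simp add: wminus_eq_iff)

lemma wminus_self [simp]: "a \<boxminus> a = (\<lambda>_. 0)"
  by (simp add: wminus_eq_iff)

lemma wminus_0 [simp]: "a \<boxminus> (\<lambda>_. 0) = a"
  by (simp add: wminus_eq_iff)

lemma wminus_wadd_wadd: "(a \<boxplus> b) \<boxminus> (c \<boxplus> d) = (a \<boxminus> c) \<boxplus> (b \<boxminus> d)"
proof -
  have "a \<boxplus> b = ((a \<boxminus> c) \<boxplus> c) \<boxplus> ((b \<boxminus> d) \<boxplus> d)" by simp
  also have "\<dots> = ((a \<boxminus> c) \<boxplus> (b \<boxminus> d)) \<boxplus> (c \<boxplus> d)" by (simp only: wadd_ac)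
  finally show ?thesis by (simp only: wminus_eq_iff)
qed

lemma wsum_empty [simp]: "wsum f {} = (\<lambda>_. 0)"
proof -
  interpret abelian_group "witt_ring p :: (nat \<Rightarrow> 'a) ring" by (rule abelian_group_witt_ring[OF p])
  show ?thesis by simp
qed

lemma wsum_insert [simp]:
  "finite S \<Longrightarrow> x \<notin> S \<Longrightarrow> wsum f (insert x S) = f x \<boxplus> wsum f S"
  for f :: "'i \<Rightarrow> nat \<Rightarrow> 'a::comm_ring_1"
proof -
  interpret abelian_group "witt_ring p :: (nat \<Rightarrow> 'a) ring" by (rule abelian_group_witt_ring[OF p])
  show "finite S \<Longrightarrow> x \<notin> S \<Longrightarrow> wsum f (insert x S) = f x \<boxplus> wsum f S" by simp
qed

lemma wsum_cong: "(\<And>x. x \<in> S \<Longrightarrow> f x = g x) \<Longrightarrow> wsum f S = wsum g S"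
  for f :: "'i \<Rightarrow> nat \<Rightarrow> 'a::comm_ring_1"
proof -
  interpret abelian_group "witt_ring p :: (nat \<Rightarrow> 'a) ring" by (rule abelian_group_witt_ring[OF p])
  show "(\<And>x. x \<in> S \<Longrightarrow> f x = g x) \<Longrightarrow> wsum f S = wsum g S"
    by (rule finsum_cong') auto
qed

lemma wsum_mono_neutral:
  fixes f :: "'i \<Rightarrow> nat \<Rightarrow> 'a::comm_ring_1"
  assumes "finite S" "T \<subseteq> S" "\<And>x. x \<in> S - T \<Longrightarrow> f x = (\<lambda>_. 0)"
  shows "wsum f T = wsum f S"
proof -
  interpret abelian_group "witt_ring p :: (nat \<Rightarrow> 'a) ring" by (rule abelian_group_witt_ring[OF p])
  show ?thesis using assms by (intro add.finprod_mono_neutral_cong_left) auto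
qed

lemma wsum_reindex:
  fixes f :: "'i \<Rightarrow> nat \<Rightarrow> 'a::comm_ring_1"
  shows "inj_on h S \<Longrightarrow> wsum f (h ` S) = wsum (\<lambda>x. f (h x)) S"
proof -
  interpret abelian_group "witt_ring p :: (nat \<Rightarrow> 'a) ring" by (rule abelian_group_witt_ring[OF p])
  show "inj_on h S \<Longrightarrow> ?thesis" by (intro finsum_reindex) auto
qed

lemma wsum_add: "finite S \<Longrightarrow> wsum (\<lambda>x. f x \<boxplus> g x) S = wsum f S \<boxplus> wsum g S"
  for f :: "'i \<Rightarrow> nat \<Rightarrow> 'a::comm_ring_1"
  by (induction S rule: finite_induct) (simp_all add: wadd_ac)

lemma wsum_apply_0: "finite S \<Longrightarrow> wsum f S 0 = (\<Sum>x\<in>S. f x 0)"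
  for f :: "'i \<Rightarrow> nat \<Rightarrow> 'a::comm_ring_1"
  by (induction S rule: finite_induct) (simp_all add: witt_add_apply_0[OF p])

lemma wminus_apply_0: "(a \<boxminus> b) 0 = a 0 - b 0"
  using witt_add_apply_0[OF p, of "a \<boxminus> b" b] by simp

lemma wadd_cong: "(\<And>k. k < n \<Longrightarrow> a k = a' k) \<Longrightarrow> (\<And>k. k < n \<Longrightarrow> b k = b' k) \<Longrightarrow> k < n
    \<Longrightarrow> (a \<boxplus> b) k = (a' \<boxplus> b') k"
  using witt_add_trunc_cong[OF p, of n a a' b b'] by (auto simp: witt_trunc_eq_iff)

lemma wsum_cong_trunc:
  fixes f :: "'i \<Rightarrow> nat \<Rightarrow> 'a::comm_ring_1"
  assumes "finite S" "\<And>x k. x \<in> S \<Longrightarrow> k < n \<Longrightarrow> f x k = g x k" "k < n"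
  shows "wsum f S k = wsum g S k"
  using assms
  by (induction S arbitrary: k rule: finite_induct) (simp, simp, intro wadd_cong[where n = n], auto)

lemma witt_hom_add: "witt_hom p f \<Longrightarrow> f (a \<boxplus> b) = f a \<boxplus> f b"
  by (simp add: witt_hom_def)

lemma witt_hom_0: "witt_hom p f \<Longrightarrow> f (\<lambda>_. 0) = (\<lambda>_. 0)"
  using witt_hom_add[of f "\<lambda>_. 0" "\<lambda>_. 0"]
  by (metis wadd_0(1) wadd_left_cancel)

lemma witt_hom_minus: "witt_hom p f \<Longrightarrow> f (a \<boxminus> b) = f a \<boxminus> f b"
  by (metis wadd_minus_cancel witt_hom_add wminus_add_cancel)

lemma witt_hom_sum: "finite S \<Longrightarrow> witt_hom p f \<Longrightarrow> f (wsum g S) = wsum (\<lambda>x. f (g x)) S"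
  by (induction S rule: finite_induct) (simp_all add: witt_hom_0 witt_hom_add)

lemma witt_hom_comp: "ring_morph h \<Longrightarrow> witt_hom p ((\<circ>) h)"
  by (simp add: witt_hom_def ring_morph.witt_op)

lemma witt_hom_verschiebung: "witt_hom p verschiebung"
  by (simp add: witt_hom_def verschiebung_add[OF p])

lemma witt_hom_verschiebung_pow: "witt_hom p (verschiebung ^^ n)"
  by (simp add: witt_hom_def verschiebung_pow_add[OF p])

lemma witt_hom_teich_scale: "witt_hom p (teich_scale p y)"
  by (simp add: witt_hom_def teich_scale_add[OF p])

text \<open>Turns the topology of the theorem into agreement of components: equal truncations
  cancel, and the difference of the tails is again a V^n multiple.\<close>

lemma wminus_in_range_verschiebung_pow:
  "a \<boxminus> b \<in> range (verschiebung ^^ n) \<longleftrightarrow> (\<forall>k<n. a k = b k)"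
proof
  assume "a \<boxminus> b \<in> range (verschiebung ^^ n)"
  then obtain y where "a = b \<boxplus> (verschiebung ^^ n) y"
    using wminus_eq_iff witt_add_commute[OF p] by (metis imageE)
  then show "\<forall>k<n. a k = b k" by (simp add: witt_add_verschiebung_pow_apply[OF p])
next
  assume "\<forall>k<n. a k = b k"
  then have *: "witt_trunc n a = witt_trunc n b" by (simp add: witt_trunc_eq_iff)
  let ?V = "\<lambda>a. (verschiebung ^^ n) (\<lambda>k. a (k + n))"
  have "a \<boxminus> b = (witt_trunc n a \<boxplus> ?V a) \<boxminus> (witt_trunc n b \<boxplus> ?V b)"
    by (simp only: witt_trunc_add_tail[OF p])
  also have "\<dots> = ?V a \<boxminus> ?V b"
    by (simp add: wminus_wadd_wadd *)
  also have "\<dots> = (verschiebung ^^ n) ((\<lambda>k. a (k + n)) \<boxminus> (\<lambda>k. b (k + n)))"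
    by (simp add: witt_hom_minus[OF witt_hom_verschiebung_pow])
  finally show "a \<boxminus> b \<in> range (verschiebung ^^ n)" by blast
qed

end

subsection \<open>Frobenius\<close>

lemma ring_morph_power_CHAR:
  assumes "prime p" "CHAR('a::comm_ring_1) = p"
  shows "ring_morph (\<lambda>x::'a. x ^ p)"
  using assms by unfold_locales (simp_all add: freshmans_dream power_mult_distrib)

lemma witt_frobenius_comp: "witt_frobenius p a = (\<lambda>x. x ^ p) \<circ> a"
  by (auto simp: witt_frobenius_def)

lemma witt_frobenius_comp_morph:
  "ring_morph h \<Longrightarrow> h \<circ> witt_frobenius p a = witt_frobenius p (h \<circ> a)"
  by (auto simp: witt_frobenius_def ring_morph.power)

context witt_prime
begin

lemma witt_hom_frobenius:
  assumes "CHAR('a::comm_ring_1) = p"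
  shows "witt_hom p (witt_frobenius p :: (nat \<Rightarrow> 'a) \<Rightarrow> _)"
  using witt_hom_comp[OF ring_morph_power_CHAR[OF p assms]]
  by (simp add: witt_hom_def witt_frobenius_comp)

lemma witt_hom_wp:
  assumes "CHAR('a::comm_ring_1) = p"
  shows "witt_hom p (witt_wp p :: (nat \<Rightarrow> 'a) \<Rightarrow> _)"
  unfolding witt_hom_def witt_wp_def
  by (simp add: witt_hom_add[OF witt_hom_frobenius[OF assms]] wminus_wadd_wadd)

lemma frobenius_eq_add_wp: "witt_frobenius p a = a \<boxplus> witt_wp p a"
  by (metis witt_wp_def wminus_add_cancel witt_add_commute[OF p])

lemma frobenius_verschiebung:
  "witt_frobenius p (verschiebung a) = verschiebung (witt_frobenius p a)"
  using p_gt_0 by (auto simp: fun_eq_iff witt_frobenius_def verschiebung_def power_0_left split: nat.split)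

lemma frobenius_teichmueller: "witt_frobenius p (teichmueller x) = teichmueller (x ^ p)"
  using p_gt_0 by (auto simp: fun_eq_iff witt_frobenius_def teichmueller_def power_0_left)

lemma wp_verschiebung: "witt_wp p (verschiebung a) = verschiebung (witt_wp p a)"
  by (simp add: witt_wp_def frobenius_verschiebung witt_hom_minus[OF witt_hom_verschiebung])

lemma wp_comp:
  assumes "ring_morph h"
  shows "h \<circ> witt_wp p a = witt_wp p (h \<circ> a)"
  using assms by (simp add: witt_wp_def witt_hom_minus[OF witt_hom_comp] witt_frobenius_comp_morph)

lemma wp_apply_0: "witt_wp p a 0 = a 0 ^ p - a 0"
  by (simp add: witt_wp_def wminus_apply_0 witt_frobenius_def)

lemma wminus_eq_add: "a \<boxminus> b = a \<boxplus> ((\<lambda>_. 0) \<boxminus> b)"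
  by (simp add: wminus_eq_iff witt_add_assoc[OF p])

lemma wminus_cong:
  assumes "\<And>k. k < n \<Longrightarrow> a k = a' k" "\<And>k. k < n \<Longrightarrow> b k = b' k" "k < n"
  shows "(a \<boxminus> b) k = (a' \<boxminus> b') k"
proof -
  have "b \<boxminus> b' \<in> range (verschiebung ^^ n)"
    using assms by (simp add: wminus_in_range_verschiebung_pow)
  then obtain y where y: "b = b' \<boxplus> (verschiebung ^^ n) y"
    using wminus_eq_iff witt_add_commute[OF p] by (metis imageE)
  have "(a \<boxminus> b') = (a \<boxminus> b) \<boxplus> (verschiebung ^^ n) y"
    unfolding wminus_eq_iff by (metis wadd_ac wminus_add_cancel y)
  then have "(a \<boxminus> b) k = (a \<boxminus> b') k"
    using assms(3) by (simp add: witt_add_verschiebung_pow_apply[OF p])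
  also have "\<dots> = (a' \<boxminus> b') k"
    unfolding wminus_eq_add[of a b'] wminus_eq_add[of a' b'] using assms by (intro wadd_cong[where n = n]) auto
  finally show ?thesis .
qed

lemma wp_cong: "(\<And>k. k < n \<Longrightarrow> a k = b k) \<Longrightarrow> k < n \<Longrightarrow> witt_wp p a k = witt_wp p b k"
  unfolding witt_wp_def by (intro wminus_cong[where n = n]) (auto simp: witt_frobenius_def)

text \<open>On component n + 1 both sides are (a_n * y^(p^n))^p. With V alone the scalar would have
  to become y^p; the extra F absorbs this, which keeps all pole orders fixed.\<close>

lemma teich_scale_verschiebung:
  "teich_scale p y (verschiebung (witt_frobenius p a)) = verschiebung (witt_frobenius p (teich_scale p y a))"
  by (auto simp: fun_eq_iff teich_scale_def verschiebung_def witt_frobenius_def power_mult_distrib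
      mult.commute[of p] split: nat.split simp flip: power_mult)

lemma teich_scale_teichmueller: "teich_scale p y (teichmueller x) = teichmueller (x * y)"
  using p_gt_0 by (auto simp: fun_eq_iff teich_scale_def teichmueller_def)

lemma eq_verschiebung: "a 0 = 0 \<Longrightarrow> a = verschiebung (\<lambda>k. a (Suc k))"
  by (auto simp: fun_eq_iff verschiebung_def split: nat.split)

lemma verschiebung_eq_iff [simp]: "verschiebung a = verschiebung b \<longleftrightarrow> a = b"
  by (metis (no_types, lifting) ext nat.case(2) verschiebung_def)

section \<open>Integer powers of Teichmueller lifts\<close>

lemma teichmueller_power:
  "teichmueller y [^]\<^bsub>witt_ring p\<^esub> (n :: nat) = teichmueller (y ^ n)"
  by (induction n) (simp_all add: nat_pow_def witt_mult_teichmueller[OF p] teich_scale_teichmueller mult.commute)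

text \<open>The inverse is a definite description, so uniqueness is part of the proof:
  multiplication by [y] scales component n by the nonzero y^(p^n) and can be undone
  componentwise.\<close>

lemma inv_teichmueller:
  fixes y :: "'a::field"
  assumes "y \<noteq> 0"
  shows "inv\<^bsub>witt_ring p\<^esub> (teichmueller y) = teichmueller (inverse y)"
  unfolding m_inv_def
proof (rule the_equality)
  fix z assume "z \<in> carrier (witt_ring p) \<and> teichmueller y \<otimes>\<^bsub>witt_ring p\<^esub> z = \<one>\<^bsub>witt_ring p\<^esub> \<and>
      z \<otimes>\<^bsub>witt_ring p\<^esub> teichmueller y = \<one>\<^bsub>witt_ring p\<^esub>"
  then have "teich_scale p y z = teichmueller 1" by (simp add: witt_mult_teichmueller[OF p])
  then have "z n * y ^ p ^ n = teichmueller 1 n" for n by (metis teich_scale_def)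
  then have z: "z n = teichmueller 1 n / y ^ p ^ n" for n
    using assms by (simp add: eq_divide_eq)
  show "z = teichmueller (inverse y)"
    by (rule ext) (simp add: z teichmueller_def field_simps)
qed (use assms in \<open>simp add: witt_mult_teichmueller[OF p] teich_scale_teichmueller\<close>)

lemma mult_teichmueller_int_power:
  fixes y :: "'a::field"
  assumes "y \<noteq> 0" "i \<ge> 1"
  shows "a \<otimes>\<^bsub>witt_ring p\<^esub> (teichmueller y [^]\<^bsub>witt_ring p\<^esub> (- int i)) = teich_scale p (inverse y ^ i) a"
proof -
  have "teichmueller y [^]\<^bsub>witt_ring p\<^esub> (- int i) =
      inv\<^bsub>witt_ring p\<^esub> (teichmueller y [^]\<^bsub>witt_ring p\<^esub> i)"
    using assms(2) by (auto simp: int_pow_def2)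
  also have "\<dots> = teichmueller (inverse y ^ i)"
    using assms(1) by (simp add: teichmueller_power inv_teichmueller power_inverse)
  finally show ?thesis by (simp add: witt_mult_teichmueller[OF p])
qed

end

section \<open>Rational functions\<close>

subsection \<open>Field morphisms acting on coefficients\<close>

lemma ring_morph_eq_0_iff:
  fixes h :: "'a::field \<Rightarrow> 'b::field"
  assumes "ring_morph h"
  shows "h x = 0 \<longleftrightarrow> x = 0"
proof -
  interpret ring_morph h by fact
  have "h x * h (inverse x) = 1" if "x \<noteq> 0"
    using that by (metis mult one right_inverse)
  then show ?thesis by (metis mult_zero_left zero_neq_one zero)
qed

lemma ring_morph_inj:
  fixes h :: "'a::field \<Rightarrow> 'b::field"
  assumes "ring_morph h"
  shows "inj h"
  using ring_morph_eq_0_iff[OF assms] ring_morph.diff[OF assms]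
  by (metis injI eq_iff_diff_eq_0)

lemma ring_morph_inverse:
  fixes h :: "'a::field \<Rightarrow> 'b::field"
  assumes "ring_morph h"
  shows "h (inverse x) = inverse (h x)"
proof (cases "x = 0")
  case False
  then have "h x * h (inverse x) = 1"
    by (metis assms ring_morph.mult ring_morph.one right_inverse)
  then show ?thesis by (simp add: inverse_unique)
qed (simp add: ring_morph.zero[OF assms])

lemma ring_morph_map_poly:
  assumes "ring_morph h"
  shows "ring_morph (map_poly h)"
proof -
  interpret ring_morph h by fact
  show ?thesis
  proof
    show "map_poly h 1 = 1" by simp
    show "map_poly h (a + b) = map_poly h a + map_poly h b" for a b
      by (rule poly_eqI) (simp add: coeff_map_poly)
    show "map_poly h (a * b) = map_poly h a * map_poly h b" for a b
      by (rule poly_eqI) (simp add: coeff_map_poly coeff_mult sum)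
  qed
qed

lemma map_poly_eq_0_iff_morph:
  fixes h :: "'a::field \<Rightarrow> 'b::field"
  assumes "ring_morph h"
  shows "map_poly h q = 0 \<longleftrightarrow> q = 0"
  using ring_morph_eq_0_iff[OF assms] by (simp add: map_poly_eq_0_iff)

text \<open>The construction of \<open>ratfun_to_ac\<close> for an arbitrary field morphism, so that
  the embedding into the closure and the Galois action are treated together.\<close>

definition ratmap :: "('a::field \<Rightarrow> 'b::field) \<Rightarrow> 'a poly fract \<Rightarrow> 'b poly fract" where
  "ratmap h r = (THE s. \<exists>a b. b \<noteq> 0 \<and> r = Fract a b \<and> s = Fract (map_poly h a) (map_poly h b))"

lemma ratfun_to_ac_eq_ratmap: "ratfun_to_ac = ratmap to_ac"
  by (simp add: fun_eq_iff ratfun_to_ac_def ratmap_def)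

lemma ratmap_Fract:
  fixes h :: "'a::field \<Rightarrow> 'b::field"
  assumes h: "ring_morph h" and b: "b \<noteq> 0"
  shows "ratmap h (Fract a b) = Fract (map_poly h a) (map_poly h b)"
  unfolding ratmap_def
proof (rule the_equality)
  fix s
  assume "\<exists>c d. d \<noteq> 0 \<and> Fract a b = Fract c d \<and> s = Fract (map_poly h c) (map_poly h d)"
  then obtain c d where d: "d \<noteq> 0" and eq: "Fract a b = Fract c d"
    and s: "s = Fract (map_poly h c) (map_poly h d)"
    by blast
  have "a * d = c * b"
    using eq b d by (simp add: eq_fract)
  then have "map_poly h a * map_poly h d = map_poly h c * map_poly h b"
    by (metis ring_morph.mult[OF ring_morph_map_poly[OF h]])
  then show "s = Fract (map_poly h a) (map_poly h b)"
    using s b d by (simp add: eq_fract map_poly_eq_0_iff_morph[OF h])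
qed (use b in blast)

lemma ring_morph_ratmap:
  fixes h :: "'a::field \<Rightarrow> 'b::field"
  assumes h: "ring_morph h"
  shows "ring_morph (ratmap h)"
proof -
  interpret M: ring_morph "map_poly h" by (rule ring_morph_map_poly[OF h])
  note [simp] = map_poly_eq_0_iff_morph[OF h]
  show ?thesis
  proof
    show "ratmap h 1 = 1" by (simp add: One_fract_def ratmap_Fract[OF h])
    fix x y :: "'a poly fract"
    obtain a b c d where "x = Fract a b" "y = Fract c d" "b \<noteq> 0" "d \<noteq> 0"
      by (metis Fract_cases)
    then show "ratmap h (x + y) = ratmap h x + ratmap h y" "ratmap h (x * y) = ratmap h x * ratmap h y"
      by (simp_all add: ratmap_Fract[OF h])
  qed
qed

lemma ratmap_to_fract:
  fixes h :: "'a::field \<Rightarrow> 'b::field"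
  assumes h: "ring_morph h"
  shows "ratmap h (to_fract q) = to_fract (map_poly h q)"
  using ring_morph.one[OF ring_morph_map_poly[OF h]] ratmap_Fract[OF h, of 1 q]
  by (simp add: to_fract_def)

lemma ring_morph_ratfun_const: "ring_morph ratfun_const"
  by unfold_locales (simp_all add: ratfun_const_def one_pCons flip: to_fract_1 to_fract_add to_fract_mult)

lemma ratfun_const_eq_iff [simp]: "ratfun_const x = ratfun_const y \<longleftrightarrow> x = y"
  by (simp add: ratfun_const_def)

lemma ratmap_const:
  assumes "ring_morph h"
  shows "ratmap h (ratfun_const c) = ratfun_const (h c)"
  using ring_morph.zero[OF assms]
  by (simp add: ratfun_const_def ratmap_to_fract[OF assms] map_poly_pCons)

lemma ratmap_local_param:
  assumes h: "ring_morph h"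
  shows "ratmap h (local_param x) = local_param (map_proj_line h x)"
proof -
  interpret ring_morph h by fact
  show ?thesis
    using ring_morph_inverse[OF ring_morph_ratmap[OF h]]
    by (cases x) (auto simp: local_param_def ratmap_to_fract[OF h] map_poly_pCons divide_inverse
        ring_morph.mult[OF ring_morph_ratmap[OF h]] ring_morph.one[OF ring_morph_ratmap[OF h]])
qed

lemma local_param_nonzero [simp]: "local_param x \<noteq> 0"
  by (auto simp: local_param_def split: proj_line.split)

lemma CHAR_poly_fract [simp]: "CHAR('a::field poly fract) = CHAR('a)"
proof (rule CHAR_eqI)
  interpret ring_morph "ratfun_const :: 'a \<Rightarrow> _" by (rule ring_morph_ratfun_const)
  have eq: "(of_nat n :: 'a poly fract) = 0 \<longleftrightarrow> (of_nat n :: 'a) = 0" for n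
    using ring_morph_eq_0_iff[OF ring_morph_ratfun_const, of "of_nat n :: 'a"] of_nat[of n] by simp
  show "of_nat CHAR('a) = (0 :: 'a poly fract)"
    by (simp add: eq)
  show "CHAR('a) dvd n" if "of_nat n = (0 :: 'a poly fract)" for n
    using that by (simp add: eq of_nat_eq_0_iff_char_dvd)
qed

subsection \<open>Partial fractions\<close>

text \<open>
  The functions \<open>pole_term z\<close> for \<open>z = (x, j)\<close> with \<open>j \<ge> 1\<close> or \<open>x = Infinity\<close> are a basis of the
  rational functions over an algebraically closed field; \<open>(Infinity, 0)\<close> stands for the constant 1.
\<close>

definition pole_term :: "'a::field proj_line \<times> nat \<Rightarrow> 'a poly fract" where
  "pole_term z = inverse (local_param (fst z)) ^ snd z"

text \<open>Indices (Affine t, 0) are barred because their pole term is again 1, already represented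
  by (Infinity, 0); without this, coefficients would not be unique.\<close>

definition pf_coeffs :: "('a::field proj_line \<times> nat \<Rightarrow> 'a) \<Rightarrow> bool" where
  "pf_coeffs a \<longleftrightarrow> finite {z. a z \<noteq> 0} \<and> (\<forall>t. a (Affine t, 0) = 0)"

definition pf_sum :: "('a::field proj_line \<times> nat \<Rightarrow> 'a) \<Rightarrow> 'a poly fract" where
  "pf_sum a = (\<Sum>z | a z \<noteq> 0. ratfun_const (a z) * pole_term z)"

interpretation const: ring_morph ratfun_const
  by (rule ring_morph_ratfun_const)

lemma pf_sum_superset:
  "finite S \<Longrightarrow> {z. a z \<noteq> 0} \<subseteq> S \<Longrightarrow> pf_sum a = (\<Sum>z\<in>S. ratfun_const (a z) * pole_term z)"
  unfolding pf_sum_def by (intro sum.mono_neutral_left) auto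

lemma pf_coeffs_add: "pf_coeffs a \<Longrightarrow> pf_coeffs b \<Longrightarrow> pf_coeffs (\<lambda>z. a z + b z)"
  unfolding pf_coeffs_def by (auto intro: finite_subset[of _ "{z. a z \<noteq> 0} \<union> {z. b z \<noteq> 0}"])

lemma pf_sum_add:
  assumes "pf_coeffs a" "pf_coeffs b"
  shows "pf_sum (\<lambda>z. a z + b z) = pf_sum a + pf_sum b"
proof -
  let ?S = "{z. a z \<noteq> 0} \<union> {z. b z \<noteq> 0}"
  have "finite ?S" using assms by (auto simp: pf_coeffs_def)
  moreover have "{z. a z + b z \<noteq> 0} \<subseteq> ?S" by auto
  ultimately show ?thesis
    by (simp add: pf_sum_superset[of ?S] sum.distrib distrib_right)
qed

lemma pf_coeffs_scale: "pf_coeffs a \<Longrightarrow> pf_coeffs (\<lambda>z. c * a z)"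
  unfolding pf_coeffs_def by (auto intro: finite_subset[of _ "{z. a z \<noteq> 0}"])

lemma pf_sum_scale:
  assumes "pf_coeffs a"
  shows "pf_sum (\<lambda>z. c * a z) = ratfun_const c * pf_sum a"
proof -
  let ?S = "{z. a z \<noteq> 0}"
  have "finite ?S" using assms by (auto simp: pf_coeffs_def)
  then show ?thesis
    by (subst (1 2) pf_sum_superset[of ?S]) (auto simp: sum_distrib_left mult_ac)
qed

lemma pf_coeffs_diff: "pf_coeffs a \<Longrightarrow> pf_coeffs b \<Longrightarrow> pf_coeffs (\<lambda>z. a z - b z)"
  using pf_coeffs_add[OF _ pf_coeffs_scale[of b "-1"], of a] by simp

lemma pf_sum_diff: "pf_coeffs a \<Longrightarrow> pf_coeffs b \<Longrightarrow> pf_sum (\<lambda>z. a z - b z) = pf_sum a - pf_sum b"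
  using pf_sum_add[OF _ pf_coeffs_scale[of b "-1"], of a] pf_sum_scale[of b "-1"] by simp

definition pf_span :: "'a::field poly fract set" where
  "pf_span = pf_sum ` {a. pf_coeffs a}"

lemma pf_span_add: "r \<in> pf_span \<Longrightarrow> s \<in> pf_span \<Longrightarrow> r + s \<in> pf_span"
  unfolding pf_span_def by (auto simp: image_iff simp flip: pf_sum_add intro!: pf_coeffs_add)

lemma pf_span_scale: "r \<in> pf_span \<Longrightarrow> ratfun_const c * r \<in> pf_span"
  unfolding pf_span_def by (auto simp: image_iff simp flip: pf_sum_scale intro!: pf_coeffs_scale)

lemma pf_span_diff: "r \<in> pf_span \<Longrightarrow> s \<in> pf_span \<Longrightarrow> r - s \<in> pf_span"
  using pf_span_add[of r "ratfun_const (- 1) * s"] pf_span_scale[of s "-1"] by simp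

lemma pf_span_0: "0 \<in> pf_span"
  unfolding pf_span_def
  by (rule image_eqI[of _ _ "\<lambda>_. 0"]) (auto simp: pf_coeffs_def pf_sum_def)

lemma pf_span_sum: "(\<And>x. x \<in> S \<Longrightarrow> f x \<in> pf_span) \<Longrightarrow> sum f S \<in> pf_span"
  by (induction S rule: infinite_finite_induct) (auto simp: pf_span_0 pf_span_add)

lemma pole_term_in_pf_span:
  assumes "snd z \<ge> 1 \<or> fst z = Infinity"
  shows "pole_term z \<in> pf_span"
  unfolding pf_span_def
proof (rule image_eqI)
  show "pole_term z = pf_sum (\<lambda>w. if w = z then 1 else 0)"
    by (subst pf_sum_superset[of "{z}"]) auto
  show "(\<lambda>w. if w = z then 1 else 0) \<in> {a. pf_coeffs a}"
    using assms by (auto simp: pf_coeffs_def)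
qed

lemma pole_term_Infinity: "pole_term (Infinity, j) = to_fract [:0, 1:] ^ j"
  by (simp add: pole_term_def local_param_def)

lemma pole_term_Affine: "pole_term (Affine t, j) = inverse (to_fract [:- t, 1:]) ^ j"
  by (simp add: pole_term_def local_param_def)

lemma to_fract_power: "to_fract (q ^ n) = to_fract q ^ n"
  by (induction n) auto

lemma to_fract_in_pf_span:
  fixes q :: "'a::field poly"
  shows "to_fract q \<in> pf_span"
proof -
  have "to_fract (monom c i) = ratfun_const c * pole_term (Infinity, i)" for c :: 'a and i
    by (simp add: pole_term_Infinity ratfun_const_def monom_altdef flip: to_fract_power to_fract_mult)
  then have "to_fract (monom c i) \<in> pf_span" for c :: 'a and i
    by (simp add: pf_span_scale pole_term_in_pf_span)
  then have "(\<Sum>i\<le>degree q. to_fract (monom (Polynomial.coeff q i) i)) \<in> pf_span"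
    by (intro pf_span_sum)
  then show ?thesis
    by (simp add: poly_as_sum_of_monoms flip: to_fract_sum)
qed

lemma to_fract_linear: "to_fract [:- t, 1:] = to_fract [:0, 1:] - ratfun_const t"
  by (simp add: ratfun_const_def flip: to_fract_diff)

text \<open>At infinity, X = (X - t) + t lowers the power of X. At t itself the pole order rises by
  one. At s distinct from t, 1/((X-s)(X-t)) is 1/(s-t) times the difference of 1/(X-s) and
  1/(X-t).\<close>

lemma pole_term_div_linear:
  fixes z :: "'a::field proj_line \<times> nat"
  assumes "snd z \<ge> 1 \<or> fst z = Infinity"
  shows "pole_term z * inverse (to_fract [:- t, 1:]) \<in> pf_span"
proof -
  obtain x j where z: "z = (x, j)" by fastforce
  let ?v = "inverse (to_fract [:- t, 1:])"
  have v: "?v \<in> pf_span"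
    using pole_term_in_pf_span[of "(Affine t, 1)"] by (simp add: pole_term_Affine)
  show ?thesis
  proof (cases x)
    case Infinity
    have "to_fract [:0, 1:] ^ j * ?v \<in> pf_span"
    proof (induction j)
      case (Suc j)
      have "to_fract [:0, 1:] ^ Suc j * ?v =
          to_fract [:0, 1:] ^ j * (to_fract [:- t, 1:] * ?v) + ratfun_const t * (to_fract [:0, 1:] ^ j * ?v)"
        unfolding to_fract_linear by (simp add: algebra_simps)
      also have "to_fract [:- t, 1:] * ?v = 1" by simp
      finally show ?case
        using pf_span_add[OF pole_term_in_pf_span[of "(Infinity, j)"] pf_span_scale[OF Suc, of t]]
        by (simp add: pole_term_Infinity)
    qed (use v in simp)
    then show ?thesis by (simp add: z Infinity pole_term_Infinity)
  next
    case (Affine s)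
    show ?thesis
    proof (cases "s = t")
      case True
      have "pole_term z * ?v = pole_term (Affine t, Suc j)"
        by (simp add: z Affine True pole_term_Affine)
      then show ?thesis by (simp add: pole_term_in_pf_span)
    next
      case False
      let ?u = "inverse (to_fract [:- s, 1:])"
      have "to_fract [:- t, 1:] - to_fract [:- s, 1:] = ratfun_const (s - t)"
        unfolding to_fract_linear by simp
      then have "?u - ?v = ratfun_const (s - t) * (?u * ?v)"
        by (simp add: field_simps)
      then have "ratfun_const (inverse (s - t)) * (?u - ?v) =
          ratfun_const (inverse (s - t) * (s - t)) * (?u * ?v)"
        unfolding const.mult by (simp add: mult.assoc)
      then have uv: "?u * ?v = ratfun_const (inverse (s - t)) * (?u - ?v)"
        using False by simp
      have "?u ^ j * ?v \<in> pf_span"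
      proof (induction j)
        case (Suc j)
        have "?u ^ Suc j * ?v = ?u ^ j * (?u * ?v)" by simp
        also have "\<dots> = ratfun_const (inverse (s - t)) * (?u ^ Suc j - ?u ^ j * ?v)"
          unfolding uv by (simp add: algebra_simps)
        finally show ?case
          using pf_span_scale[OF pf_span_diff[OF pole_term_in_pf_span[of "(Affine s, Suc j)"] Suc]]
          by (simp add: pole_term_Affine)
      qed (use v in simp)
      then show ?thesis by (simp add: z Affine pole_term_Affine)
    qed
  qed
qed

lemma pf_span_div_linear:
  assumes "r \<in> pf_span"
  shows "r * inverse (to_fract [:- t, 1:]) \<in> pf_span"
proof -
  obtain a where a: "pf_coeffs a" "r = pf_sum a" using assms by (auto simp: pf_span_def)
  have "snd z \<ge> 1 \<or> fst z = Infinity" if "a z \<noteq> 0" for z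
    using a(1) that by (cases z; cases "fst z"; cases "snd z") (auto simp: pf_coeffs_def)
  then have "(\<Sum>z | a z \<noteq> 0. ratfun_const (a z) * (pole_term z * inverse (to_fract [:- t, 1:]))) \<in> pf_span"
    by (intro pf_span_sum pf_span_scale pole_term_div_linear) auto
  then show ?thesis by (simp add: a(2) pf_sum_def sum_distrib_right mult.assoc)
qed

text \<open>Over an algebraically closed field the denominator splits; its linear factors are
  divided out one at a time, each division staying in the span.\<close>

theorem partial_fractions_exist:
  fixes r :: "'a::alg_closed_field poly fract"
  obtains a where "pf_coeffs a" "r = pf_sum a"
proof -
  obtain n d where r: "r = Fract n d" and d: "d \<noteq> 0" by (metis Fract_cases)
  obtain A where "d = smult (lead_coeff d) (\<Prod>x\<in>#A. [:- x, 1:])"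
    using alg_closed_imp_factorization[OF d] by blast
  moreover define l where "l = lead_coeff d"
  ultimately have dA: "d = [:l:] * (\<Prod>x\<in>#A. [:- x, 1:])" by simp
  have "q * inverse (to_fract (\<Prod>x\<in>#A. [:- x, 1:])) \<in> pf_span" if "q \<in> pf_span" for q
    using that
  proof (induction A arbitrary: q)
    case (add x A)
    then show ?case
      using add.IH[OF pf_span_div_linear[OF add.prems, of x]]
      by (simp only: image_mset_add_mset prod_mset.add_mset to_fract_mult inverse_mult_distrib mult_ac)
  qed simp
  from pf_span_scale[OF this[OF to_fract_in_pf_span], of "inverse l" n]
  have "ratfun_const (inverse l) * (to_fract n * inverse (to_fract (\<Prod>x\<in>#A. [:- x, 1:]))) \<in> pf_span" .
  also have "ratfun_const (inverse l) = inverse (to_fract [:l:])"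
    using ring_morph_inverse[OF ring_morph_ratfun_const, of l] by (simp add: ratfun_const_def)
  also have "inverse (to_fract [:l:]) * (to_fract n * inverse (to_fract (\<Prod>x\<in>#A. [:- x, 1:]))) = r"
    unfolding r Fract_conv_to_fract dA to_fract_mult by (simp add: field_simps)
  finally show ?thesis
    using that by (auto simp: pf_span_def)
qed

text \<open>The local ring at t. It takes the place of a pole order: it is a ring containing all
  pole terms at other points, but not 1/(X - t).\<close>

definition regular_at :: "'a::field \<Rightarrow> 'a poly fract set" where
  "regular_at t = {r. \<exists>a b. poly b t \<noteq> 0 \<and> r = Fract a b}"

lemma regular_at_to_fract: "to_fract q \<in> regular_at t"
  unfolding regular_at_def to_fract_def by (rule CollectI) (rule exI[of _ q], rule exI[of _ 1], simp)

lemma regular_at_mult: "r \<in> regular_at t \<Longrightarrow> s \<in> regular_at t \<Longrightarrow> r * s \<in> regular_at t"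
proof -
  assume "r \<in> regular_at t" "s \<in> regular_at t"
  then obtain a b c d where "r = Fract a b" "s = Fract c d" "poly b t \<noteq> 0" "poly d t \<noteq> 0"
    by (auto simp: regular_at_def)
  then have "r * s = Fract (a * c) (b * d) \<and> poly (b * d) t \<noteq> 0" by auto
  then show ?thesis unfolding regular_at_def by blast
qed

lemma regular_at_add: "r \<in> regular_at t \<Longrightarrow> s \<in> regular_at t \<Longrightarrow> r + s \<in> regular_at t"
proof -
  assume "r \<in> regular_at t" "s \<in> regular_at t"
  then obtain a b c d where rs: "r = Fract a b" "s = Fract c d" "poly b t \<noteq> 0" "poly d t \<noteq> 0"
    by (auto simp: regular_at_def)
  then have "b \<noteq> 0" "d \<noteq> 0" by auto
  then have "r + s = Fract (a * d + c * b) (b * d) \<and> poly (b * d) t \<noteq> 0" using rs by auto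
  then show ?thesis unfolding regular_at_def by blast
qed

lemma regular_at_power: "r \<in> regular_at t \<Longrightarrow> r ^ n \<in> regular_at t"
  using regular_at_to_fract[of 1 t] by (induction n) (auto simp: regular_at_mult)

lemma regular_at_sum: "(\<And>x. x \<in> S \<Longrightarrow> f x \<in> regular_at t) \<Longrightarrow> sum f S \<in> regular_at t"
  using regular_at_to_fract[of 0 t]
  by (induction S rule: infinite_finite_induct) (auto simp: regular_at_add)

lemma regular_at_const: "ratfun_const c \<in> regular_at t"
  by (simp add: ratfun_const_def regular_at_to_fract)

lemma not_regular_at_pole: "inverse (to_fract [:- t, 1:]) \<notin> regular_at t"
proof
  assume "inverse (to_fract [:- t, 1:]) \<in> regular_at t"
  then obtain a b where b: "poly b t \<noteq> 0" and eq: "Fract 1 [:- t, 1:] = Fract a b"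
    by (auto simp: regular_at_def to_fract_def)
  from b have "b \<noteq> 0" by auto
  then have "b = a * [:- t, 1:]" using eq by (simp add: eq_fract)
  then have "poly b t = 0" by simp
  with b show False by simp
qed

lemma regular_at_pole_term:
  assumes "x \<noteq> Affine t"
  shows "pole_term (x, j) \<in> regular_at t"
proof (cases x)
  case (Affine s)
  then have "poly [:- s, 1:] t \<noteq> 0" using assms by auto
  then have "inverse (to_fract [:- s, 1:]) \<in> regular_at t"
    unfolding regular_at_def to_fract_def inverse_fract by blast
  then show ?thesis by (simp add: Affine pole_term_Affine regular_at_power)
qed (simp add: pole_term_Infinity regular_at_power regular_at_to_fract)

text \<open>If J is the highest order occurring at t, multiplying the vanishing sum by (X - t)^(J-1)
  makes every other term regular at t and leaves a nonzero multiple of 1/(X - t), a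
  contradiction.\<close>

theorem partial_fractions_unique_0:
  fixes a :: "'a::field proj_line \<times> nat \<Rightarrow> 'a"
  assumes a: "pf_coeffs a" and 0: "pf_sum a = 0"
  shows "a = (\<lambda>_. 0)"
proof -
  let ?S = "{z. a z \<noteq> 0}"
  have fin: "finite ?S" using a by (simp add: pf_coeffs_def)
  have affine: "a (Affine t, j) = 0" for t j
  proof (rule ccontr)
    assume "a (Affine t, j) \<noteq> 0"
    moreover have finJ: "finite {j. a (Affine t, j) \<noteq> 0}"
      using finite_vimageI[OF fin, of "Pair (Affine t)"] by (simp add: vimage_def inj_on_def)
    moreover define J where "J = Max {j. a (Affine t, j) \<noteq> 0}"
    ultimately have J: "a (Affine t, J) \<noteq> 0" and le: "\<And>j. a (Affine t, j) \<noteq> 0 \<Longrightarrow> j \<le> J"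
      using Max_in[OF finJ] Max_ge[OF finJ] by auto
    have "J \<noteq> 0" using J a by (metis pf_coeffs_def)
    let ?u = "to_fract [:- t, 1:]" and ?z = "(Affine t, J)"
    have "?u ^ (J - 1) * (ratfun_const (a z) * pole_term z) \<in> regular_at t" if z: "z \<in> ?S - {?z}" for z
    proof -
      obtain x j where xj: "z = (x, j)" by fastforce
      have "?u ^ (J - 1) * pole_term z \<in> regular_at t"
      proof (cases "x = Affine t")
        case True
        then have "j < J" using le[of j] z xj by (cases "j = J") auto
        then have "?u ^ (J - 1) = ?u ^ (J - 1 - j) * ?u ^ j"
          by (simp flip: power_add)
        then have "?u ^ (J - 1) * pole_term z = ?u ^ (J - 1 - j) * (?u ^ j * inverse ?u ^ j)"
          by (simp add: xj True pole_term_Affine mult.assoc)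
        also have "?u ^ j * inverse ?u ^ j = 1"
          by (simp flip: power_mult_distrib)
        finally show ?thesis by (simp add: regular_at_power regular_at_to_fract)
      next
        case False
        then show ?thesis
          by (simp add: xj regular_at_mult regular_at_power regular_at_to_fract regular_at_pole_term)
      qed
      from regular_at_mult[OF regular_at_const this, of "a z"] show ?thesis by (simp add: mult_ac)
    qed
    then have "(\<Sum>z\<in>?S - {?z}. ?u ^ (J - 1) * (ratfun_const (a z) * pole_term z)) \<in> regular_at t"
      by (rule regular_at_sum)
    also have "(\<Sum>z\<in>?S - {?z}. ?u ^ (J - 1) * (ratfun_const (a z) * pole_term z)) =
        ?u ^ (J - 1) * (pf_sum a - ratfun_const (a ?z) * pole_term ?z)"
      using fin J by (simp add: pf_sum_def sum_diff1 flip: sum_distrib_left)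
    also have "\<dots> = - ratfun_const (a ?z) * (?u ^ (J - 1) * inverse ?u ^ J)"
      by (simp add: 0 pole_term_Affine)
    also have "inverse ?u ^ J = inverse ?u ^ (J - 1) * inverse ?u"
      using \<open>J \<noteq> 0\<close> by (simp flip: power_Suc2)
    also have "?u ^ (J - 1) * (inverse ?u ^ (J - 1) * inverse ?u) = inverse ?u"
      by (simp flip: mult.assoc power_mult_distrib)
    finally have "- ratfun_const (a ?z) * inverse ?u \<in> regular_at t" .
    from regular_at_mult[OF regular_at_const this, of "- inverse (a ?z)"]
    have "ratfun_const (inverse (a ?z) * a ?z) * inverse ?u \<in> regular_at t"
      unfolding const.mult const.uminus by (simp add: mult_ac)
    then show False using J not_regular_at_pole[of t] by simp
  qed
  \<comment> \<open>Only the point at infinity is left, so the sum is a polynomial and the a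
    (Infinity, j) are its coefficients.\<close>
  define T where "T = {j. a (Infinity, j) \<noteq> 0}"
  have "finite T" unfolding T_def
    using finite_vimageI[OF fin, of "Pair Infinity"] by (simp add: vimage_def inj_on_def)
  have S: "?S = Pair Infinity ` T"
  proof (intro Set.set_eqI iffI)
    fix z assume "z \<in> ?S"
    then show "z \<in> Pair Infinity ` T"
      using affine by (cases z; cases "fst z") (auto simp: T_def)
  qed (auto simp: T_def)
  have "to_fract (monom c j) = ratfun_const c * pole_term (Infinity, j)" for c :: 'a and j
    by (simp add: pole_term_Infinity ratfun_const_def monom_altdef flip: to_fract_power to_fract_mult)
  then have "pf_sum a = to_fract (\<Sum>j\<in>T. monom (a (Infinity, j)) j)"
    unfolding pf_sum_def S by (subst sum.reindex) (auto simp: inj_on_def)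
  then have "(\<Sum>j\<in>T. monom (a (Infinity, j)) j) = 0"
    using 0 by (metis to_fract_eq_0_iff)
  then have "Polynomial.coeff (\<Sum>j\<in>T. monom (a (Infinity, j)) j) k = 0" for k by simp
  then have *: "(\<Sum>j\<in>T. if j = k then a (Infinity, j) else 0) = 0" for k
    by (simp add: coeff_sum)
  have "a (Infinity, k) = 0" for k
    using \<open>finite T\<close> *[of k] by (cases "k \<in> T") (simp_all add: T_def)
  then show ?thesis
    using affine by (intro ext) (metis prod.exhaust proj_line.exhaust)
qed

theorem partial_fractions_unique:
  assumes "pf_coeffs a" "pf_coeffs b" "pf_sum a = pf_sum b"
  shows "a = b"
  using partial_fractions_unique_0[OF pf_coeffs_diff[OF assms(1,2)]] assms
  by (auto simp: pf_sum_diff fun_eq_iff)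

subsection \<open>The Artin--Schreier operator in terms of partial fractions\<close>

text \<open>The partial fraction coefficients of the p-th power: raising to the power p is additive
  and multiplies every pole order by p.\<close>

definition pf_frob :: "nat \<Rightarrow> ('a::field proj_line \<times> nat \<Rightarrow> 'a) \<Rightarrow> 'a proj_line \<times> nat \<Rightarrow> 'a" where
  "pf_frob p a = (\<lambda>(x, j). if p dvd j then a (x, j div p) ^ p else 0)"

lemma pf_frob_support:
  assumes "p > 0"
  shows "{z. pf_frob p a z \<noteq> 0} \<subseteq> (\<lambda>(x, j). (x, p * j)) ` {z. a z \<noteq> 0}"
proof
  fix z assume z: "z \<in> {z. pf_frob p a z \<noteq> 0}"
  obtain x j where xj: "z = (x, j)" by fastforce
  show "z \<in> (\<lambda>(x, j). (x, p * j)) ` {z. a z \<noteq> 0}"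
    using z assms unfolding xj
    by (intro image_eqI[of _ _ "(x, j div p)"]) (auto simp: pf_frob_def power_0_left split: if_splits)
qed

lemma pf_coeffs_frob:
  assumes "p > 0" "pf_coeffs a"
  shows "pf_coeffs (pf_frob p a)"
  unfolding pf_coeffs_def
proof
  show "finite {z. pf_frob p a z \<noteq> 0}"
    by (rule finite_subset[OF pf_frob_support[OF assms(1)]])
      (use assms(2) in \<open>simp add: pf_coeffs_def\<close>)
qed (use assms in \<open>auto simp: pf_frob_def pf_coeffs_def power_0_left\<close>)

lemma pf_sum_frob:
  fixes a :: "'a::field proj_line \<times> nat \<Rightarrow> 'a"
  assumes p: "prime p" "CHAR('a) = p" and a: "pf_coeffs a"
  shows "pf_sum (pf_frob p a) = pf_sum a ^ p"
proof -
  have p0: "p > 0" using p(1) by (rule prime_gt_0_nat)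
  let ?f = "\<lambda>(x :: 'a proj_line, j). (x, p * j)"
  have inj: "inj_on ?f S" for S using p0 by (auto simp: inj_on_def)
  have fin: "finite {z. a z \<noteq> 0}" using a by (simp add: pf_coeffs_def)
  have "pf_sum a ^ p = (\<Sum>z | a z \<noteq> 0. (ratfun_const (a z) * pole_term z) ^ p)"
    unfolding pf_sum_def by (rule freshmans_dream_sum) (use p in auto)
  also have "\<dots> = (\<Sum>z | a z \<noteq> 0. ratfun_const (pf_frob p a (?f z)) * pole_term (?f z))"
    using p0 by (intro sum.cong)
      (auto simp: pf_frob_def pole_term_def power_mult_distrib mult.commute[of p] simp flip: power_mult)
  also have "\<dots> = (\<Sum>z\<in>?f ` {z. a z \<noteq> 0}. ratfun_const (pf_frob p a z) * pole_term z)"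
    by (subst sum.reindex[OF inj]) simp
  also have "\<dots> = pf_sum (pf_frob p a)"
    using fin pf_frob_support[OF p0] by (intro pf_sum_superset[symmetric]) auto
  finally show ?thesis by simp
qed

text \<open>If u had a term of highest order J \<ge> 1 at x, then u^p has order p * J > J there,
  where u itself cannot cancel it. So d would have a nonzero coefficient at an order divisible by p.
  Hence u is constant and d has no poles. Infinity is covered like any other point.\<close>

theorem artin_schreier_unique:
  fixes d :: "'a::alg_closed_field proj_line \<times> nat \<Rightarrow> 'a"
  assumes p: "prime p" "CHAR('a) = p" and d: "pf_coeffs d"
    and reduced: "\<And>x j. j \<ge> 1 \<Longrightarrow> p dvd j \<Longrightarrow> d (x, j) = 0"
    and eq: "pf_sum d = u ^ p - u"
  shows "\<exists>z. u = ratfun_const z" and "\<And>x j. j \<ge> 1 \<Longrightarrow> d (x, j) = 0"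
proof -
  have p1: "p > 1" using p(1) by (rule prime_gt_1_nat)
  obtain a where a: "pf_coeffs a" and u: "u = pf_sum a" by (rule partial_fractions_exist)
  have "pf_sum d = pf_sum (\<lambda>z. pf_frob p a z - a z)"
    using eq p a p1 by (simp add: u pf_sum_diff pf_coeffs_frob pf_sum_frob)
  then have da: "d = (\<lambda>z. pf_frob p a z - a z)"
    using d a p1 by (intro partial_fractions_unique pf_coeffs_diff pf_coeffs_frob) auto
  have a0: "a (x, j) = 0" if j: "j \<ge> 1" for x j
  proof (rule ccontr)
    assume nz: "a (x, j) \<noteq> 0"
    have finJ: "finite {j. a (x, j) \<noteq> 0}"
      using finite_vimageI[of "{z. a z \<noteq> 0}" "Pair x"] a
      by (simp add: vimage_def inj_on_def pf_coeffs_def)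
    define J where "J = Max {j. a (x, j) \<noteq> 0}"
    have J: "a (x, J) \<noteq> 0" and le: "\<And>j. a (x, j) \<noteq> 0 \<Longrightarrow> j \<le> J"
      unfolding J_def using Max_in[OF finJ] Max_ge[OF finJ] nz by auto
    have J1: "J \<ge> 1" using le[OF nz] j by simp
    then have "p * J > J" using p1 by simp
    then have "a (x, p * J) = 0" using le[of "p * J"] by fastforce
    moreover have "d (x, p * J) = 0" using J1 p1 by (intro reduced) auto
    ultimately have "a (x, J) ^ p = 0"
      using fun_cong[OF da, of "(x, p * J)"] p1 by (simp add: pf_frob_def)
    with J show False by simp
  qed
  have "a (Affine t, j) = 0" for t j
    using a a0[of j "Affine t"] by (cases j) (auto simp: pf_coeffs_def)
  then have "a z = 0" if "z \<noteq> (Infinity, 0)" for z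
    using a0 that by (cases z; cases "fst z"; cases "snd z") auto
  then have "u = ratfun_const (a (Infinity, 0))"
    unfolding u by (subst pf_sum_superset[of "{(Infinity, 0)}"]) (auto simp: pole_term_def)
  then show "\<exists>z. u = ratfun_const z" by blast
  show "d (x, j) = 0" if "j \<ge> 1" for x j
  proof (cases "p dvd j")
    case True
    then show ?thesis using reduced that by blast
  next
    case False
    then show ?thesis using a0[OF that, of x] by (simp add: da pf_frob_def)
  qed
qed

subsection \<open>Galois descent\<close>

lemma ring_morph_to_ac: "ring_morph to_ac"
  by unfold_locales auto

lemma field_aut_ring_morph:
  assumes "\<sigma> \<in> field_auts_fixing S"
  shows "ring_morph \<sigma>"
proof -
  have bij: "bij \<sigma>" and add: "\<And>x y. \<sigma> (x + y) = \<sigma> x + \<sigma> y" and mult: "\<And>x y. \<sigma> (x * y) = \<sigma> x * \<sigma> y"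
    using assms by (auto simp: field_auts_fixing_def)
  have "\<sigma> 0 = 0" using add[of 0 0] by (metis add.right_neutral add_left_cancel)
  then have "\<sigma> 1 \<noteq> 0" using bij by (metis bij_is_inj inj_eq zero_neq_one)
  then have "\<sigma> 1 = 1" using mult[of 1 1] by simp
  then show ?thesis using add mult by unfold_locales
qed

text \<open>For fixed y the polynomials (X + y)^q and X^q + y^q have degree at most q and the same
  coefficient at q, so agreement on the q elements of the finite field makes them equal.\<close>

lemma power_card_add:
  fixes x y :: "'a::finite_field alg_closure"
  shows "(x + y) ^ CARD('a) = x ^ CARD('a) + y ^ CARD('a)"
proof -
  let ?q = "CARD('a)"
  let ?k = "range (to_ac :: 'a \<Rightarrow> _)"
  have q: "?q > 0" by simp
  have card: "card ?k = ?q" by (simp add: card_image inj_to_ac)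
  have fix_k: "z ^ ?q = z" if "z \<in> ?k" for z
    using that by (auto simp: finite_field_power_card_eq_same simp flip: to_ac_power)
  have *: "[:y, 1:] ^ ?q = monom 1 ?q + [:y ^ ?q:]"
    if "\<And>z. z \<in> ?k \<Longrightarrow> (z + y) ^ ?q = z ^ ?q + y ^ ?q" for y :: "'a alg_closure"
  proof (rule poly_eqI_degree_lead_coeff[where n = ?q and A = ?k])
    show "Polynomial.degree ([:y, 1:] ^ ?q) \<le> ?q"
      using degree_power_le[of "[:y, 1:]" ?q] by simp
    show "Polynomial.degree (monom 1 ?q + [:y ^ ?q:]) \<le> ?q"
      by (intro degree_add_le) (simp_all add: degree_monom_le)
    show "Polynomial.coeff ([:y, 1:] ^ ?q) ?q = Polynomial.coeff (monom 1 ?q + [:y ^ ?q:]) ?q"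
      using q coeff_linear_power[of y ?q] by (simp add: coeff_pCons split: nat.split)
    show "\<And>z. z \<in> ?k \<Longrightarrow> poly ([:y, 1:] ^ ?q) z = poly (monom 1 ?q + [:y ^ ?q:]) z"
      using that by (simp add: poly_monom add.commute)
  qed (simp add: card)
  have "(x + y) ^ ?q = x ^ ?q + y ^ ?q" if y: "y \<in> ?k" for x y :: "'a alg_closure"
  proof -
    have "(z + y) ^ ?q = z ^ ?q + y ^ ?q" if "z \<in> ?k" for z
    proof -
      have "z + y \<in> ?k" using y that by (auto simp flip: to_ac_add)
      then show ?thesis using y that by (simp add: fix_k)
    qed
    from arg_cong[OF *[OF this], of "\<lambda>f. poly f x"] show ?thesis
      by (simp add: poly_monom add.commute)
  qed
  \<comment> \<open>The case just settled, with the summands exchanged, supplies agreement on the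
    finite field for an arbitrary y of the closure.\<close>
  then have "(z + y) ^ ?q = z ^ ?q + y ^ ?q" if "z \<in> ?k" for z
    using that by (metis add.commute)
  from arg_cong[OF *[OF this], of "\<lambda>f. poly f x"] show ?thesis
    by (simp add: poly_monom add.commute)
qed

text \<open>X^q - X has at most q roots, and the finite field already provides q of them.\<close>

lemma power_card_eq_iff:
  fixes x :: "'a::finite_field alg_closure"
  shows "x ^ CARD('a) = x \<longleftrightarrow> x \<in> range to_ac"
proof
  let ?q = "CARD('a)"
  let ?f = "monom 1 ?q - [:0, 1:] :: 'a alg_closure poly"
  have q: "?q > 1" using card_mono[of UNIV "{0, 1 :: 'a}"] by simp
  have f: "poly ?f y = y ^ ?q - y" for y by (simp add: poly_monom)
  have "Polynomial.coeff ?f ?q = 1" using q by (simp add: coeff_pCons split: nat.split)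
  then have nz: "?f \<noteq> 0" by (metis coeff_0 zero_neq_one)
  have deg: "Polynomial.degree ?f \<le> ?q"
    using q by (intro degree_diff_le) (simp_all add: degree_monom_le)
  have sub: "range (to_ac :: 'a \<Rightarrow> _) \<subseteq> {y. poly ?f y = 0}"
    by (auto simp: poly_monom finite_field_power_card_eq_same simp flip: to_ac_power)
  have "range (to_ac :: 'a \<Rightarrow> _) = {y. poly ?f y = 0}"
  proof (rule card_subset_eq[OF poly_roots_finite[OF nz] sub])
    have "card {y. poly ?f y = 0} \<le> ?q" using card_poly_roots_bound[OF nz] deg by linarith
    moreover have "card (range (to_ac :: 'a \<Rightarrow> _)) = ?q" by (simp add: card_image inj_to_ac)
    ultimately show "card (range (to_ac :: 'a \<Rightarrow> _)) = card {y. poly ?f y = 0}"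
      using card_mono[OF poly_roots_finite[OF nz] sub] by linarith
  qed
  moreover assume "x ^ ?q = x"
  ultimately show "x \<in> range to_ac" using f[of x] by auto
qed (auto simp: finite_field_power_card_eq_same simp flip: to_ac_power)

text \<open>The Frobenius of the closure over the finite field. Its fixed points are exactly that
  field, so descent is carried out with this one automorphism.\<close>

lemma power_card_aut:
  "(\<lambda>x. x ^ CARD('a)) \<in> field_auts_fixing (range (to_ac :: 'a::finite_field \<Rightarrow> 'a alg_closure))"
proof -
  let ?\<phi> = "\<lambda>x :: 'a alg_closure. x ^ CARD('a)"
  have m: "ring_morph ?\<phi>" by unfold_locales (simp_all add: power_card_add power_mult_distrib)
  have "surj ?\<phi>"
    using nth_root_exists[of "CARD('a)"] by (metis zero_less_card_finite surjI someI_ex)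
  then have "bij ?\<phi>" using ring_morph_inj[OF m] by (simp add: bij_def)
  then show ?thesis
    using power_card_eq_iff[where 'a = 'a] by (auto simp: field_auts_fixing_def power_card_add power_mult_distrib)
qed

lemma map_poly_fixed_imp_range:
  fixes q :: "'a::finite_field alg_closure poly"
  assumes "map_poly (\<lambda>x. x ^ CARD('a)) q = q"
  shows "q \<in> range (map_poly to_ac)"
proof -
  have "Polynomial.coeff q n \<in> range to_ac" for n
    using arg_cong[OF assms, of "\<lambda>f. Polynomial.coeff f n"]
    by (simp add: coeff_map_poly power_0_left flip: power_card_eq_iff)
  then have "q = map_poly to_ac (map_poly of_ac q)"
    by (intro poly_eqI) (simp add: coeff_map_poly to_ac_of_ac)
  then show ?thesis by blast
qed

text \<open>A fraction fixed by Frobenius has a monic denominator of minimal degree, which is unique and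
  hence fixed as well.\<close>

lemma ratmap_fixed_imp_range:
  fixes r :: "'a::finite_field alg_closure poly fract"
  assumes fixed: "ratmap (\<lambda>x. x ^ CARD('a)) r = r"
  shows "r \<in> range ratfun_to_ac"
proof -
  define \<phi> where "\<phi> = (\<lambda>x :: 'a alg_closure. x ^ CARD('a))"
  have m: "ring_morph \<phi>" using field_aut_ring_morph[OF power_card_aut] by (simp add: \<phi>_def)
  have deg: "Polynomial.degree (map_poly \<phi> f) = Polynomial.degree f" for f
    using ring_morph_eq_0_iff[OF m] by (intro degree_map_poly) auto
  let ?P = "\<lambda>b. lead_coeff b = 1 \<and> (\<exists>a. r = Fract a b)"
  have "\<exists>b. ?P b"
  proof -
    obtain a b where r: "r = Fract a b" and b: "b \<noteq> 0" by (metis Fract_cases)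
    define c where "c = inverse (lead_coeff b)"
    have c: "c \<noteq> 0" using b by (simp add: c_def)
    have "r = Fract (smult c a) (smult c b)"
      unfolding r using b c by (simp add: eq_fract)
    moreover have "lead_coeff (smult c b) = 1" using b by (simp add: c_def)
    ultimately show ?thesis by blast
  qed
  then obtain b where b: "?P b" and min: "\<And>b'. ?P b' \<Longrightarrow> Polynomial.degree b \<le> Polynomial.degree b'"
    using ex_has_least_nat[of ?P _ Polynomial.degree] by blast
  obtain a where r: "r = Fract a b" using b by blast
  have b0: "b \<noteq> 0" using b by auto
  have r': "r = Fract (map_poly \<phi> a) (map_poly \<phi> b)"
    using fixed ratmap_Fract[OF m b0, of a] by (simp add: r \<phi>_def)
  have mb: "map_poly \<phi> b \<noteq> 0" using b0 map_poly_eq_0_iff_morph[OF m] by simp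
  have cross: "a * map_poly \<phi> b = map_poly \<phi> a * b"
    using r r' b0 mb by (simp add: eq_fract)
  have lead: "lead_coeff (map_poly \<phi> b) = 1"
    using b lead_coeff_map_poly_nz[of \<phi> b] ring_morph.zero[OF m] ring_morph.one[OF m] by simp
  have "map_poly \<phi> b = b"
  proof (rule ccontr)
    assume ne: "map_poly \<phi> b \<noteq> b"
    \<comment> \<open>Subtracting numerators and denominators of two expressions of r gives a third
      one. Its denominator has smaller degree because both denominators are monic of equal
      degree.\<close>
    define e where "e = b - map_poly \<phi> b"
    define c where "c = inverse (lead_coeff e)"
    have e: "e \<noteq> 0" using ne by (simp add: e_def)
    then have c: "c \<noteq> 0" by (simp add: c_def)
    have "a * e = (a - map_poly \<phi> a) * b"
      by (simp add: e_def algebra_simps cross)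
    then have "r = Fract (smult c (a - map_poly \<phi> a)) (smult c e)"
      unfolding r using b0 e c by (simp add: eq_fract)
    moreover have "lead_coeff (smult c e) = 1" using e by (simp add: c_def)
    ultimately have "Polynomial.degree b \<le> Polynomial.degree (smult c e)" by (intro min) blast
    then have le: "Polynomial.degree b \<le> Polynomial.degree e" using c by simp
    have "Polynomial.degree e \<le> Polynomial.degree b"
      unfolding e_def by (intro degree_diff_le) (simp_all add: deg)
    with le have "lead_coeff e = Polynomial.coeff b (Polynomial.degree b) - Polynomial.coeff (map_poly \<phi> b) (Polynomial.degree b)"
      by (simp add: e_def)
    also have "\<dots> = 0" using b lead by (simp add: deg)
    finally show False using e by simp
  qed
  moreover from this have "map_poly \<phi> a = a" using cross b0 by simp
  ultimately have "a \<in> range (map_poly to_ac)" "b \<in> range (map_poly to_ac)"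
    using map_poly_fixed_imp_range by (auto simp: \<phi>_def)
  then obtain a' b' where ab: "a = map_poly to_ac a'" "b = map_poly to_ac b'" by blast
  then have "b' \<noteq> 0" using b0 by auto
  then have "r = ratfun_to_ac (Fract a' b')" by (simp add: r ab ratfun_to_ac_Fract)
  then show ?thesis by blast
qed

subsection \<open>The trace of a finite field\<close>

lemma card_prime_subfield: "card (prime_subfield :: 'a::finite_field set) = CHAR('a)"
proof -
  have "inj_on (of_nat :: nat \<Rightarrow> 'a) {..<CHAR('a)}"
  proof (rule linorder_inj_onI')
    fix m n assume "m \<in> {..<CHAR('a)}" "n \<in> {..<CHAR('a)}" "m < n"
    then have "\<not> CHAR('a) dvd n - m" by (intro nat_dvd_not_less) auto
    then show "of_nat m \<noteq> (of_nat n :: 'a)" using of_nat_eq_iff_char_dvd[OF \<open>m < n\<close>] by blast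
  qed
  moreover have "prime_subfield = (of_nat :: nat \<Rightarrow> 'a) ` {..<CHAR('a)}"
  proof -
    have "of_nat n \<in> (of_nat :: nat \<Rightarrow> 'a) ` {..<CHAR('a)}" for n
    proof -
      have "(of_nat n :: 'a) = of_nat (CHAR('a) * (n div CHAR('a)) + n mod CHAR('a))" by simp
      also have "\<dots> = of_nat (n mod CHAR('a))" unfolding of_nat_add of_nat_mult by simp
      finally show ?thesis by (intro image_eqI) auto
    qed
    then show ?thesis by (auto simp: prime_subfield_def)
  qed
  ultimately show ?thesis by (metis card_image card_lessThan)
qed

lemma power_CHAR_eq_iff:
  fixes x :: "'a::finite_field"
  shows "x ^ CHAR('a) = x \<longleftrightarrow> x \<in> prime_subfield"
proof -
  let ?p = "CHAR('a)"
  let ?f = "monom 1 ?p - [:0, 1:] :: 'a poly"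
  have p: "prime ?p" by simp
  then have p1: "?p > 1" by (rule prime_gt_1_nat)
  interpret ring_morph "\<lambda>x::'a. x ^ ?p" by (rule ring_morph_power_CHAR[OF p refl])
  have f: "poly ?f y = y ^ ?p - y" for y by (simp add: poly_monom)
  have "Polynomial.coeff ?f ?p = 1" using p1 by (simp add: coeff_pCons split: nat.split)
  then have nz: "?f \<noteq> 0" by (metis coeff_0 zero_neq_one)
  have deg: "Polynomial.degree ?f \<le> ?p"
    using p1 by (intro degree_diff_le) (simp_all add: degree_monom_le)
  have sub: "(prime_subfield :: 'a set) \<subseteq> {y. poly ?f y = 0}"
    using of_nat by (auto simp: poly_monom prime_subfield_def)
  have "card {y. poly ?f y = 0} \<le> ?p" using card_poly_roots_bound[OF nz] deg by linarith
  then have "card (prime_subfield :: 'a set) = card {y. poly ?f y = 0}"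
    using card_mono[OF _ sub] by (simp add: card_prime_subfield)
  then have "prime_subfield = {y. poly ?f y = 0}"
    using sub by (intro card_subset_eq) auto
  then have "x \<in> prime_subfield \<longleftrightarrow> poly ?f x = 0" by blast
  then show ?thesis unfolding f by simp
qed

lemma abs_trace_add: "abs_trace (x + y) = abs_trace x + abs_trace y"
  unfolding abs_trace_def sum.distrib[symmetric]
  by (intro sum.cong) (auto simp: field_auts_fixing_def)

lemma abs_trace_diff: "abs_trace (x - y) = abs_trace x - abs_trace y"
  using abs_trace_add[of "x - y" y] by simp

lemma abs_trace_scale: "c \<in> prime_subfield \<Longrightarrow> abs_trace (c * x) = c * abs_trace x"
  unfolding abs_trace_def sum_distrib_left by (intro sum.cong) (auto simp: field_auts_fixing_def)

text \<open>Precomposition with the Frobenius permutes the automorphisms over which the trace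
  sums.\<close>

lemma abs_trace_power_CHAR: "abs_trace (x ^ CHAR('a)) = abs_trace (x :: 'a::finite_field)"
proof -
  let ?\<phi> = "\<lambda>x::'a. x ^ CHAR('a)" and ?G = "field_auts_fixing (prime_subfield :: 'a set)"
  have m: "ring_morph ?\<phi>" by (rule ring_morph_power_CHAR) auto
  have \<phi>: "bij ?\<phi>" using ring_morph_inj[OF m] by (simp add: bij_def finite_UNIV_inj_surj)
  have "bij_betw (\<lambda>\<sigma>. \<sigma> \<circ> ?\<phi>) ?G ?G"
  proof (rule bij_betw_imageI)
    show "inj_on (\<lambda>\<sigma>. \<sigma> \<circ> ?\<phi>) ?G"
      using \<phi> by (intro inj_onI) (metis bij_is_surj surj_fun_eq)
    have sub: "(\<lambda>\<sigma>. \<sigma> \<circ> ?\<phi>) ` ?G \<subseteq> ?G"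
      using \<phi> ring_morph.add[OF m] by (auto simp: field_auts_fixing_def bij_comp power_mult_distrib
          power_CHAR_eq_iff[symmetric])
    show "(\<lambda>\<sigma>. \<sigma> \<circ> ?\<phi>) ` ?G = ?G"
      by (rule card_subset_eq[OF _ sub]) (simp_all add: card_image \<open>inj_on _ _\<close>)
  qed
  from sum.reindex_bij_betw[OF this, of "\<lambda>\<sigma>. \<sigma> x"] show ?thesis
    by (simp add: abs_trace_def)
qed

text \<open>The trace kills x^p - x and is linear over the prime field, so c times the nonzero trace
  of \<alpha> is 0.\<close>

lemma trace_scale_eq_wp_imp_0:
  fixes \<alpha> c x :: "'a::finite_field"
  assumes "abs_trace \<alpha> \<noteq> 0" "c \<in> prime_subfield" "c * \<alpha> = x ^ CHAR('a) - x"
  shows "c = 0"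
  using assms abs_trace_diff[of "x ^ CHAR('a)" x] abs_trace_scale[of c \<alpha>]
  by (simp add: abs_trace_power_CHAR)

text \<open>The kernel of \<open>x \<mapsto> x ^ p - x\<close> is the prime field, so by counting the multiples of \<open>\<alpha>\<close>
  represent all cosets of its image.\<close>

lemma finite_field_artin_schreier:
  fixes \<alpha> y :: "'a::finite_field"
  assumes \<alpha>: "abs_trace \<alpha> \<noteq> 0"
  obtains c x where "c \<in> prime_subfield" "y = c * \<alpha> + (x ^ CHAR('a) - x)"
proof -
  let ?p = "CHAR('a)"
  let ?wp = "\<lambda>x::'a. x ^ ?p - x"
  let ?F = "prime_subfield :: 'a set"
  interpret ring_morph "\<lambda>x::'a. x ^ ?p" by (rule ring_morph_power_CHAR) auto
  have fibre: "card {x. ?wp x = z} \<le> ?p" if "z \<in> range ?wp" for z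
  proof -
    obtain x0 where "z = ?wp x0" using \<open>z \<in> range ?wp\<close> by blast
    then have "{x. ?wp x = z} \<subseteq> (+) x0 ` ?F"
      using diff by (auto simp: image_iff power_CHAR_eq_iff[symmetric] algebra_simps intro!: bexI[of _ "_ - x0"])
    then have "card {x. ?wp x = z} \<le> card ((+) x0 ` ?F)" by (intro card_mono) auto
    also have "\<dots> \<le> ?p" using card_image_le[of ?F "(+) x0"] by (simp add: card_prime_subfield)
    finally show ?thesis .
  qed
  \<comment> \<open>All fibres of x \<mapsto> x^p - x have at most p elements, so the field is no
    larger than prime field times image. The trace makes (c, z) \<mapsto> c * \<alpha> + z injective
    on that product, hence surjective by counting.\<close>
  have "CARD('a) = card (\<Union>z\<in>range ?wp. {x. ?wp x = z})" by (rule arg_cong[of _ _ card]) auto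
  also have "\<dots> \<le> (\<Sum>z\<in>range ?wp. card {x. ?wp x = z})" by (intro card_UN_le) auto
  also have "\<dots> \<le> (\<Sum>z\<in>range ?wp. ?p)" using fibre by (intro sum_mono) auto
  also have "\<dots> = card (?F \<times> range ?wp)"
    by (simp add: card_cartesian_product card_prime_subfield)
  finally have le: "CARD('a) \<le> card (?F \<times> range ?wp)" .
  let ?s = "\<lambda>(c, z). c * \<alpha> + z"
  have "inj_on ?s (?F \<times> range ?wp)"
  proof (rule inj_onI, clarify)
    fix c x c' x' assume c: "c \<in> ?F" "c' \<in> ?F" and eq: "c * \<alpha> + ?wp x = c' * \<alpha> + ?wp x'"
    have "c - c' \<in> ?F" using c diff[of c c'] by (simp add: power_CHAR_eq_iff[symmetric])
    moreover have "(c - c') * \<alpha> = ?wp (x' - x)" using eq diff[of x' x] by (simp add: algebra_simps)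
    ultimately have "c - c' = 0" using \<alpha> trace_scale_eq_wp_imp_0 by blast
    then show "c = c' \<and> ?wp x = ?wp x'" using eq by simp
  qed
  then have "card (?s ` (?F \<times> range ?wp)) = card (?F \<times> range ?wp)" by (rule card_image)
  then have "?s ` (?F \<times> range ?wp) = UNIV"
    using le card_mono[of UNIV "?s ` (?F \<times> range ?wp)"] by (intro card_subset_eq) auto
  then have "y \<in> ?s ` (?F \<times> range ?wp)" by simp
  then show ?thesis using that by auto
qed

subsection \<open>Decomposition in length one\<close>

text \<open>Condition (i) of the theorem for a single Witt component of all coefficients.\<close>

definition equivariant :: "('a::field alg_closure proj_line \<times> nat \<Rightarrow> 'a alg_closure) \<Rightarrow> bool" where
  "equivariant d \<longleftrightarrow> (\<forall>\<sigma>\<in>field_auts_fixing (range to_ac). \<forall>x j. d (map_proj_line \<sigma> x, j) = \<sigma> (d (x, j)))"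

section \<open>Galois action on partial fractions\<close>

lemma field_aut_zero: "\<sigma> \<in> field_auts_fixing S \<Longrightarrow> \<sigma> 0 = 0"
  by (rule ring_morph.zero[OF field_aut_ring_morph])

lemma map_proj_line_inv:
  assumes "bij \<sigma>"
  shows "map_proj_line \<sigma> (map_proj_line (inv_into UNIV \<sigma>) x) = x" "map_proj_line (inv_into UNIV \<sigma>) (map_proj_line \<sigma> x) = x"
  using assms by (cases x; simp add: bij_is_surj surj_f_inv_f bij_is_inj inv_f_f)+

lemma ratmap_pole_term:
  assumes "ring_morph h"
  shows "ratmap h (pole_term (x, j)) = pole_term (map_proj_line h x, j)"
  using ring_morph.power[OF ring_morph_ratmap[OF assms]] ring_morph_inverse[OF ring_morph_ratmap[OF assms]]
  by (simp add: pole_term_def ratmap_local_param[OF assms])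

lemma pf_support_map:
  assumes \<sigma>: "\<sigma> \<in> field_auts_fixing S" and a': "\<And>x j. a' (map_proj_line \<sigma> x, j) = \<sigma> (a (x, j))"
  shows "{z. a' z \<noteq> 0} = (\<lambda>(x, j). (map_proj_line \<sigma> x, j)) ` {z. a z \<noteq> 0}"
proof -
  have bij: "bij \<sigma>" using \<sigma> by (simp add: field_auts_fixing_def)
  note iff = ring_morph_eq_0_iff[OF field_aut_ring_morph[OF \<sigma>]]
  show ?thesis
  proof (intro Set.set_eqI iffI)
    fix z assume z: "z \<in> {z. a' z \<noteq> 0}"
    obtain x j where xj: "z = (x, j)" by fastforce
    have "a' (map_proj_line \<sigma> (map_proj_line (inv_into UNIV \<sigma>) x), j) \<noteq> 0"
      using z by (simp add: xj map_proj_line_inv[OF bij])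
    then show "z \<in> (\<lambda>(x, j). (map_proj_line \<sigma> x, j)) ` {z. a z \<noteq> 0}"
      unfolding a' iff xj
      by (intro image_eqI[of _ _ "(map_proj_line (inv_into UNIV \<sigma>) x, j)"]) (auto simp: map_proj_line_inv[OF bij])
  qed (auto simp: a' iff)
qed

text \<open>An automorphism moves poles and coefficients simultaneously, because it sends the local
  parameter at x to the one at its image. The family \<open>a'\<close> is \<open>a\<close>
  transported in this way; an equivariant \<open>a\<close> is its own transport.\<close>

lemma pf_sum_map:
  assumes \<sigma>: "\<sigma> \<in> field_auts_fixing S" and a': "\<And>x j. a' (map_proj_line \<sigma> x, j) = \<sigma> (a (x, j))"
  shows "pf_sum a' = ratmap \<sigma> (pf_sum a)"
proof -
  let ?f = "\<lambda>(x, j :: nat). (map_proj_line \<sigma> x, j)"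
  have bij: "bij \<sigma>" using \<sigma> by (simp add: field_auts_fixing_def)
  have m: "ring_morph \<sigma>" by (rule field_aut_ring_morph[OF \<sigma>])
  interpret M: ring_morph "ratmap \<sigma>" by (rule ring_morph_ratmap[OF m])
  have "inj_on ?f A" for A
    using map_proj_line_inv(2)[OF bij] by (auto simp: inj_on_def) metis
  then have "pf_sum a' = (\<Sum>z | a z \<noteq> 0. ratfun_const (a' (?f z)) * pole_term (?f z))"
    unfolding pf_sum_def pf_support_map[where a = a and a' = a', OF \<sigma> a'] by (subst sum.reindex) auto
  also have "\<dots> = (\<Sum>z | a z \<noteq> 0. ratmap \<sigma> (ratfun_const (a z) * pole_term z))"
    by (intro sum.cong) (auto simp: a' ratmap_const[OF m] ratmap_pole_term[OF m])
  finally show ?thesis by (simp add: pf_sum_def M.sum)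
qed

lemma ratmap_ratfun_to_ac:
  fixes f :: "'a::field poly fract"
  assumes "\<sigma> \<in> field_auts_fixing (range (to_ac :: 'a \<Rightarrow> _))"
  shows "ratmap \<sigma> (ratfun_to_ac f) = ratfun_to_ac f"
proof -
  have m: "ring_morph \<sigma>" by (rule field_aut_ring_morph[OF assms])
  obtain a b where f: "f = Fract a b" "b \<noteq> 0" by (metis Fract_cases)
  have "map_poly \<sigma> (map_poly to_ac q) = map_poly to_ac q" for q :: "'a poly"
    using assms ring_morph.zero[OF m] by (intro poly_eqI) (simp add: coeff_map_poly field_auts_fixing_def)
  then show ?thesis
    using f by (simp add: ratfun_to_ac_Fract ratmap_Fract[OF m] map_poly_eq_0_iff)
qed

lemma equivariant_pf_sum_in_range:
  fixes a :: "'a::finite_field alg_closure proj_line \<times> nat \<Rightarrow> _"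
  assumes "equivariant a"
  shows "pf_sum a \<in> range ratfun_to_ac"
  using pf_sum_map[OF power_card_aut, of a a] power_card_aut assms
  by (intro ratmap_fixed_imp_range) (auto simp: equivariant_def)

text \<open>A function over the finite field equals all its transports, so uniqueness of partial
  fractions identifies the transported coefficients with the original ones.\<close>

lemma pf_sum_in_range_equivariant:
  fixes a :: "'a::field alg_closure proj_line \<times> nat \<Rightarrow> 'a alg_closure"
  assumes a: "pf_coeffs a" and r: "pf_sum a = ratfun_to_ac f"
  shows "equivariant a"
  unfolding equivariant_def
proof (intro ballI allI)
  fix \<sigma> x j assume \<sigma>: "\<sigma> \<in> field_auts_fixing (range (to_ac :: 'a \<Rightarrow> _))"
  then have bij: "bij \<sigma>" by (simp add: field_auts_fixing_def)
  define a' where "a' = (\<lambda>(x, j). \<sigma> (a (map_proj_line (inv_into UNIV \<sigma>) x, j)))"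
  have a': "a' (map_proj_line \<sigma> x, j) = \<sigma> (a (x, j))" for x j
    by (simp add: a'_def map_proj_line_inv[OF bij])
  have "pf_coeffs a'"
    using a ring_morph.zero[OF field_aut_ring_morph[OF \<sigma>]] unfolding pf_coeffs_def pf_support_map[where a = a and a' = a', OF \<sigma> a']
    by (auto simp: a'_def)
  then have "a' = a"
    using a pf_sum_map[where a = a and a' = a', OF \<sigma> a'] by (intro partial_fractions_unique) (simp_all add: r ratmap_ratfun_to_ac[OF \<sigma>])
  then show "a (map_proj_line \<sigma> x, j) = \<sigma> (a (x, j))" using a' by simp
qed

lemma equivariant_add: "equivariant a \<Longrightarrow> equivariant b \<Longrightarrow> equivariant (\<lambda>z. a z + b z)"
  by (auto simp: equivariant_def field_auts_fixing_def)

text \<open>Taking \<open>p\<close>-th roots of the coefficients replaces the poles of order \<open>p j\<close> by poles of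
  order \<open>j\<close> at the cost of an element of the form \<open>g ^ p - g\<close>.\<close>

lemma artin_schreier_reduce:
  fixes a :: "'a::finite_field alg_closure proj_line \<times> nat \<Rightarrow> 'a alg_closure"
  assumes p: "CHAR('a) = p" and "pf_coeffs a" "equivariant a" "\<forall>x j. a (x, j) \<noteq> 0 \<longrightarrow> j \<le> N"
  shows "\<exists>d u. pf_coeffs d \<and> equivariant d \<and> pf_coeffs u \<and> equivariant u \<and>
    (\<forall>x j. j \<ge> 1 \<longrightarrow> p dvd j \<longrightarrow> d (x, j) = 0) \<and> pf_sum a = pf_sum d + (pf_sum u ^ p - pf_sum u)"
  using assms(2-)
proof (induction N arbitrary: a rule: less_induct)
  case (less N)
  have pr: "prime p" using p by auto
  have p1: "p > 1" using pr by (rule prime_gt_1_nat)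
  have ch: "CHAR('a alg_closure) = p" using p by simp
  let ?F = "\<lambda>x :: 'a alg_closure. x ^ p"
  have injF: "inj ?F" by (rule ring_morph_inj[OF ring_morph_power_CHAR[OF pr ch]])
  have surjF: "surj ?F" using nth_root_exists[of p] p1 by (metis surjI someI_ex zero_less_one order_less_trans)
  define root where "root = inv_into UNIV ?F"
  have root_p: "root y ^ p = y" for y using surj_f_inv_f[OF surjF, of y] by (simp add: root_def)
  have root0: "root 0 = 0" using root_p[of 0] p1 by simp
  show ?case
  proof (cases "N = 0")
    case True
    have "a (x, j) = 0" if "j \<ge> 1" for x j using less.prems(3) True that by fastforce
    moreover have "pf_sum (\<lambda>_ :: 'a alg_closure proj_line \<times> nat. 0 :: 'a alg_closure) = 0"
      "pf_coeffs (\<lambda>_ :: 'a alg_closure proj_line \<times> nat. 0 :: 'a alg_closure)"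
      "equivariant (\<lambda>_ :: 'a alg_closure proj_line \<times> nat. 0 :: 'a alg_closure)"
      using field_aut_ring_morph ring_morph.zero
      by (auto simp: pf_sum_def pf_coeffs_def equivariant_def)
    ultimately show ?thesis
      using less.prems p1
      by (intro exI[of _ a] exI[of _ "\<lambda>_. 0"]) (simp add: power_0_left)
  next
    case False
    \<comment> \<open>Then a = b + g^p = b + g + (g^p - g), and g is reduced recursively. The
      constant coefficient stays in b: order 0 is divisible by p but cannot be lowered.\<close>
    define g where "g = (\<lambda>(x, j). if j \<ge> 1 then root (a (x, p * j)) else 0)"
    define b where "b = (\<lambda>(x, j). if j \<ge> 1 \<and> p dvd j then 0 else a (x, j))"
    have fin: "finite {z. a z \<noteq> 0}" using less.prems(1) by (simp add: pf_coeffs_def)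
    have "{z. b z \<noteq> 0} \<subseteq> {z. a z \<noteq> 0}" by (auto simp: b_def split: if_splits)
    then have b: "pf_coeffs b"
      using less.prems(1) finite_subset[OF _ fin] by (auto simp: pf_coeffs_def b_def)
    have "finite ((\<lambda>(x, j). (x, p * j)) -` {z. a z \<noteq> 0})"
      using p1 by (intro finite_vimageI[OF fin]) (auto simp: inj_on_def)
    then have g: "pf_coeffs g"
      unfolding pf_coeffs_def
      by (auto simp: g_def elim!: rev_finite_subset) (metis root0)
    have eb: "equivariant b"
      using less.prems(2) unfolding equivariant_def by (auto simp: b_def field_aut_zero)
    have eg: "equivariant g"
      unfolding equivariant_def
    proof (intro ballI allI)
      fix \<sigma> x j assume \<sigma>: "\<sigma> \<in> field_auts_fixing (range (to_ac :: 'a \<Rightarrow> _))"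
      interpret ring_morph \<sigma> by (rule field_aut_ring_morph[OF \<sigma>])
      \<comment> \<open>In characteristic p the p-th root is unique, so it commutes with every field
        automorphism and g inherits equivariance.\<close>
      have "root (\<sigma> y) = \<sigma> (root y)" for y
        using power[of "root y" p] root_p by (metis injF injD)
      then show "g (map_proj_line \<sigma> x, j) = \<sigma> (g (x, j))"
        using less.prems(2) \<sigma> by (simp add: g_def equivariant_def)
    qed
    have ab: "a = (\<lambda>z. b z + pf_frob p g z)"
    proof
      fix z :: "'a alg_closure proj_line \<times> nat"
      obtain x j where xj: "z = (x, j)" by fastforce
      show "a z = b z + pf_frob p g z"
        using p1 root0 root_p
        by (cases "j = 0") (auto simp: xj b_def pf_frob_def g_def power_0_left dvd_imp_le Suc_le_eq div_greater_zero_iff)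
    qed
    have bound: "\<forall>x j. g (x, j) \<noteq> 0 \<longrightarrow> j \<le> N div p"
    proof (intro allI impI)
      fix x j assume gj: "g (x, j) \<noteq> 0"
      have "a (x, p * j) \<noteq> 0" using gj root0 by (auto simp: g_def split: if_splits)
      then have "p * j \<le> N" using less.prems(3) by blast
      then show "j \<le> N div p" using p1 by (simp add: less_eq_div_iff_mult_less_eq mult.commute)
    qed
    have less: "N div p < N" using False p1 by simp
    obtain d u where
      d: "pf_coeffs d" "equivariant d" "\<And>x j. j \<ge> 1 \<Longrightarrow> p dvd j \<Longrightarrow> d (x, j) = 0" and
      u: "pf_coeffs u" "equivariant u" and gdu: "pf_sum g = pf_sum d + (pf_sum u ^ p - pf_sum u)"
      using less.IH[OF less g eg bound] by blast
    have "pf_sum a = pf_sum b + pf_sum g ^ p"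
      using p1 by (subst ab) (simp add: pf_sum_add b g pf_coeffs_frob pf_sum_frob[OF pr ch])
    also have "\<dots> = pf_sum b + pf_sum d + ((pf_sum u ^ p + pf_sum g ^ p) - (pf_sum u + pf_sum g))"
      using gdu by simp
    also have "pf_sum u ^ p + pf_sum g ^ p = (pf_sum u + pf_sum g) ^ p"
      using pr ch by (intro freshmans_dream[symmetric]) auto
    finally have "pf_sum a = pf_sum (\<lambda>z. b z + d z) +
        (pf_sum (\<lambda>z. u z + g z) ^ p - pf_sum (\<lambda>z. u z + g z))"
      by (simp add: pf_sum_add b g d u)
    moreover have "\<forall>x j. j \<ge> 1 \<longrightarrow> p dvd j \<longrightarrow> b (x, j) + d (x, j) = 0"
      using d(3) by (simp add: b_def)
    ultimately show ?thesis
      using pf_coeffs_add[OF b d(1)] pf_coeffs_add[OF u(1) g] equivariant_add[OF eb d(2)]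
        equivariant_add[OF u(2) eg]
      by (intro exI[of _ "\<lambda>z. b z + d z"] exI[of _ "\<lambda>z. u z + g z"]) simp
  qed
qed

text \<open>The reduction leaves pole orders prime to p and a constant. The constant lies in the
  finite field and splits there into c * \<alpha> plus x^p - x; the two Artin-Schreier terms are
  merged into u.\<close>

theorem length_one_decomposition:
  fixes f :: "'a::finite_field poly fract"
  assumes p: "CHAR('a) = p" and \<alpha>: "abs_trace \<alpha> \<noteq> 0"
  obtains c D u where "c \<in> prime_subfield" "pf_coeffs D" "equivariant D"
    "\<And>x j. D (x, j) \<noteq> 0 \<Longrightarrow> j \<ge> 1 \<and> coprime j p"
    "ratfun_to_ac f = ratfun_const (to_ac (c * \<alpha>)) + pf_sum D + ratfun_to_ac (u ^ p - u)"
proof -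
  have pr: "prime p" using p by auto
  interpret R: ring_morph "ratfun_to_ac :: 'a poly fract \<Rightarrow> _"
    unfolding ratfun_to_ac_eq_ratmap by (rule ring_morph_ratmap[OF ring_morph_to_ac])
  obtain a where a: "pf_coeffs a" "ratfun_to_ac f = pf_sum a" by (rule partial_fractions_exist)
  have ea: "equivariant a" by (rule pf_sum_in_range_equivariant[OF a(1) a(2)[symmetric]])
  have "finite (snd ` {z. a z \<noteq> 0})" using a(1) by (simp add: pf_coeffs_def)
  then obtain N where "\<forall>j\<in>snd ` {z. a z \<noteq> 0}. j \<le> N" by (meson finite_nat_set_iff_bounded_le)
  then have bound: "\<forall>x j. a (x, j) \<noteq> 0 \<longrightarrow> j \<le> N" by force
  obtain d u where
    d: "pf_coeffs d" "equivariant d" "\<And>x j. j \<ge> 1 \<Longrightarrow> p dvd j \<Longrightarrow> d (x, j) = 0" and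
    u: "equivariant u" and adu: "pf_sum a = pf_sum d + (pf_sum u ^ p - pf_sum u)"
    using artin_schreier_reduce[OF p a(1) ea bound] by blast
  obtain v where v: "pf_sum u = ratfun_to_ac v" using equivariant_pf_sum_in_range[OF u] by blast
  \<comment> \<open>Infinity is fixed by every automorphism, so equivariance makes the constant
    coefficient a fixed point of the q-Frobenius.\<close>
  have "d (Infinity, 0) ^ CARD('a) = d (Infinity, 0)"
    using d(2) power_card_aut[where 'a = 'a] unfolding equivariant_def by (metis proj_line.simps(9))
  then obtain e where e: "d (Infinity, 0) = to_ac e" unfolding power_card_eq_iff by blast
  obtain c x where c: "c \<in> prime_subfield" and ecx: "e = c * \<alpha> + (x ^ p - x)"
    using finite_field_artin_schreier[OF \<alpha>, of e] p by blast
  define D where "D = (\<lambda>z. if z = (Infinity, 0) then 0 else d z)"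
  define \<delta> where "\<delta> = (\<lambda>z :: 'a alg_closure proj_line \<times> nat. if z = (Infinity, 0) then to_ac e else 0)"
  have D: "pf_coeffs D"
    using d(1) unfolding pf_coeffs_def D_def by (auto elim!: rev_finite_subset)
  have \<delta>: "pf_coeffs \<delta>" "pf_sum \<delta> = ratfun_const (to_ac e)"
    by (auto simp: pf_coeffs_def \<delta>_def) (subst pf_sum_superset[of "{(Infinity, 0)}"], auto simp: pole_term_def)
  have "equivariant D"
    unfolding equivariant_def
  proof (intro ballI allI)
    fix \<sigma> x j assume \<sigma>: "\<sigma> \<in> field_auts_fixing (range (to_ac :: 'a \<Rightarrow> _))"
    have "map_proj_line \<sigma> x = Infinity \<longleftrightarrow> x = Infinity" by (cases x) auto
    then show "D (map_proj_line \<sigma> x, j) = \<sigma> (D (x, j))"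
      using d(2) \<sigma> by (auto simp: D_def equivariant_def field_aut_zero)
  qed
  moreover have "j \<ge> 1 \<and> coprime j p" if nz: "D (x, j) \<noteq> 0" for x j
  proof -
    have "j \<ge> 1" using nz D unfolding pf_coeffs_def
      by (cases x; cases j) (auto simp: D_def)
    moreover from this have "\<not> p dvd j" using nz d(3)[of j x] by (auto simp: D_def split: if_splits)
    ultimately show ?thesis using pr by (metis coprime_commute prime_imp_coprime)
  qed
  moreover have "ratfun_to_ac f = ratfun_const (to_ac (c * \<alpha>)) + pf_sum D +
      ratfun_to_ac ((v + ratfun_const x) ^ p - (v + ratfun_const x))"
  proof -
    have "d = (\<lambda>z. D z + \<delta> z)" by (auto simp: D_def \<delta>_def e)
    then have "pf_sum d = pf_sum D + ratfun_const (to_ac e)"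
      using pf_sum_add[OF D \<delta>(1)] \<delta>(2) by simp
    moreover have "ratfun_to_ac ((v + ratfun_const x) ^ p - (v + ratfun_const x)) =
        (pf_sum u ^ p - pf_sum u) + ratfun_const (to_ac (x ^ p - x))"
    proof -
      have "(v + ratfun_const x) ^ p = v ^ p + ratfun_const (x ^ p)"
        unfolding const.power by (rule freshmans_dream) (use pr p in auto)
      moreover have "ratfun_to_ac (ratfun_const y) = ratfun_const (to_ac y)" for y :: 'a
        by (simp add: ratfun_to_ac_eq_ratmap ratmap_const[OF ring_morph_to_ac])
      ultimately show ?thesis unfolding v by (simp del: const.power)
    qed
    moreover have "ratfun_const (to_ac e) = ratfun_const (to_ac (c * \<alpha>)) + ratfun_const (to_ac (x ^ p - x))"
      unfolding ecx by (simp del: to_ac_diff)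
    ultimately show ?thesis using a(2) adu by simp
  qed
  ultimately show ?thesis using that c D by blast
qed

section \<open>Witt vectors over rational function fields\<close>

text \<open>The summand C [\<pi>_x]^(-i) of the normal form for z = (x, i), without any integer
  power in the Witt ring.\<close>

definition pole_vec :: "nat \<Rightarrow> 'a::field proj_line \<times> nat \<Rightarrow> (nat \<Rightarrow> 'a) \<Rightarrow> nat \<Rightarrow> 'a poly fract" where
  "pole_vec p z C = teich_scale p (pole_term z) (ratfun_const \<circ> C)"

lemma pole_vec_apply: "pole_vec p z C n = ratfun_const (C n) * pole_term z ^ (p ^ n)"
  by (simp add: pole_vec_def teich_scale_def)

subsection \<open>Uniqueness\<close>

context witt_prime
begin

lemma witt_hom_pole_vec: "witt_hom p (pole_vec p z)"
  using witt_hom_add[OF witt_hom_comp[OF ring_morph_ratfun_const]] witt_hom_add[OF witt_hom_teich_scale]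
  unfolding witt_hom_def pole_vec_def by metis

lemma pole_vec_eq:
  assumes "i \<ge> 1"
  shows "(ratfun_const \<circ> C) \<otimes>\<^bsub>witt_ring p\<^esub> (teichmueller (local_param x) [^]\<^bsub>witt_ring p\<^esub> (- int i)) =
    pole_vec p (x, i) C"
  unfolding mult_teichmueller_int_power[OF local_param_nonzero assms] by (simp add: pole_vec_def pole_term_def)

lemma pole_vec_verschiebung_frobenius:
  "pole_vec p z (verschiebung (witt_frobenius p C)) = verschiebung (witt_frobenius p (pole_vec p z C))"
  unfolding pole_vec_def teich_scale_verschiebung[symmetric]
    comp_verschiebung[of ratfun_const, OF const.zero] witt_frobenius_comp_morph[OF ring_morph_ratfun_const] ..

text \<open>Component 0 is an Artin-Schreier equation, which forces all \<open>D z 0\<close> to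
  vanish and \<open>w 0\<close> to be a constant y. After subtracting \<wp>[y] everything is
  divisible by V, and the quotient equation has the same shape in length n - 1. The constant vector
  \<open>c\<close> is arbitrary because this step changes it.\<close>

lemma pole_vec_sum_eq_wp_imp_0:
  fixes D :: "'b::alg_closed_field proj_line \<times> nat \<Rightarrow> nat \<Rightarrow> 'b"
  assumes ch: "CHAR('b) = p" and S: "finite S" "\<And>x j. (x, j) \<in> S \<Longrightarrow> j \<ge> 1 \<and> coprime j p"
    and eq: "\<And>k. k < n \<Longrightarrow> ((ratfun_const \<circ> c) \<boxplus> wsum (\<lambda>z. pole_vec p z (D z)) S) k = witt_wp p w k"
    and z: "z \<in> S" and k: "k < n"
  shows "D z k = 0"
  using eq z k
proof (induction n arbitrary: c D w k z)
  case (Suc n)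
  have chF: "CHAR('b poly fract) = p" using ch by simp
  let ?P = "\<lambda>D. wsum (\<lambda>z. pole_vec p z (D z)) S"
  \<comment> \<open>Collects the components 0 as one family of partial fraction coefficients. The
    slot (Infinity, 0) is free for \<open>c 0\<close> since all orders in S are positive.\<close>
  define d where "d = (\<lambda>z. if z \<in> S then D z 0 else if z = (Infinity, 0) then c 0 else 0)"
  have inf: "(Infinity, 0) \<notin> S" using S(2) by fastforce
  have d: "pf_coeffs d"
    unfolding pf_coeffs_def
  proof
    have "{z. d z \<noteq> 0} \<subseteq> insert (Infinity, 0) S" by (auto simp: d_def)
    then show "finite {z. d z \<noteq> 0}" by (rule finite_subset) (simp add: S(1))
    show "\<forall>t. d (Affine t, 0) = 0" using S(2) by (fastforce simp: d_def)
  qed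
  have "pf_sum d = ratfun_const (c 0) + (\<Sum>z\<in>S. ratfun_const (D z 0) * pole_term z)"
    using S(1) inf by (subst pf_sum_superset[of "insert (Infinity, 0) S"])
      (auto simp: d_def pole_term_def intro!: sum.cong)
  also have "\<dots> = ((ratfun_const \<circ> c) \<boxplus> ?P D) 0"
    using S(1) by (simp add: witt_add_apply_0[OF p] wsum_apply_0 pole_vec_apply)
  also have "\<dots> = w 0 ^ p - w 0"
    using Suc.prems(1)[OF zero_less_Suc] by (simp only: wp_apply_0)
  finally have dw: "pf_sum d = w 0 ^ p - w 0" .
  have reduced: "d (x, j) = 0" if "j \<ge> 1" "p dvd j" for x j
  proof -
    have "\<not> coprime j p" using that(2) p by (metis coprime_absorb_right prime_gt_1_nat not_prime_unit)
    then show ?thesis using S(2)[of x j] that(1) by (auto simp: d_def)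
  qed
  obtain y where y: "w 0 = ratfun_const y"
    using artin_schreier_unique(1)[OF p ch d reduced dw] by blast
  have d0: "d (x, j) = 0" if "j \<ge> 1" for x j
    using artin_schreier_unique(2)[OF p ch d reduced dw that] .
  have D0: "D z 0 = 0" if "z \<in> S" for z
    using d0[of "snd z" "fst z"] S(2)[of "fst z" "snd z"] that by (simp add: d_def)
  have "ratfun_const (c 0) = ratfun_const (y ^ p - y)"
    using dw d0 inf by (subst (asm) pf_sum_superset[of "{(Infinity, 0)}"])
      (auto simp: d_def pole_term_def y D0 split: if_splits)
  then have c0: "c 0 = y ^ p - y" unfolding ratfun_const_eq_iff .
  \<comment> \<open>With p-th roots of the shifted components, D z = VF (E z), so the division by V
    can be carried out inside each pole term.\<close>
  define E where "E = (\<lambda>z k. SOME e. e ^ p = D z (Suc k))"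
  have E: "E z k ^ p = D z (Suc k)" for z k
    unfolding E_def by (rule someI_ex) (rule nth_root_exists[OF p_gt_0])
  have DE: "D z = verschiebung (witt_frobenius p (E z))" if "z \<in> S" for z
  proof -
    have "(\<lambda>k. D z (Suc k)) = witt_frobenius p (E z)"
      by (auto simp: fun_eq_iff witt_frobenius_def E)
    then show ?thesis using eq_verschiebung[where a = "D z", OF D0[OF that]] by argo
  qed
  define t where "t = teichmueller y"
  have t: "ratfun_const \<circ> t = teichmueller (ratfun_const y)"
    by (simp add: t_def comp_teichmueller)
  define c' where "c' = (\<lambda>k. (c \<boxminus> witt_wp p t) (Suc k))"
  have c': "c \<boxminus> witt_wp p t = verschiebung c'"
    unfolding c'_def by (rule eq_verschiebung) (simp add: wminus_apply_0 wp_apply_0 t_def teichmueller_def c0)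
  define w' where "w' = (\<lambda>k. (w \<boxminus> (ratfun_const \<circ> t)) (Suc k))"
  have w': "w \<boxminus> (ratfun_const \<circ> t) = verschiebung w'"
    unfolding w'_def by (rule eq_verschiebung) (simp add: wminus_apply_0 t_def teichmueller_def y)
  define Y where "Y = ?P E"
  have PD: "?P D = verschiebung (witt_frobenius p Y)"
  proof -
    have "?P D = wsum (\<lambda>z. verschiebung (witt_frobenius p (pole_vec p z (E z)))) S"
      by (rule wsum_cong) (simp add: DE pole_vec_verschiebung_frobenius)
    then show ?thesis unfolding Y_def
      by (simp add: witt_hom_sum[OF S(1) witt_hom_verschiebung] witt_hom_sum[OF S(1) witt_hom_frobenius[OF chF]])
  qed
  define A where "A = (ratfun_const \<circ> c') \<boxplus> witt_frobenius p Y"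
  have VA: "verschiebung A = ((ratfun_const \<circ> c) \<boxplus> ?P D) \<boxminus> witt_wp p (ratfun_const \<circ> t)"
  proof -
    have "verschiebung (ratfun_const \<circ> c') = (ratfun_const \<circ> c) \<boxminus> witt_wp p (ratfun_const \<circ> t)"
      by (simp add: comp_verschiebung[symmetric] c'[symmetric] witt_hom_minus[OF witt_hom_comp[OF ring_morph_ratfun_const]]
          wp_comp[OF ring_morph_ratfun_const])
    then show ?thesis
      unfolding A_def verschiebung_add[OF p] PD
      using wminus_wadd_wadd[of "ratfun_const \<circ> c" "verschiebung (witt_frobenius p Y)" "witt_wp p (ratfun_const \<circ> t)" "\<lambda>_. 0"]
      by simp
  qed
  have Vw: "verschiebung (witt_wp p w') = witt_wp p w \<boxminus> witt_wp p (ratfun_const \<circ> t)"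
    by (simp add: wp_verschiebung[symmetric] w'[symmetric] witt_hom_minus[OF witt_hom_wp[OF chF]])
  have "verschiebung A k = verschiebung (witt_wp p w') k" if "k < Suc n" for k
    unfolding VA Vw by (rule wminus_cong[where n = "Suc n", OF Suc.prems(1) refl that])
  from this[of "Suc _"] have A: "A k = witt_wp p w' k" if "k < n" for k
    using that by (simp add: verschiebung_def)
  \<comment> \<open>After division by V the poles appear as FY = Y + \<wp>Y. Moving \<wp>Y to the
    other side, with w' - Y in place of w', restores the form required by the induction
    hypothesis.\<close>
  have "A = (ratfun_const \<circ> c') \<boxplus> Y \<boxplus> witt_wp p Y"
    by (simp only: A_def frobenius_eq_add_wp wadd_ac)
  then have AY: "(ratfun_const \<circ> c') \<boxplus> Y = A \<boxminus> witt_wp p Y"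
    by (simp only: wadd_minus_cancel)
  have YE: "((ratfun_const \<circ> c') \<boxplus> Y) k = witt_wp p (w' \<boxminus> Y) k" if "k < n" for k
    unfolding AY witt_hom_minus[OF witt_hom_wp[OF chF]]
    by (rule wminus_cong[where n = n, OF A refl that])
  have E0: "E z k = 0" if "k < n" "z \<in> S" for z k
    by (rule Suc.IH[OF YE[unfolded Y_def] that(2,1)])
  show ?case
  proof (cases k)
    case 0
    then show ?thesis using D0 Suc.prems by simp
  next
    case (Suc m)
    then have "D z k = E z m ^ p" by (simp add: E)
    then show ?thesis using E0[of m z] Suc Suc.prems p_gt_0 by simp
  qed
qed simp

section \<open>Constants over the finite field\<close>

lemma frobenius_prime_subfield:
  fixes c :: "nat \<Rightarrow> 'a::finite_field"
  assumes "CHAR('a) = p" "\<And>n. c n \<in> prime_subfield"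
  shows "witt_frobenius p c = c"
  using assms power_CHAR_eq_iff[where 'a = 'a] by (auto simp: fun_eq_iff witt_frobenius_def)

text \<open>Over the closure \<open>w 0\<close> must be constant, and invariance under the
  q-Frobenius puts that constant y into the finite field. There the trace gives
  \<open>c 0 = 0\<close>, whence y^p = y.\<close>

lemma const_eq_wp_apply_0:
  fixes \<alpha> :: "'a::finite_field" and w :: "nat \<Rightarrow> 'a poly fract"
  assumes ch: "CHAR('a) = p" and \<alpha>: "abs_trace \<alpha> \<noteq> 0" and c: "\<And>n. c n \<in> prime_subfield"
    and eq: "ratfun_const \<circ> teich_scale p \<alpha> c = witt_wp p w"
  obtains y where "c 0 = 0" "w 0 = ratfun_const y" "y ^ p = y"
proof -
  note R = ring_morph_ratmap[OF ring_morph_to_ac]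
  have chac: "CHAR('a alg_closure) = p" using ch by simp
  have eq0: "ratfun_const (c 0 * \<alpha>) = w 0 ^ p - w 0"
    using fun_cong[OF eq, of 0] by (simp add: wp_apply_0 teich_scale_def)
  let ?u = "ratmap to_ac (w 0)"
  define d where "d = (\<lambda>z :: 'a alg_closure proj_line \<times> nat. if z = (Infinity, 0) then to_ac (c 0 * \<alpha>) else 0)"
  have d: "pf_coeffs d" by (auto simp: pf_coeffs_def d_def)
  have "pf_sum d = ratfun_const (to_ac (c 0 * \<alpha>))"
    by (subst pf_sum_superset[of "{(Infinity, 0)}"]) (auto simp: d_def pole_term_def)
  also have "\<dots> = ratmap to_ac (w 0 ^ p - w 0)"
    unfolding ratmap_const[OF ring_morph_to_ac, symmetric] eq0 ..
  also have "\<dots> = ?u ^ p - ?u"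
    by (simp add: ring_morph.diff[OF R] ring_morph.power[OF R])
  finally have dw: "pf_sum d = ?u ^ p - ?u" .
  have "d (x, j) = 0" if "j \<ge> 1" for x j using that by (simp add: d_def)
  then obtain z where z: "?u = ratfun_const z"
    using artin_schreier_unique(1)[OF p chac d _ dw] by blast
  have "ratmap (\<lambda>x. x ^ CARD('a)) ?u = ?u"
    using ratmap_ratfun_to_ac[OF power_card_aut, of "w 0"] by (simp add: ratfun_to_ac_eq_ratmap)
  then have "z ^ CARD('a) = z"
    unfolding z ratmap_const[OF field_aut_ring_morph[OF power_card_aut]] ratfun_const_eq_iff .
  then obtain y where "z = to_ac y" unfolding power_card_eq_iff by blast
  then have "?u = ratmap to_ac (ratfun_const y)" by (simp add: z ratmap_const[OF ring_morph_to_ac])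
  then have y: "w 0 = ratfun_const y" by (rule injD[OF ring_morph_inj[OF R]])
  then have cy: "c 0 * \<alpha> = y ^ p - y"
    using eq0 by (metis const.power const.diff ratfun_const_eq_iff)
  then have "c 0 = 0"
    using trace_scale_eq_wp_imp_0[OF \<alpha> c[of 0], of y] ch by blast
  then show ?thesis using that y cy by simp
qed

text \<open>Because y^p = y, the lift [y] is in the kernel of \<wp> and may be subtracted from w
  freely. As c has components in the prime field, c = V c' = VF c', and division by V followed by F
  = id + \<wp> returns the same equation for c'.\<close>

lemma const_eq_wp_imp_0:
  fixes \<alpha> :: "'a::finite_field"
  assumes ch: "CHAR('a) = p" and \<alpha>: "abs_trace \<alpha> \<noteq> 0" and "\<And>n. c n \<in> prime_subfield"
    and "ratfun_const \<circ> teich_scale p \<alpha> c = witt_wp p w"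
  shows "c n = 0"
  using assms(3-)
proof (induction n arbitrary: c w)
  case 0
  then show ?case using const_eq_wp_apply_0[OF ch \<alpha>] by blast
next
  case (Suc n)
  have chF: "CHAR('a poly fract) = p" using ch by simp
  obtain y where y: "c 0 = 0" "w 0 = ratfun_const y" "y ^ p = y"
    using const_eq_wp_apply_0[OF ch \<alpha> Suc.prems] by blast
  define t where "t = teichmueller (ratfun_const y)"
  have "witt_frobenius p t = t"
    unfolding t_def frobenius_teichmueller const.power[symmetric] y(3) ..
  then have wp_t: "witt_wp p t = (\<lambda>_. 0)" by (simp add: witt_wp_def)
  define w' where "w' = (\<lambda>k. (w \<boxminus> t) (Suc k))"
  have w': "w \<boxminus> t = verschiebung w'"
    unfolding w'_def by (rule eq_verschiebung) (simp add: wminus_apply_0 t_def teichmueller_def y)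
  define c' where "c' = (\<lambda>k. c (Suc k))"
  have c': "c' k \<in> prime_subfield" for k using Suc.prems(1) by (simp add: c'_def)
  have "c = verschiebung c'" unfolding c'_def by (rule eq_verschiebung) (rule y)
  then have c: "c = verschiebung (witt_frobenius p c')"
    using frobenius_prime_subfield[OF ch c'] by simp
  define B where "B = ratfun_const \<circ> teich_scale p \<alpha> c'"
  have "verschiebung (witt_frobenius p B) = witt_wp p w"
    unfolding Suc.prems(2)[symmetric] c teich_scale_verschiebung B_def
      witt_frobenius_comp_morph[OF ring_morph_ratfun_const, symmetric]
    by (simp add: comp_verschiebung)
  also have "\<dots> = witt_wp p (w \<boxminus> t)"
    by (simp add: witt_hom_minus[OF witt_hom_wp[OF chF]] wp_t)
  also have "\<dots> = verschiebung (witt_wp p w')" by (simp add: w' wp_verschiebung)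
  finally have "witt_frobenius p B = witt_wp p w'" by simp
  then have "B = witt_wp p (w' \<boxminus> B)"
    unfolding witt_hom_minus[OF witt_hom_wp[OF chF]] frobenius_eq_add_wp
    by (metis wadd_minus_cancel)
  then have "c' n = 0"
    unfolding B_def by (intro Suc.IH[OF c'])
  then show ?case by (simp add: c'_def)
qed

end

section \<open>Sums over all poles as limits of finite sums\<close>

definition prime_to :: "nat \<Rightarrow> ('a proj_line \<times> nat) set" where
  "prime_to p = {(x, i). i \<ge> 1 \<and> coprime i p}"

text \<open>\<open>has_witt_sum\<close> for the pole terms with its filter and topology unfolded:
  each initial segment of s is computed exactly by every sufficiently large finite partial
  sum.\<close>

definition has_pole_sum ::
    "nat \<Rightarrow> ('a::field proj_line \<times> nat \<Rightarrow> nat \<Rightarrow> 'a) \<Rightarrow> (nat \<Rightarrow> 'a poly fract) \<Rightarrow> bool" where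
  "has_pole_sum p C s \<longleftrightarrow> (\<forall>j. \<exists>U. finite U \<and> U \<subseteq> prime_to p \<and>
     (\<forall>Y. finite Y \<and> U \<subseteq> Y \<and> Y \<subseteq> prime_to p \<longrightarrow>
       (\<forall>k<j. s k = finsum (witt_ring p) (\<lambda>z. pole_vec p z (C z)) Y k)))"

context witt_prime
begin

lemma has_witt_sum_iff:
  fixes C :: "'b::field proj_line \<Rightarrow> nat \<Rightarrow> nat \<Rightarrow> 'b"
  shows "has_witt_sum p
        (\<lambda>(x, i). (ratfun_const \<circ> C x i) \<otimes>\<^bsub>witt_ring p\<^esub>
           (teichmueller (local_param x) [^]\<^bsub>witt_ring p\<^esub> (- int i)))
        {(x, i). i \<ge> 1 \<and> coprime i p} s \<longleftrightarrow>
    has_pole_sum p (\<lambda>z. C (fst z) (snd z)) s"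
proof -
  let ?f = "\<lambda>(x, i). (ratfun_const \<circ> C x i) \<otimes>\<^bsub>witt_ring p\<^esub>
    (teichmueller (local_param x) [^]\<^bsub>witt_ring p\<^esub> (- int i))"
  have eq: "wsum ?f Y = wsum (\<lambda>z. pole_vec p z (C (fst z) (snd z))) Y" if "Y \<subseteq> prime_to p" for Y
    using that by (intro wsum_cong) (auto simp: pole_vec_eq prime_to_def simp del: witt_ring_simps)
  show ?thesis
    unfolding has_witt_sum_def eventually_finite_subsets_at_top wminus_in_range_verschiebung_pow
      prime_to_def[symmetric] has_pole_sum_def
    by (intro all_cong1 ex_cong1 conj_cong refl imp_cong) (simp add: eq del: witt_ring_simps)
qed

lemma mult_const_teichmueller:
  "(ratfun_const \<circ> to_ac \<circ> c) \<otimes>\<^bsub>witt_ring p\<^esub> (ratfun_const \<circ> to_ac \<circ> teichmueller \<alpha>) =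
    ratfun_const \<circ> (to_ac \<circ> teich_scale p \<alpha> c)"
proof -
  have m: "ring_morph (ratfun_const \<circ> to_ac)"
    by (rule ring_morph_comp[OF ring_morph_to_ac ring_morph_ratfun_const])
  have "ratfun_const \<circ> to_ac \<circ> teichmueller \<alpha> = teichmueller ((ratfun_const \<circ> to_ac) \<alpha>)"
    by (rule comp_teichmueller) (simp add: ring_morph.zero[OF m])
  then have "(ratfun_const \<circ> to_ac \<circ> c) \<otimes>\<^bsub>witt_ring p\<^esub> (ratfun_const \<circ> to_ac \<circ> teichmueller \<alpha>) =
      teich_scale p ((ratfun_const \<circ> to_ac) \<alpha>) (ratfun_const \<circ> to_ac \<circ> c)"
    by (simp only: witt_ring_simps witt_mult_teichmueller[OF p])
  also have "\<dots> = ratfun_const \<circ> to_ac \<circ> teich_scale p \<alpha> c"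
    by (rule comp_teich_scale[OF m, symmetric])
  finally show ?thesis by (simp only: comp_assoc)
qed

lemma wsum_minus: "finite S \<Longrightarrow> wsum (\<lambda>z. f z \<boxminus> g z) S = wsum f S \<boxminus> wsum g S"
  for f :: "'i \<Rightarrow> nat \<Rightarrow> 'b::comm_ring_1"
  using wsum_add[of S "\<lambda>z. f z \<boxminus> g z" g] by simp

text \<open>The pole coefficients are compared first, over the closure with the constants as an
  arbitrary vector. The infinite sums then cancel, and what remains is an equation between constants
  over the finite field.\<close>

theorem normal_form_unique:
  fixes b b' w :: "nat \<Rightarrow> 'a::finite_field poly fract"
  assumes ch: "CHAR('a) = p" and \<alpha>: "abs_trace (\<alpha> :: 'a) \<noteq> 0"
    and bb': "b' \<boxminus> b = witt_wp p w"
    and c: "\<And>n. c n \<in> prime_subfield" and c': "\<And>n. c' n \<in> prime_subfield"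
    and sum: "has_pole_sum p C s" and sum': "has_pole_sum p C' s'"
    and b: "ratfun_to_ac \<circ> b = (ratfun_const \<circ> (to_ac \<circ> teich_scale p \<alpha> c)) \<boxplus> s"
    and b': "ratfun_to_ac \<circ> b' = (ratfun_const \<circ> (to_ac \<circ> teich_scale p \<alpha> c')) \<boxplus> s'"
  shows "b' = b"
proof -
  have R: "ring_morph (ratfun_to_ac :: 'a poly fract \<Rightarrow> _)"
    unfolding ratfun_to_ac_eq_ratmap by (rule ring_morph_ratmap[OF ring_morph_to_ac])
  have chac: "CHAR('a alg_closure) = p" using ch by simp
  note hom_const = witt_hom_comp[OF ring_morph_ratfun_const]
  let ?T = "\<lambda>c. to_ac \<circ> teich_scale p \<alpha> c"
  have q: "?T c' \<boxminus> ?T c = ?T (c' \<boxminus> c)"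
    by (simp add: witt_hom_minus[OF witt_hom_comp[OF ring_morph_to_ac]] witt_hom_minus[OF witt_hom_teich_scale])
  have diff: "(ratfun_const \<circ> ?T (c' \<boxminus> c)) \<boxplus> (s' \<boxminus> s) = witt_wp p (ratfun_to_ac \<circ> w)"
  proof -
    have "witt_wp p (ratfun_to_ac \<circ> w) = (ratfun_to_ac \<circ> b') \<boxminus> (ratfun_to_ac \<circ> b)"
      unfolding wp_comp[OF R, symmetric] bb'[symmetric] by (rule witt_hom_minus[OF witt_hom_comp[OF R]])
    then show ?thesis
      unfolding b b' wminus_wadd_wadd q[symmetric] witt_hom_minus[OF hom_const] by simp
  qed
  \<comment> \<open>One finite index set that serves both sums up to n components and contains the
    index under consideration.\<close>
  have approx: "\<exists>Y. Y \<subseteq> prime_to p \<and> finite Y \<and> Z \<subseteq> Y \<and> (\<forall>k<n. s k = wsum (\<lambda>z. pole_vec p z (C z)) Y k) \<and>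
      (\<forall>k<n. s' k = wsum (\<lambda>z. pole_vec p z (C' z)) Y k)" if "finite Z" "Z \<subseteq> prime_to p" for Z n
  proof -
    obtain U where U: "U \<subseteq> prime_to p" "finite U"
      "\<And>Y. Y \<subseteq> prime_to p \<Longrightarrow> finite Y \<Longrightarrow> U \<subseteq> Y \<Longrightarrow> \<forall>k<n. s k = wsum (\<lambda>z. pole_vec p z (C z)) Y k"
      using sum unfolding has_pole_sum_def by meson
    obtain U' where U': "U' \<subseteq> prime_to p" "finite U'"
      "\<And>Y. Y \<subseteq> prime_to p \<Longrightarrow> finite Y \<Longrightarrow> U' \<subseteq> Y \<Longrightarrow> \<forall>k<n. s' k = wsum (\<lambda>z. pole_vec p z (C' z)) Y k"
      using sum' unfolding has_pole_sum_def by meson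
    show ?thesis
      using that U(1,2) U'(1,2) U(3)[of "U \<union> U' \<union> Z"] U'(3)[of "U \<union> U' \<union> Z"]
      by (intro exI[of _ "U \<union> U' \<union> Z"]) auto
  qed
  have CC: "C' z = C z" if z: "z \<in> prime_to p" for z
  proof -
    have "(C' z \<boxminus> C z) k = 0" for k
    proof -
      obtain Y where Y: "Y \<subseteq> prime_to p" "finite Y" "z \<in> Y"
        and s: "\<forall>k2<Suc k. s k2 = wsum (\<lambda>z. pole_vec p z (C z)) Y k2"
        and s': "\<forall>k2<Suc k. s' k2 = wsum (\<lambda>z. pole_vec p z (C' z)) Y k2"
        using approx[of "{z}" "Suc k"] z by auto
      have eq: "wsum (\<lambda>z. pole_vec p z (C' z \<boxminus> C z)) Y =
          wsum (\<lambda>z. pole_vec p z (C' z)) Y \<boxminus> wsum (\<lambda>z. pole_vec p z (C z)) Y"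
        by (simp add: witt_hom_minus[OF witt_hom_pole_vec] wsum_minus[OF Y(2)])
      have D: "wsum (\<lambda>z. pole_vec p z (C' z \<boxminus> C z)) Y k2 = (s' \<boxminus> s) k2" if "k2 < Suc k" for k2
        unfolding eq using s s' by (intro wminus_cong[OF _ _ that]) auto
      show ?thesis
      proof (rule pole_vec_sum_eq_wp_imp_0[OF chac Y(2) _ _ Y(3), of "Suc k"])
        show "j \<ge> 1 \<and> coprime j p" if "(x, j) \<in> Y" for x j
          using Y(1) that by (auto simp: prime_to_def)
        fix k2 assume k2: "k2 < Suc k"
        show "((ratfun_const \<circ> ?T (c' \<boxminus> c)) \<boxplus> wsum (\<lambda>z. pole_vec p z (C' z \<boxminus> C z)) Y) k2 =
            witt_wp p (ratfun_to_ac \<circ> w) k2"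
          unfolding diff[symmetric] by (rule wadd_cong[OF refl D k2])
      qed simp
    qed
    then have "C' z \<boxminus> C z = (\<lambda>_. 0)" by blast
    then show ?thesis by (simp add: wminus_eq_iff)
  qed
  have "s' k = s k" for k
  proof -
    obtain Y where Y: "Y \<subseteq> prime_to p"
      and "s k = wsum (\<lambda>z. pole_vec p z (C z)) Y k" "s' k = wsum (\<lambda>z. pole_vec p z (C' z)) Y k"
      using approx[of "{}" "Suc k"] by auto
    moreover have "wsum (\<lambda>z. pole_vec p z (C' z)) Y = wsum (\<lambda>z. pole_vec p z (C z)) Y"
      using Y CC by (intro wsum_cong) auto
    ultimately show ?thesis by simp
  qed
  then have "s' \<boxminus> s = (\<lambda>_. 0)" by (simp add: wminus_eq_iff ext)
  then have "ratfun_const \<circ> ?T (c' \<boxminus> c) = witt_wp p (ratfun_to_ac \<circ> w)"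
    using diff by simp
  \<comment> \<open>Both sides now come from W(K), so injectivity of the embedding brings the
    equation down to K, where the trace condition applies.\<close>
  also have "ratfun_const \<circ> ?T (c' \<boxminus> c) = ratfun_to_ac \<circ> (ratfun_const \<circ> teich_scale p \<alpha> (c' \<boxminus> c))"
    by (auto simp: fun_eq_iff ratfun_to_ac_eq_ratmap ratmap_const[OF ring_morph_to_ac])
  finally have "ratfun_const \<circ> teich_scale p \<alpha> (c' \<boxminus> c) = witt_wp p w"
    using ring_morph_inj[OF R] unfolding wp_comp[OF R, symmetric] by (simp add: fun_eq_iff inj_eq)
  \<comment> \<open>Witt subtraction is not componentwise; membership follows because the difference
    is again fixed by F.\<close>
  moreover have "(c' \<boxminus> c) n \<in> prime_subfield" for n
  proof -
    have "witt_frobenius p (c' \<boxminus> c) = c' \<boxminus> c"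
      by (simp add: witt_hom_minus[OF witt_hom_frobenius[OF ch]] frobenius_prime_subfield[OF ch] c c')
    from fun_cong[OF this, of n] show ?thesis
      using ch by (simp add: witt_frobenius_def flip: power_CHAR_eq_iff)
  qed
  ultimately have "(c' \<boxminus> c) n = 0" for n
    by (intro const_eq_wp_imp_0[OF ch \<alpha>]) auto
  then have "c' \<boxminus> c = (\<lambda>_. 0)" by blast
  with \<open>ratfun_const \<circ> teich_scale p \<alpha> (c' \<boxminus> c) = witt_wp p w\<close>
  have "b' \<boxminus> b = (\<lambda>_. 0)"
    unfolding bb' by (auto simp: fun_eq_iff teich_scale_def)
  then show ?thesis by (simp add: wminus_eq_iff)
qed

end

subsection \<open>Existence\<close>

context witt_prime
begin

text \<open>In characteristic \<open>p\<close> this is multiplication by \<open>p\<close>.\<close>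

definition vf :: "(nat \<Rightarrow> 'a::comm_ring_1) \<Rightarrow> nat \<Rightarrow> 'a" where
  "vf a = verschiebung (witt_frobenius p a)"

lemma vf_pow_apply: "(vf ^^ n) a k = (if k < n then 0 else a (k - n) ^ (p ^ n))"
proof (induction n arbitrary: k)
  case (Suc n)
  then show ?case
    using p_gt_0
    by (auto simp: vf_def verschiebung_def witt_frobenius_def power_0_left mult.commute[of p]
        split: nat.split simp flip: power_mult)
qed simp

lemma witt_hom_vf_pow:
  assumes "CHAR('a::comm_ring_1) = p"
  shows "witt_hom p (vf ^^ n :: (nat \<Rightarrow> 'a) \<Rightarrow> _)"
proof (induction n)
  case (Suc n)
  then show ?case
    using witt_hom_add[OF witt_hom_frobenius[OF assms]]
    by (simp add: witt_hom_def vf_def verschiebung_add[OF p])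
qed (simp add: witt_hom_def)

lemma vf_pow_teichmueller: "(vf ^^ n) (teichmueller x) = (verschiebung ^^ n) (teichmueller (x ^ (p ^ n)))"
  using p_gt_0 by (auto simp: fun_eq_iff vf_pow_apply verschiebung_pow_apply teichmueller_def power_0_left)

lemma comp_vf_pow:
  assumes "ring_morph h"
  shows "h \<circ> (vf ^^ n) a = (vf ^^ n) (h \<circ> a)"
  using ring_morph.zero[OF assms] ring_morph.power[OF assms] by (auto simp: fun_eq_iff vf_pow_apply)

lemma pole_vec_vf_pow: "pole_vec p z ((vf ^^ n) a) = (vf ^^ n) (pole_vec p z a)"
  by (induction n) (simp_all add: vf_def pole_vec_verschiebung_frobenius)

lemma teich_scale_vf_pow: "teich_scale p y ((vf ^^ n) a) = (vf ^^ n) (teich_scale p y a)"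
  by (induction n) (simp_all add: vf_def teich_scale_verschiebung)

lemma wp_vf_pow:
  assumes "CHAR('a::comm_ring_1) = p"
  shows "witt_wp p ((vf ^^ n) a) = (vf ^^ n) (witt_wp p (a :: nat \<Rightarrow> 'a))"
proof -
  have "witt_frobenius p ((vf ^^ n) a) = (vf ^^ n) (witt_frobenius p a)"
    using p_gt_0 by (auto simp: fun_eq_iff vf_pow_apply witt_frobenius_def power_0_left mult.commute
        simp flip: power_mult)
  then show ?thesis
    by (simp add: witt_wp_def witt_hom_minus[OF witt_hom_vf_pow[OF assms]])
qed

section \<open>Convergent series of VF powers\<close>

definition vf_partial_sum :: "(nat \<Rightarrow> nat \<Rightarrow> 'a::comm_ring_1) \<Rightarrow> nat \<Rightarrow> nat \<Rightarrow> 'a" where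
  "vf_partial_sum f n = wsum (\<lambda>m. (vf ^^ m) (f m)) {..<n}"

lemma vf_partial_sum_Suc: "vf_partial_sum f (Suc n) = vf_partial_sum f n \<boxplus> (vf ^^ n) (f n)"
  by (simp add: vf_partial_sum_def lessThan_Suc witt_add_commute[OF p])

lemma vf_partial_sum_stable:
  assumes "k < n"
  shows "vf_partial_sum f n k = vf_partial_sum f (Suc k) k"
  using assms
proof (induction n)
  case (Suc n)
  show ?case
  proof (cases "k = n")
    case False
    have "(vf_partial_sum f n \<boxplus> (vf ^^ n) (f n)) k = (vf_partial_sum f n \<boxplus> (\<lambda>_. 0)) k"
      using Suc.prems False by (intro wadd_cong[where n = n]) (auto simp: vf_pow_apply)
    then show ?thesis using Suc False by (simp add: vf_partial_sum_Suc)
  qed simp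
qed simp

text \<open>The limit of the partial sums: component k is read off at stage k + 1, from which point
  on it no longer changes.\<close>

definition vf_sum :: "(nat \<Rightarrow> nat \<Rightarrow> 'a::comm_ring_1) \<Rightarrow> nat \<Rightarrow> 'a" where
  "vf_sum f k = vf_partial_sum f (Suc k) k"

lemma vf_sum_apply: "k < n \<Longrightarrow> vf_sum f k = vf_partial_sum f n k"
  unfolding vf_sum_def by (rule vf_partial_sum_stable[symmetric])

text \<open>The higher components of a Witt sum contain carries and are not partial fraction sums,
  so invariance is tested on the whole vector: the q-Frobenius permutes the Teichmueller summands.
  Each component then descends separately.\<close>

lemma equivariant_teichmueller_sum_in_range:
  fixes D :: "'a::finite_field alg_closure proj_line \<times> nat \<Rightarrow> 'a alg_closure"
  assumes D: "pf_coeffs D" "equivariant D"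
  obtains b :: "nat \<Rightarrow> 'a poly fract" where "ratfun_to_ac \<circ> b =
    (ratfun_const \<circ> (to_ac \<circ> teichmueller x)) \<boxplus> wsum (\<lambda>z. pole_vec p z (teichmueller (D z))) {z. D z \<noteq> 0}"
proof -
  let ?\<phi> = "\<lambda>x :: 'a alg_closure. x ^ CARD('a)"
  let ?S = "{z. D z \<noteq> 0}"
  let ?f = "\<lambda>z. pole_vec p z (teichmueller (D z))"
  let ?h = "\<lambda>(x, j :: nat). (map_proj_line ?\<phi> x, j)"
  let ?v = "(ratfun_const \<circ> (to_ac \<circ> teichmueller x)) \<boxplus> wsum ?f ?S"
  have \<phi>: "?\<phi> \<in> field_auts_fixing (range (to_ac :: 'a \<Rightarrow> _))" by (rule power_card_aut)
  then have bij: "bij ?\<phi>" by (simp add: field_auts_fixing_def)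
  have m: "ring_morph ?\<phi>" by (rule field_aut_ring_morph[OF \<phi>])
  have R: "ring_morph (ratmap ?\<phi>)" by (rule ring_morph_ratmap[OF m])
  have fin: "finite ?S" using D(1) by (simp add: pf_coeffs_def)
  have eqD: "D (map_proj_line ?\<phi> x, j) = ?\<phi> (D (x, j))" for x j
    using D(2) \<phi> unfolding equivariant_def by blast
  have f: "ratmap ?\<phi> \<circ> ?f z = ?f (?h z)" for z
  proof -
    obtain x j where z: "z = (x, j)" by fastforce
    have f: "?f z = teichmueller (ratfun_const (D z) * pole_term z)" for z
      by (simp add: pole_vec_def comp_teichmueller teich_scale_teichmueller)
    have "ratmap ?\<phi> \<circ> ?f z = teichmueller (ratmap ?\<phi> (ratfun_const (D z) * pole_term z))"
      unfolding f by (rule comp_teichmueller) (rule ring_morph.zero[OF R])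
    also have "\<dots> = teichmueller (ratfun_const (D (?h z)) * pole_term (?h z))"
      by (simp add: z ring_morph.mult[OF R] ratmap_const[OF m] ratmap_pole_term[OF m] eqD)
    finally show ?thesis unfolding f .
  qed
  have "ratmap ?\<phi> \<circ> wsum ?f ?S = wsum (\<lambda>z. ?f (?h z)) ?S"
    unfolding witt_hom_sum[OF fin witt_hom_comp[OF R]] f ..
  also have "\<dots> = wsum ?f (?h ` ?S)"
    using map_proj_line_inv(2)[OF bij]
    by (intro wsum_reindex[symmetric]) (auto simp: inj_on_def, metis)
  also have "?h ` ?S = ?S"
    by (rule pf_support_map[where a = D and a' = D, OF \<phi> eqD, symmetric])
  finally have "ratmap ?\<phi> \<circ> wsum ?f ?S = wsum ?f ?S" .
  moreover have "ratmap ?\<phi> \<circ> (ratfun_const \<circ> (to_ac \<circ> teichmueller x)) = ratfun_const \<circ> (to_ac \<circ> teichmueller x)"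
    by (auto simp: fun_eq_iff ratmap_const[OF m] finite_field_power_card_eq_same simp del: to_ac_power simp flip: to_ac_power)
  ultimately have fixed: "ratmap ?\<phi> \<circ> ?v = ?v"
    unfolding witt_hom_add[OF witt_hom_comp[OF R]] by simp
  have "ratmap ?\<phi> (?v n) = ?v n" for n
    using fun_cong[OF fixed, of n] by (simp only: comp_apply)
  then have "?v n \<in> range ratfun_to_ac" for n by (rule ratmap_fixed_imp_range)
  then have "\<forall>n. \<exists>r. ?v n = ratfun_to_ac r" by blast
  then obtain b where "\<forall>n. ?v n = ratfun_to_ac (b n)" by (rule choice[THEN exE])
  then have "ratfun_to_ac \<circ> b = ?v" by (intro ext) (simp only: comp_apply)
  then show ?thesis by (rule that)
qed

text \<open>One round of the iteration: b is a Witt vector over K in normal form with Teichmueller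
  coefficients that accounts for component 0 of \<open>a\<close>, and a' is the remainder after
  division by VF.\<close>

definition wp_step ::
    "'a::finite_field \<Rightarrow> (nat \<Rightarrow> 'a poly fract) \<Rightarrow> 'a \<Rightarrow> ('a alg_closure proj_line \<times> nat \<Rightarrow> 'a alg_closure) \<Rightarrow>
     (nat \<Rightarrow> 'a poly fract) \<Rightarrow> (nat \<Rightarrow> 'a poly fract) \<Rightarrow> (nat \<Rightarrow> 'a poly fract) \<Rightarrow> bool" where
  "wp_step \<alpha> a c D b w a' \<longleftrightarrow>
    c \<in> prime_subfield \<and> finite {z. D z \<noteq> 0} \<and> equivariant D \<and> {z. D z \<noteq> 0} \<subseteq> prime_to p \<and>
    ratfun_to_ac \<circ> b = (ratfun_const \<circ> (to_ac \<circ> teich_scale p \<alpha> (teichmueller c))) \<boxplus>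
      wsum (\<lambda>z. pole_vec p z (teichmueller (D z))) {z. D z \<noteq> 0} \<and>
    a = b \<boxplus> witt_wp p w \<boxplus> vf a'"

lemma wp_step_exists:
  fixes a :: "nat \<Rightarrow> 'a::finite_field poly fract"
  assumes ch: "CHAR('a) = p" and \<alpha>: "abs_trace (\<alpha> :: 'a) \<noteq> 0"
  shows "\<exists>c D b w a'. wp_step \<alpha> a c D b w a'"
proof -
  have chF: "CHAR('a poly fract) = p" using ch by simp
  have R: "ring_morph (ratfun_to_ac :: 'a poly fract \<Rightarrow> _)"
    unfolding ratfun_to_ac_eq_ratmap by (rule ring_morph_ratmap[OF ring_morph_to_ac])
  obtain c D u where c: "c \<in> prime_subfield" and D: "pf_coeffs D" "equivariant D"
    and supp: "\<And>x j. D (x, j) \<noteq> 0 \<Longrightarrow> j \<ge> 1 \<and> coprime j p"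
    and a0: "ratfun_to_ac (a 0) = ratfun_const (to_ac (c * \<alpha>)) + pf_sum D + ratfun_to_ac (u ^ p - u)"
    by (rule length_one_decomposition[OF ch \<alpha>, of "a 0"]) (rule that; (assumption | blast))
  obtain b where b: "ratfun_to_ac \<circ> b = (ratfun_const \<circ> (to_ac \<circ> teichmueller (c * \<alpha>))) \<boxplus>
      wsum (\<lambda>z. pole_vec p z (teichmueller (D z))) {z. D z \<noteq> 0}"
    by (rule equivariant_teichmueller_sum_in_range[OF D])
  have fin: "finite {z. D z \<noteq> 0}" using D(1) by (simp add: pf_coeffs_def)
  have "ratfun_to_ac (b 0) = ratfun_const (to_ac (c * \<alpha>)) + pf_sum D"
    using fun_cong[OF b, of 0] fin
    by (simp add: witt_add_apply_0[OF p] wsum_apply_0 pole_vec_apply pf_sum_def teichmueller_def)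
  then have "ratfun_to_ac (a 0) = ratfun_to_ac (b 0 + (u ^ p - u))"
    using a0 by (simp add: ring_morph.add[OF R])
  then have a0: "a 0 = b 0 + (u ^ p - u)" by (rule injD[OF ring_morph_inj[OF R]])
  define t where "t = teichmueller u"
  define a' where "a' = (\<lambda>k. (a \<boxminus> (b \<boxplus> witt_wp p t)) (Suc k))"
  have "a \<boxminus> (b \<boxplus> witt_wp p t) = verschiebung a'"
    unfolding a'_def by (rule eq_verschiebung)
      (simp add: wminus_apply_0 witt_add_apply_0[OF p] wp_apply_0 t_def teichmueller_def a0)
  then have "a = verschiebung a' \<boxplus> (b \<boxplus> witt_wp p t)" unfolding wminus_eq_iff .
  \<comment> \<open>The division leaves V a'. Writing it as VF a' - \<wp>(V a') explains why the
    witness for w is t - V a'.\<close>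
  moreover have "vf a' = verschiebung a' \<boxplus> witt_wp p (verschiebung a')"
    unfolding vf_def frobenius_verschiebung[symmetric] by (rule frobenius_eq_add_wp)
  moreover have "witt_wp p t = witt_wp p (t \<boxminus> verschiebung a') \<boxplus> witt_wp p (verschiebung a')"
    unfolding witt_hom_minus[OF witt_hom_wp[OF chF]] by simp
  ultimately have "a = b \<boxplus> witt_wp p (t \<boxminus> verschiebung a') \<boxplus> vf a'"
    by (simp only: wadd_ac)
  moreover have "{z. D z \<noteq> 0} \<subseteq> prime_to p" using supp by (auto simp: prime_to_def)
  ultimately have "wp_step \<alpha> a c D b (t \<boxminus> verschiebung a') a'"
    unfolding wp_step_def teich_scale_teichmueller using b c D(2) fin by blast
  then show ?thesis by blast
qed

text \<open>Iterating \<open>wp_step\<close> writes \<open>a\<close> as the sum of (VF)^n B_n plus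
  \<wp> of the sum of (VF)^n W_n. Both series converge because (VF)^n vanishes below component
  n.\<close>

theorem normal_form_exists:
  fixes a :: "nat \<Rightarrow> 'a::finite_field poly fract"
  assumes ch: "CHAR('a) = p" and \<alpha>: "abs_trace (\<alpha> :: 'a) \<noteq> 0"
  obtains b w c C s where "a \<boxminus> b = witt_wp p w" "\<And>n. c n \<in> prime_subfield"
    "\<And>\<sigma> x i. \<sigma> \<in> field_auts_fixing (range (to_ac :: 'a \<Rightarrow> _)) \<Longrightarrow> C (map_proj_line \<sigma> x, i) = \<sigma> \<circ> C (x, i)"
    "\<And>n. finite {z. witt_val (C z) \<le> enat n}"
    "has_pole_sum p C s" "ratfun_to_ac \<circ> b = (ratfun_const \<circ> (to_ac \<circ> teich_scale p \<alpha> c)) \<boxplus> s"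
proof -
  have chF: "CHAR('a poly fract) = p" and chacF: "CHAR('a alg_closure poly fract) = p" using ch by simp_all
  have R: "ring_morph (ratfun_to_ac :: 'a poly fract \<Rightarrow> _)"
    unfolding ratfun_to_ac_eq_ratmap by (rule ring_morph_ratmap[OF ring_morph_to_ac])
  have "\<forall>a. \<exists>c D b w a'. wp_step \<alpha> a c D b w a'" using wp_step_exists[OF ch \<alpha>] by blast
  then obtain fc fD fb fw fa where step: "\<And>a. wp_step \<alpha> a (fc a) (fD a) (fb a) (fw a) (fa a)"
    by metis
  define A where "A n = (fa ^^ n) a" for n
  have A: "A 0 = a" "A (Suc n) = fa (A n)" for n by (simp_all add: A_def)
  define c where "c n = fc (A n)" for n
  define D where "D n = fD (A n)" for n
  define B where "B n = fb (A n)" for n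
  define W where "W n = fw (A n)" for n
  have st: "wp_step \<alpha> (A n) (c n) (D n) (B n) (W n) (A (Suc n))" for n
    unfolding c_def D_def B_def W_def A(2) by (rule step)
  \<comment> \<open>The exponent comes from (VF)^n [d] = V^n [d^(p^n)]. For the constants it is
    invisible, since elements of the prime field are their own p-th powers.\<close>
  define C where "C z n = D n z ^ (p ^ n)" for z n
  have c: "c n \<in> prime_subfield" for n using st[of n] by (simp add: wp_step_def)
  have fin: "finite {z. D n z \<noteq> 0}" for n using st[of n] by (simp add: wp_step_def)
  have supp: "{z. D n z \<noteq> 0} \<subseteq> prime_to p" for n using st[of n] by (simp add: wp_step_def)
  have eqv: "equivariant (D n)" for n using st[of n] by (simp add: wp_step_def)
  have An: "A n = B n \<boxplus> witt_wp p (W n) \<boxplus> vf (A (Suc n))" for n using st[of n] unfolding wp_step_def by blast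
  have a: "a = vf_partial_sum B n \<boxplus> witt_wp p (vf_partial_sum W n) \<boxplus> (vf ^^ n) (A n)" for n
  proof (induction n)
    case 0
    have "witt_wp p (\<lambda>_. 0 :: 'a poly fract) = (\<lambda>_. 0)" by (rule witt_hom_0[OF witt_hom_wp[OF chF]])
    then show ?case by (simp add: A vf_partial_sum_def)
  next
    case (Suc n)
    note hom = witt_hom_add[OF witt_hom_vf_pow[OF chF]]
    have "(vf ^^ n) (A n) = (vf ^^ n) (B n) \<boxplus> (vf ^^ n) (witt_wp p (W n)) \<boxplus> (vf ^^ n) (vf (A (Suc n)))"
      by (subst An) (simp only: hom)
    also have "(vf ^^ n) (vf (A (Suc n))) = (vf ^^ Suc n) (A (Suc n))" by (simp add: funpow_swap1)
    finally have vfA: "(vf ^^ n) (A n) =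
      (vf ^^ n) (B n) \<boxplus> witt_wp p ((vf ^^ n) (W n)) \<boxplus> (vf ^^ Suc n) (A (Suc n))"
      by (simp only: wp_vf_pow[OF chF])
    have "a = vf_partial_sum B n \<boxplus> witt_wp p (vf_partial_sum W n) \<boxplus>
      ((vf ^^ n) (B n) \<boxplus> witt_wp p ((vf ^^ n) (W n)) \<boxplus> (vf ^^ Suc n) (A (Suc n)))"
      using Suc unfolding vfA .
    then show ?case
      unfolding vf_partial_sum_Suc witt_hom_add[OF witt_hom_wp[OF chF]] by (simp only: wadd_ac)
  qed
  define b where "b = vf_sum B"
  define w where "w = vf_sum W"
  have "a = witt_wp p w \<boxplus> b"
  proof
    fix k
    \<comment> \<open>At stage k + 1 component k of both limits is already reached, and the
      remainder contributes nothing to it.\<close>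
    have "(vf_partial_sum B (Suc k) \<boxplus> witt_wp p (vf_partial_sum W (Suc k)) \<boxplus> (vf ^^ Suc k) (A (Suc k))) k =
        (b \<boxplus> witt_wp p w \<boxplus> (\<lambda>_. 0)) k"
      by (intro wadd_cong[where n = "Suc k"] wp_cong[where n = "Suc k"])
        (simp_all add: b_def w_def vf_sum_apply vf_pow_apply del: funpow.simps)
    then show "a k = (witt_wp p w \<boxplus> b) k"
      using a[of "Suc k"] by (simp add: witt_add_commute[OF p])
  qed
  then have ab: "a \<boxminus> b = witt_wp p w" unfolding wminus_eq_iff .
  let ?T = "\<lambda>x. ratfun_const \<circ> (to_ac \<circ> teich_scale p \<alpha> x) :: nat \<Rightarrow> 'a alg_closure poly fract"
  have hom_T: "witt_hom p ?T"
    by (simp add: witt_hom_def teich_scale_add[OF p] ring_morph.witt_op[OF ring_morph_to_ac]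
        ring_morph.witt_op[OF ring_morph_ratfun_const])
  have T_vf: "?T ((vf ^^ n) x) = (vf ^^ n) (?T x)" for n x
    by (simp only: teich_scale_vf_pow comp_vf_pow[OF ring_morph_to_ac] comp_vf_pow[OF ring_morph_ratfun_const])
  have c_pow: "c n ^ p ^ k = c n" for n k
    using c[of n] ch by (induction k) (simp_all add: power_mult flip: power_CHAR_eq_iff)
  \<comment> \<open>Y may be any finite set containing the first n supports, because convergence is
    a statement about all large finite sets; outside those supports the truncated coefficients are
    0.\<close>
  have B: "ratfun_to_ac \<circ> vf_partial_sum B n = ?T (witt_trunc n c) \<boxplus> wsum (\<lambda>z. pole_vec p z (witt_trunc n (C z))) Y"
    if Y: "finite Y" "(\<Union>m<n. {z. D m z \<noteq> 0}) \<subseteq> Y" for n Y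
    using Y(2)
  proof (induction n)
    case 0
    have tr: "witt_trunc 0 x = (\<lambda>_. 0)" for x :: "nat \<Rightarrow> 'x::zero" by (simp add: witt_trunc_def fun_eq_iff)
    have "wsum (\<lambda>z. pole_vec p z (\<lambda>_. 0)) Y = (\<lambda>_ . 0 :: 'a alg_closure poly fract)"
      using wsum_mono_neutral[OF Y(1), of "{}" "\<lambda>z. pole_vec p z (\<lambda>_. 0 :: 'a alg_closure)"]
      by (simp add: witt_hom_0[OF witt_hom_pole_vec])
    then show ?case
      unfolding tr witt_hom_0[OF hom_T] by (simp add: vf_partial_sum_def fun_eq_iff ring_morph.zero[OF R])
  next
    case (Suc n)
    note vhom = witt_hom_vf_pow[OF chacF]
    have Dn: "{z. D n z \<noteq> 0} \<subseteq> Y" using Suc.prems by (auto simp: lessThan_Suc)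
    have IH: "ratfun_to_ac \<circ> vf_partial_sum B n = ?T (witt_trunc n c) \<boxplus> wsum (\<lambda>z. pole_vec p z (witt_trunc n (C z))) Y"
      using Suc.prems by (intro Suc.IH) (auto simp: lessThan_Suc)
    have Bn: "ratfun_to_ac \<circ> B n = ?T (teichmueller (c n)) \<boxplus>
        wsum (\<lambda>z. pole_vec p z (teichmueller (D n z))) {z. D n z \<noteq> 0}"
      using st[of n] unfolding wp_step_def by blast
    have "teichmueller 0 = (\<lambda>_. 0 :: 'a alg_closure)" by (simp add: teichmueller_def fun_eq_iff)
    then have "wsum (\<lambda>z. pole_vec p z (teichmueller (D n z))) {z. D n z \<noteq> 0} =
        wsum (\<lambda>z. pole_vec p z (teichmueller (D n z))) Y"
      using Dn by (intro wsum_mono_neutral[OF Y(1)]) (auto simp: witt_hom_0[OF witt_hom_pole_vec])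
    then have "ratfun_to_ac \<circ> (vf ^^ n) (B n) = ?T ((vf ^^ n) (teichmueller (c n))) \<boxplus>
        wsum (\<lambda>z. pole_vec p z ((vf ^^ n) (teichmueller (D n z)))) Y"
      unfolding comp_vf_pow[OF R] Bn T_vf pole_vec_vf_pow witt_hom_add[OF vhom] witt_hom_sum[OF Y(1) vhom, symmetric]
      by simp
    also have "\<dots> = ?T ((verschiebung ^^ n) (teichmueller (c n))) \<boxplus>
        wsum (\<lambda>z. pole_vec p z ((verschiebung ^^ n) (teichmueller (C z n)))) Y"
      by (simp only: vf_pow_teichmueller c_pow C_def)
    finally have "ratfun_to_ac \<circ> vf_partial_sum B (Suc n) =
        (?T (witt_trunc n c) \<boxplus> wsum (\<lambda>z. pole_vec p z (witt_trunc n (C z))) Y) \<boxplus>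
        (?T ((verschiebung ^^ n) (teichmueller (c n))) \<boxplus>
          wsum (\<lambda>z. pole_vec p z ((verschiebung ^^ n) (teichmueller (C z n)))) Y)"
      unfolding vf_partial_sum_Suc witt_hom_add[OF witt_hom_comp[OF R]] IH by simp
    also have "\<dots> = ?T (witt_trunc (Suc n) c) \<boxplus> wsum (\<lambda>z. pole_vec p z (witt_trunc (Suc n) (C z))) Y"
      unfolding witt_trunc_Suc[OF p] witt_hom_add[OF hom_T] witt_hom_add[OF witt_hom_pole_vec] wsum_add[OF Y(1)]
      by (simp only: wadd_ac)
    finally show ?case .
  qed
  \<comment> \<open>Taking s as the difference makes the required equation immediate; that it is the
    limit of the pole sums is then read off from the truncated identities.\<close>
  define s where "s = (ratfun_to_ac \<circ> b) \<boxminus> ?T c"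
  have bs: "ratfun_to_ac \<circ> b = ?T c \<boxplus> s" unfolding s_def by (simp only: witt_add_commute[OF p, of "?T c"] wminus_add_cancel)
  have sum: "has_pole_sum p C s"
    unfolding has_pole_sum_def
  proof (intro allI exI conjI impI)
    fix j
    let ?U = "\<Union>m<j. {z. D m z \<noteq> 0}"
    show "finite ?U" using fin by auto
    show "?U \<subseteq> prime_to p" using supp by auto
    fix Y k assume Y: "finite Y \<and> ?U \<subseteq> Y \<and> Y \<subseteq> prime_to p" and k: "k < j"
    have "s k = ((ratfun_to_ac \<circ> vf_partial_sum B j) \<boxminus> ?T (witt_trunc j c)) k"
      unfolding s_def by (rule wminus_cong[where n = j])
        (use k in \<open>simp_all add: b_def vf_sum_apply teich_scale_def witt_trunc_def\<close>)
    also have "(ratfun_to_ac \<circ> vf_partial_sum B j) \<boxminus> ?T (witt_trunc j c) = wsum (\<lambda>z. pole_vec p z (witt_trunc j (C z))) Y"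
      using B[of Y j] Y unfolding wminus_eq_iff by (simp only: witt_add_commute[OF p])
    also have "\<dots> k = wsum (\<lambda>z. pole_vec p z (C z)) Y k"
      by (rule wsum_cong_trunc[where n = j]) (use Y k in \<open>auto simp: pole_vec_apply witt_trunc_def\<close>)
    finally show "s k = wsum (\<lambda>z. pole_vec p z (C z)) Y k" .
  qed
  have eqC: "C (map_proj_line \<sigma> x, i) = \<sigma> \<circ> C (x, i)"
    if "\<sigma> \<in> field_auts_fixing (range (to_ac :: 'a \<Rightarrow> _))" for \<sigma> x i
    using eqv that ring_morph.power[OF field_aut_ring_morph[OF that]]
    by (simp add: fun_eq_iff C_def equivariant_def)
  have finC: "finite {z. witt_val (C z) \<le> enat n}" for n
  proof (rule finite_subset)
    \<comment> \<open>Valuation at most n means that some component of index at most n is nonzero,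
      which places z in one of finitely many finite supports.\<close>
    show "{z. witt_val (C z) \<le> enat n} \<subseteq> (\<Union>m\<le>n. {z. D m z \<noteq> 0})"
    proof
      fix z assume "z \<in> {z. witt_val (C z) \<le> enat n}"
      then have nz: "\<exists>j. C z j \<noteq> 0" and le: "(LEAST j. C z j \<noteq> 0) \<le> n"
        by (auto simp: witt_val_def split: if_splits)
      from LeastI_ex[OF nz] have "D (LEAST j. C z j \<noteq> 0) z \<noteq> 0"
        by (auto simp: C_def[of z "LEAST j. C z j \<noteq> 0"] p_gt_0)
      then show "z \<in> (\<Union>m\<le>n. {z. D m z \<noteq> 0})" using le by blast
    qed
  qed (use fin in auto)
  show ?thesis
    by (rule that[of b w c C s]) (fact ab c eqC finC sum bs)+
qed

end

theorem lemma5p8: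
  fixes p :: nat and \<alpha> :: "'a::finite_field" and a :: "nat \<Rightarrow> 'a poly fract"
  assumes "CHAR('a) = p"
    and "abs_trace \<alpha> \<noteq> 0"
  shows "\<exists>!b :: nat \<Rightarrow> 'a poly fract.
    (\<exists>w. a \<ominus>\<^bsub>witt_ring p\<^esub> b = witt_wp p w) \<and>
    (\<exists>(c :: nat \<Rightarrow> 'a)
      (C :: 'a alg_closure proj_line \<Rightarrow> nat \<Rightarrow> nat \<Rightarrow> 'a alg_closure)
      (s :: nat \<Rightarrow> 'a alg_closure poly fract).
      (\<forall>n. c n \<in> prime_subfield) \<and>
      (\<forall>\<sigma>\<in>field_auts_fixing (Set.range to_ac). \<forall>x. \<forall>i\<ge>1. coprime i p \<longrightarrow>
         C (map_proj_line \<sigma> x) i = \<sigma> \<circ> C x i) \<and>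
      (\<forall>n\<ge>1::nat. finite {(x, i). i \<ge> 1 \<and> coprime i p \<and> witt_val (C x i) \<le> enat n}) \<and>
      has_witt_sum p
        (\<lambda>(x, i). (ratfun_const \<circ> C x i) \<otimes>\<^bsub>witt_ring p\<^esub>
           (teichmueller (local_param x) [^]\<^bsub>witt_ring p\<^esub> (- int i)))
        {(x, i). i \<ge> 1 \<and> coprime i p} s \<and>
      ratfun_to_ac \<circ> b =
        ((ratfun_const \<circ> to_ac \<circ> c) \<otimes>\<^bsub>witt_ring p\<^esub> (ratfun_const \<circ> to_ac \<circ> teichmueller \<alpha>))
          \<oplus>\<^bsub>witt_ring p\<^esub> s)"
    (is "\<exists>!b. ?Q b")
proof -
  interpret witt_prime p
    using assms(1) by unfold_locales auto
  have chF: "CHAR('a poly fract) = p" using assms(1) by simp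
  show ?thesis
  proof (rule ex_ex1I)
    obtain b w c C s where ab: "a \<boxminus> b = witt_wp p w" and c: "\<And>n. c n \<in> prime_subfield"
      and eqv: "\<And>\<sigma> x i. \<sigma> \<in> field_auts_fixing (range (to_ac :: 'a \<Rightarrow> _)) \<Longrightarrow> C (map_proj_line \<sigma> x, i) = \<sigma> \<circ> C (x, i)"
      and fin: "\<And>n. finite {z. witt_val (C z) \<le> enat n}"
      and s: "has_pole_sum p C s" and b: "ratfun_to_ac \<circ> b = (ratfun_const \<circ> (to_ac \<circ> teich_scale p \<alpha> c)) \<boxplus> s"
      by (rule normal_form_exists[OF assms, of a]) (rule that; (assumption | blast))
    have "finite {(x, i). i \<ge> 1 \<and> coprime i p \<and> witt_val (C (x, i)) \<le> enat n}" for n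
      by (rule finite_subset[OF _ fin[of n]]) auto
    moreover have "has_pole_sum p (\<lambda>z. C (fst z, snd z)) s" using s by simp
    ultimately show "\<exists>b. ?Q b"
      unfolding has_witt_sum_iff mult_const_teichmueller witt_ring_simps(2)
      using ab c eqv b by (intro exI[of _ b] conjI exI[of _ w] exI[of _ c] exI[of _ "\<lambda>x i. C (x, i)"] exI[of _ s]) auto
  next
    fix b b' assume Q: "?Q b" and Q': "?Q b'"
    obtain w c C s where w: "a \<boxminus> b = witt_wp p w" and c: "\<And>n. c n \<in> prime_subfield"
      and s: "has_pole_sum p (\<lambda>z. C (fst z) (snd z)) s"
      and b: "ratfun_to_ac \<circ> b = (ratfun_const \<circ> (to_ac \<circ> teich_scale p \<alpha> c)) \<boxplus> s"
      using Q unfolding has_witt_sum_iff mult_const_teichmueller witt_ring_simps(2) by blast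
    obtain w' c' C' s' where w': "a \<boxminus> b' = witt_wp p w'" and c': "\<And>n. c' n \<in> prime_subfield"
      and s': "has_pole_sum p (\<lambda>z. C' (fst z) (snd z)) s'"
      and b': "ratfun_to_ac \<circ> b' = (ratfun_const \<circ> (to_ac \<circ> teich_scale p \<alpha> c')) \<boxplus> s'"
      using Q' unfolding has_witt_sum_iff mult_const_teichmueller witt_ring_simps(2) by blast
    \<comment> \<open>Both sides equal \<open>a\<close>. Two normal forms of the same vector thus
      differ by \<wp>(w' - w), the hypothesis of the uniqueness theorem.\<close>
    have "witt_wp p w' \<boxplus> b' = witt_wp p w \<boxplus> b"
      using w w' by (simp add: wminus_eq_iff)
    then have "b \<boxminus> b' = witt_wp p w' \<boxminus> witt_wp p w"
      unfolding wminus_eq_iff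
      by (metis wadd_minus_cancel wminus_add_cancel witt_add_assoc[OF p] witt_add_commute[OF p])
    then have "b \<boxminus> b' = witt_wp p (w' \<boxminus> w)"
      by (simp add: witt_hom_minus[OF witt_hom_wp[OF chF]])
    from normal_form_unique[OF assms this c' c s' s b' b] show "b = b'" .
  qed
qed

end
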